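(* Let $f\in\mathbb{K}[[X]][Y]$ be a quasi-ordinary irreducible polynomial of characteristic $(h_1,\dots,h_s)$, and let $g\in\mathbb{K}[[X]][Y]$ be a Weierstrass polynomial with $\deg g\le n_1\cdots n_k$ for some $1\le k\le s$. Assume that every monomial $X^a$ appearing with nonzero coefficient in $\mathrm{Res}(f,g)$ satisfies $a>(\deg g)\,q_k$ (i.e. $a-(\deg g)q_k\in\mathbb{Q}_{\ge0}^d\setminus\{0\}$). Then: (i) $g$ is irreducible and quasi-ordinary, $\deg g=n_1\cdots n_k$, and the characteristic of $g$ is $(h_1,\dots,h_k)$; (ii) for every $\gamma\in\mathrm{Zer}\,g$ there exists $\alpha\in\mathrm{Zer}\,f$ such that $\gamma-\alpha=\sum_{h>h_k}c_hX^h$ (a fractional power series all of whose exponents $h$ satisfy $h>h_k$). Moreover, if $k\le s-1$ and $X^{(\deg g)q_{k+1}}$ divides $\mathrm{Res}(f,g)$, then: (iii) $\mathrm{Res}(f,g)=u(X)\,X^{(\deg g)q_{k+1}}$ with $u(0)\ne0$; (iv) for every $\gamma\in\mathrm{Zer}\,g$ there exists $\alpha\in\mathrm{Zer}\,f$ such that $\gamma-\alpha=c_{h_{k+1}}X^{h_{k+1}}+\sum_{h>h_{k+1}}c_hX^h$.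
   Context: $\mathbb{K}$ is an algebraically closed field of characteristic zero; $\mathbb{K}[[X]]=\mathbb{K}[[X_1,\dots,X_d]]$, $\mathbb{K}[[X^{1/m}]]=\mathbb{K}[[X_1^{1/m},\dots,X_d^{1/m}]]$, and $X^q=X_1^{q_1}\cdots X_d^{q_d}$. A monic polynomial $f=Y^n+a_{n-1}(X)Y^{n-1}+\dots+a_0(X)\in\mathbb{K}[[X]][Y]$ is quasi-ordinary if its discriminant equals $u(X)X^q$ with $u(0)\ne0$; it is a Weierstrass polynomial if $a_i(0)=0$ for all $i$. A quasi-ordinary polynomial has all its roots in $\mathbb{K}[[X^{1/m}]]$ for some $m$ (Abhyankar–Jung); $\mathrm{Zer}\,f$ denotes its set of roots. For distinct roots $\alpha_i,\alpha_j$ one has $\alpha_i-\alpha_j=u_{ij}X^{\lambda_{ij}}$ with $u_{ij}(0)\ne0$, and $d(\alpha_i,\alpha_j):=\lambda_{ij}\in\mathbb{Q}_{\ge0}^d$ is their contact. Partial order on $\mathbb{Q}^d_{\ge0}$: $q\le q'$ iff $q'-q\in\mathbb{Q}_{\ge0}^d$, and $q<q'$ means $q\le q'$, $q\neq q'$. For irreducible quasi-ordinary $f$ the contacts between distinct roots (characteristic exponents) form an increasing sequence $h_1<\dots<h_s$, called the characteristic of $f$. Set $M_0=\mathbb{Z}^d$, $M_i=\mathbb{Z}^d+\mathbb{Z}h_1+\dots+\mathbb{Z}h_i$, $n_i=[M_i:M_{i-1}]$ ($1\le i\le s$), $n_{s+1}=1$, $e_i=n_{i+1}\cdots n_{s+1}$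 ($0\le i\le s$), so that $\deg f=n_1\cdots n_s$, and $q_i=\sum_{j=1}^{i}(e_{j-1}-e_j)h_j+e_ih_i$ for $i=1,\dots,s$. $\mathrm{Res}(f,g)$ is the resultant with respect to $Y$. *)

theory Defs
  imports "HOL-Combinatorics.Permutations" "HOL-Computational_Algebra.Polynomial"
begin

text \<open>
  Conventions.  The number of variables d is the cardinality of a finite index type 'n.
  Exponent vectors are elements of Q^d, i.e. functions 'n => rat; they are compared with
  the pointwise (partial) order of Main, so a < b means a <= b and a ~= b, as in the paper.
  A (fractional) power series is represented by its coefficient function
  ('n => rat) => 'a, the coefficient of X^a.  It lies in K[[X^(1/m)]] iff its support
  is contained in (1/m) N^d.  K[[X]] is the case m = 1.  Ring operations on series
  are defined explicitly (Cauchy product).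
\<close>

type_synonym ('n, 'a) ser = "('n \<Rightarrow> rat) \<Rightarrow> 'a"

definition frac_supp :: "nat \<Rightarrow> ('n, 'a::zero) ser \<Rightarrow> bool" where
  "frac_supp m s \<longleftrightarrow> 0 < m \<and>
     (\<forall>a. s a \<noteq> 0 \<longrightarrow> (\<forall>i. 0 \<le> a i \<and> of_nat m * a i \<in> \<int>))"

definition is_pser :: "('n, 'a::zero) ser \<Rightarrow> bool" where
  "is_pser s \<longleftrightarrow> frac_supp 1 s"

definition is_fser :: "('n, 'a::zero) ser \<Rightarrow> bool" where
  "is_fser s \<longleftrightarrow> (\<exists>m. frac_supp m s)"

definition ser_zero :: "('n, 'a::zero) ser" where
  "ser_zero = (\<lambda>a. 0)"

definition ser_one :: "('n, 'a::{zero,one}) ser" where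
  "ser_one = (\<lambda>a. if a = (\<lambda>i. 0) then 1 else 0)"

definition ser_monom :: "('n \<Rightarrow> rat) \<Rightarrow> ('n, 'a::{zero,one}) ser" where
  "ser_monom e = (\<lambda>a. if a = e then 1 else 0)"

definition ser_diff :: "('n, 'a::ab_group_add) ser \<Rightarrow> ('n, 'a) ser \<Rightarrow> ('n, 'a) ser" where
  "ser_diff s t = (\<lambda>a. s a - t a)"

text \<open>Cauchy product; the index set is finite for series with bounded denominators.\<close>
definition ser_mul :: "('n, 'a::comm_ring_1) ser \<Rightarrow> ('n, 'a) ser \<Rightarrow> ('n, 'a) ser" where
  "ser_mul s t = (\<lambda>a. \<Sum>b \<in> {b. s b \<noteq> 0 \<and> t (\<lambda>i. a i - b i) \<noteq> 0}. s b * t (\<lambda>i. a i - b i))"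

primrec ser_pow :: "('n, 'a::comm_ring_1) ser \<Rightarrow> nat \<Rightarrow> ('n, 'a) ser" where
  "ser_pow s 0 = ser_one"
| "ser_pow s (Suc k) = ser_mul s (ser_pow s k)"

definition ser_listprod :: "('n, 'a::comm_ring_1) ser list \<Rightarrow> ('n, 'a) ser" where
  "ser_listprod xs = foldr ser_mul xs ser_one"

text \<open>Polynomials in Y over K[[X]]: coefficient of Y^i is the i-th value.\<close>
type_synonym ('n, 'a) ypol = "nat \<Rightarrow> ('n, 'a) ser"

definition ypoly :: "('n, 'a::zero) ypol \<Rightarrow> bool" where
  "ypoly F \<longleftrightarrow> (\<forall>i. is_pser (F i)) \<and> finite {i. F i \<noteq> ser_zero}"

definition ydeg :: "('n, 'a::zero) ypol \<Rightarrow> nat" where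
  "ydeg F = Max ({i. F i \<noteq> ser_zero} \<union> {0})"

definition ymul :: "('n, 'a::comm_ring_1) ypol \<Rightarrow> ('n, 'a) ypol \<Rightarrow> ('n, 'a) ypol" where
  "ymul A B = (\<lambda>k a. \<Sum>j\<le>k. ser_mul (A j) (B (k - j)) a)"

definition yone :: "('n, 'a::{zero,one}) ypol" where
  "yone = (\<lambda>k. if k = 0 then ser_one else ser_zero)"

definition yunit :: "('n, 'a::comm_ring_1) ypol \<Rightarrow> bool" where
  "yunit F \<longleftrightarrow> (\<exists>B. ypoly B \<and> ymul F B = yone)"

definition yirreducible :: "('n, 'a::comm_ring_1) ypol \<Rightarrow> bool" where
  "yirreducible F \<longleftrightarrow> ypoly F \<and> F \<noteq> (\<lambda>k. ser_zero) \<and> \<not> yunit F \<and>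
     (\<forall>A B. ypoly A \<and> ypoly B \<and> F = ymul A B \<longrightarrow> yunit A \<or> yunit B)"

definition ymonic :: "('n, 'a::{zero,one}) ypol \<Rightarrow> bool" where
  "ymonic F \<longleftrightarrow> ypoly F \<and> F (ydeg F) = ser_one"

definition weierstrass :: "('n, 'a::{zero,one}) ypol \<Rightarrow> bool" where
  "weierstrass F \<longleftrightarrow> ymonic F \<and> (\<forall>i < ydeg F. F i (\<lambda>j. 0) = 0)"

definition yderiv :: "('n, 'a::comm_ring_1) ypol \<Rightarrow> ('n, 'a) ypol" where
  "yderiv F = (\<lambda>i a. of_nat (Suc i) * F (Suc i) a)"

definition sylvester :: "('n, 'a::zero) ypol \<Rightarrow> ('n, 'a) ypol \<Rightarrow> nat \<Rightarrow> nat \<Rightarrow> ('n, 'a) ser" where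
  "sylvester F G i j =
     (let n = ydeg F; m = ydeg G in
      if i < m then (if i \<le> j \<and> j \<le> i + n then F (n + i - j) else ser_zero)
      else (if i - m \<le> j \<and> j \<le> i - m + m then G (m + (i - m) - j) else ser_zero))"

definition yres :: "('n, 'a::comm_ring_1) ypol \<Rightarrow> ('n, 'a) ypol \<Rightarrow> ('n, 'a) ser" where
  "yres F G = (let N = ydeg F + ydeg G in
     (\<lambda>a. \<Sum>p \<in> {p. p permutes {..<N}}.
        of_int (sign p) * ser_listprod (map (\<lambda>i. sylvester F G i (p i)) [0..<N]) a))"

definition ydisc :: "('n, 'a::comm_ring_1) ypol \<Rightarrow> ('n, 'a) ser" where
  "ydisc F = (\<lambda>a. (- 1) ^ (ydeg F * (ydeg F - 1) div 2) * yres F (yderiv F) a)"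

definition quasi_ordinary :: "('n, 'a::comm_ring_1) ypol \<Rightarrow> bool" where
  "quasi_ordinary F \<longleftrightarrow> ymonic F \<and>
     (\<exists>u q. is_pser u \<and> u (\<lambda>i. 0) \<noteq> 0 \<and> ydisc F = ser_mul u (ser_monom q))"

definition yeval :: "('n, 'a::comm_ring_1) ypol \<Rightarrow> ('n, 'a) ser \<Rightarrow> ('n, 'a) ser" where
  "yeval F g = (\<lambda>a. \<Sum>i\<le>ydeg F. ser_mul (F i) (ser_pow g i) a)"

definition Zer :: "('n, 'a::comm_ring_1) ypol \<Rightarrow> ('n, 'a) ser set" where
  "Zer F = {g. is_fser g \<and> yeval F g = ser_zero}"

definition contact :: "('n, 'a::comm_ring_1) ser \<Rightarrow> ('n, 'a) ser \<Rightarrow> ('n \<Rightarrow> rat)" where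
  "contact \<alpha> \<beta> = (THE l. \<exists>u. is_fser u \<and> u (\<lambda>i. 0) \<noteq> 0 \<and>
                         ser_diff \<alpha> \<beta> = ser_mul u (ser_monom l))"

definition is_characteristic :: "('n, 'a::comm_ring_1) ypol \<Rightarrow> ('n \<Rightarrow> rat) list \<Rightarrow> bool" where
  "is_characteristic F hs \<longleftrightarrow> sorted_wrt (<) hs \<and>
     set hs = {contact \<alpha> \<beta> | \<alpha> \<beta>. \<alpha> \<in> Zer F \<and> \<beta> \<in> Zer F \<and> \<alpha> \<noteq> \<beta>}"

definition char_lat :: "('n \<Rightarrow> rat) list \<Rightarrow> nat \<Rightarrow> ('n \<Rightarrow> rat) set" where
  "char_lat hs i = {v. \<exists>(z::'n \<Rightarrow> int) (c::nat \<Rightarrow> int).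
      v = (\<lambda>j. of_int (z j) + (\<Sum>l<i. of_int (c l) * (hs ! l) j))}"

definition grp_index :: "('n \<Rightarrow> rat) set \<Rightarrow> ('n \<Rightarrow> rat) set \<Rightarrow> nat" where
  "grp_index A B = card ((\<lambda>x. {y \<in> A. (\<lambda>j. y j - x j) \<in> B}) ` A)"

definition char_n :: "('n \<Rightarrow> rat) list \<Rightarrow> nat \<Rightarrow> nat" where
  "char_n hs i = grp_index (char_lat hs i) (char_lat hs (i - 1))"

definition char_e :: "('n \<Rightarrow> rat) list \<Rightarrow> nat \<Rightarrow> nat" where
  "char_e hs i = (\<Prod>j \<in> {i+1..length hs}. char_n hs j)"

definition char_q :: "('n \<Rightarrow> rat) list \<Rightarrow> nat \<Rightarrow> ('n \<Rightarrow> rat)" where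
  "char_q hs i = (\<lambda>t. (\<Sum>j \<in> {1..i}. (of_nat (char_e hs (j - 1)) - of_nat (char_e hs j)) * (hs ! (j - 1)) t)
                     + of_nat (char_e hs i) * (hs ! (i - 1)) t)"

definition alg_closed_field :: "'a::field itself \<Rightarrow> bool" where
  "alg_closed_field _ \<longleftrightarrow> (\<forall>p :: 'a poly. 0 < degree p \<longrightarrow> (\<exists>x. poly p x = 0))"

end

theory Submission
  imports Defs "HOL-Library.Function_Algebras" "Jordan_Normal_Form.Determinant"
begin

text \<open>
  The characters of \<open>Q^d/Z^d\<close> with values in \<open>K\<close> act on fractional power series through the monomials,
  and the roots of \<open>f\<close> are the conjugates of one root \<open>\<alpha>\<close>. Hence \<open>Res(f, g)\<close> is the product of the
  conjugates of \<open>g(\<alpha>)\<close>, and the hypothesis means that \<open>g(\<alpha>) / X^E\<close>, with \<open>E = deg g * q_k / deg f\<close>, is a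
  series without constant term.

  Let \<open>p_i\<close> be the minimal polynomial of the part \<open>\<beta> i\<close> of \<open>\<alpha>\<close> with exponents in \<open>M_i\<close>. In the \<open>p_i\<close>-adic
  expansion of a polynomial of degree less than \<open>n_1 ... n_(i+1)\<close>, the values of the terms at \<open>\<alpha>\<close> have
  leading exponents (for every lexicographic order) that are distinct modulo \<open>M_i\<close>, so they cannot cancel. This
  bounds the divisibility of \<open>g(\<alpha>)\<close> by monomials for monic \<open>g\<close> of degree less than \<open>n_1 ... n_k\<close> and forces
  \<open>deg g = n_1 ... n_k\<close>. It also shows that \<open>g(\<alpha> + X^h_k Z) / X^E\<close> reduces modulo the maximal ideal to
  \<open>w ((c + Z)^n_k - c^n_k)\<close> with nonzero constants \<open>w\<close> and \<open>c\<close>. By Hensel's lemma the simple root \<open>Z = 0\<close> lifts, so \<open>g\<close>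
  has a root \<open>\<gamma> = \<alpha> + X^h_k Z\<close>. Its conjugates have the same contacts as those of \<open>\<beta> k\<close>; in particular
  there are at least \<open>n_1 ... n_k\<close> of them, so they are all the roots of \<open>g\<close>.
\<close>

section \<open>The ring of fractional power series\<close>

text \<open>The obstacle is that exponents are only partially ordered: a series such as X_1 + X_2 is
  not a monomial times a unit and has no single leading exponent. Each enumeration of the variables
  gives a valuation \<open>lm xs\<close> instead, and the enumerations that start with j recover the
  j-th component of divisibility by monomials. Every statement about non-cancellation is therefore
  proved for all enumerations at once. Distinctness modulo M_i has one source
  (\<open>nsm_bb_mem\<close>): the exponent of p_i(\<alpha>) is h_(i+1) plus an element of M_i,
  hence has order n_(i+1) modulo M_i. The shape of the reduced polynomial follows from the same
  fact, since a surviving digit of index 0 < a < n_k would put n_k - a times the exponent of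
  p_(k-1)(\<alpha>) into M_(k-1). The exponent E is that of the hypothesis divided by the number deg
  f of conjugates, which all have the same support. A first root \<alpha> is available because a
  nonempty characteristic is realized by roots.\<close>

lemma frac_supp_dvd: "frac_supp m s \<Longrightarrow> m dvd m' \<Longrightarrow> 0 < m' \<Longrightarrow> frac_supp m' s"
proof -
  assume s: "frac_supp m s" and d: "m dvd m'" and p: "0 < m'"
  then obtain r where r: "m' = m * r" by auto
  show ?thesis unfolding frac_supp_def
  proof (intro conjI allI impI)
    fix a i assume a: "s a \<noteq> 0"
    with s have "of_nat m * a i \<in> \<int>" by (auto simp: frac_supp_def)
    then have "of_nat r * (of_nat m * a i) \<in> \<int>" by (rule Ints_mult[OF Ints_of_nat])
    then show "of_nat m' * a i \<in> \<int>" by (simp add: r mult_ac)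
    show "0 \<le> a i" using s a by (auto simp: frac_supp_def)
  qed (use p in auto)
qed

lemma frac_supp_common:
  assumes "frac_supp m s" "frac_supp m' t"
  shows "frac_supp (m * m') s" "frac_supp (m * m') t"
  using frac_supp_dvd[OF assms(1), of "m * m'"] frac_supp_dvd[OF assms(2), of "m * m'"] assms
  by (simp_all add: frac_supp_def)

lemma frac_supp_grid:
  assumes "frac_supp m s" "s a \<noteq> 0"
  shows "0 \<le> a i" "of_nat m * a i \<in> \<int>"
  using assms by (auto simp: frac_supp_def)

text \<open>A finite superset of the index set of the Cauchy product that depends only on the
  denominator and on \<open>a\<close>. Rearranging sums in the ring laws needs index sets that do
  not depend on the factors.\<close>

definition grid_box :: "nat \<Rightarrow> ('n \<Rightarrow> rat) \<Rightarrow> ('n \<Rightarrow> rat) set" where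
  "grid_box m a = {b. \<forall>i. 0 \<le> b i \<and> b i \<le> a i \<and> of_nat m * b i \<in> \<int>}"

lemma finite_grid_box: "0 < m \<Longrightarrow> finite (grid_box m (a :: 'n::finite \<Rightarrow> rat))"
proof -
  assume m: "0 < m"
  have fin: "finite {x::rat. 0 \<le> x \<and> x \<le> c \<and> of_nat m * x \<in> \<int>}" for c
  proof -
    have "{x::rat. 0 \<le> x \<and> x \<le> c \<and> of_nat m * x \<in> \<int>} \<subseteq> (\<lambda>z::int. of_int z / of_nat m) ` {0..\<lfloor>of_nat m * c\<rfloor>}"
    proof
      fix x assume x: "x \<in> {x::rat. 0 \<le> x \<and> x \<le> c \<and> of_nat m * x \<in> \<int>}"
      then obtain z where z: "of_nat m * x = of_int z" by (auto elim: Ints_cases)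
      have "of_int z \<ge> (0::rat)" using x m by (simp add: z[symmetric])
      moreover have "of_int z \<le> of_nat m * c" using x m by (simp add: z[symmetric])
      moreover have "x = of_int z / of_nat m" using z m by (simp add: field_simps)
      ultimately show "x \<in> (\<lambda>z::int. of_int z / of_nat m) ` {0..\<lfloor>of_nat m * c\<rfloor>}"
        by (auto simp: le_floor_iff)
    qed
    then show ?thesis by (rule finite_subset) auto
  qed
  have "grid_box m a = Pi\<^sub>E UNIV (\<lambda>i. {x. 0 \<le> x \<and> x \<le> a i \<and> of_nat m * x \<in> \<int>})"
    by (auto simp: grid_box_def PiE_def Pi_def)
  then show ?thesis by (simp add: finite_PiE fin)
qed

lemma ser_mul_grid_box:
  fixes s t :: "('n::finite, 'a::comm_ring_1) ser"
  assumes s: "frac_supp m s" and t: "frac_supp m t"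
  shows "ser_mul s t a = (\<Sum>b\<in>grid_box m a. s b * t (a - b))"
proof -
  have m: "0 < m" using s by (simp add: frac_supp_def)
  have *: "{b. s b \<noteq> 0 \<and> t (\<lambda>i. a i - b i) \<noteq> 0} \<subseteq> grid_box m a"
  proof
    fix b assume b: "b \<in> {b. s b \<noteq> 0 \<and> t (\<lambda>i. a i - b i) \<noteq> 0}"
    then have "0 \<le> b i" "of_nat m * b i \<in> \<int>" "0 \<le> a i - b i" for i
      using frac_supp_grid[OF s, of b i] frac_supp_grid(1)[OF t, of "\<lambda>i. a i - b i" i] by auto
    then show "b \<in> grid_box m a" by (simp add: grid_box_def)
  qed
  show ?thesis unfolding ser_mul_def
    by (rule sum.mono_neutral_cong_left) (use * in \<open>auto simp: finite_grid_box m fun_diff_def\<close>)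
qed

lemma ser_mul_nz:
  fixes s t :: "('n, 'a::comm_ring_1) ser"
  assumes "ser_mul s t a \<noteq> 0"
  obtains b c where "s b \<noteq> 0" "t c \<noteq> 0" "a = b + c"
proof -
  from assms obtain b where "s b \<noteq> 0" "t (\<lambda>i. a i - b i) \<noteq> 0"
    unfolding ser_mul_def by (auto elim!: sum.not_neutral_contains_not_neutral)
  then show ?thesis by (rule that) (simp add: fun_eq_iff)
qed

lemma frac_supp_ser_mul:
  fixes s t :: "('n, 'a::comm_ring_1) ser"
  assumes s: "frac_supp m s" and t: "frac_supp m t"
  shows "frac_supp m (ser_mul s t)"
  unfolding frac_supp_def
proof (intro conjI allI impI)
  show "0 < m" using s by (simp add: frac_supp_def)
  fix a i assume "ser_mul s t a \<noteq> 0"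
  then obtain b c where "s b \<noteq> 0" "t c \<noteq> 0" "a = b + c" by (rule ser_mul_nz)
  with frac_supp_grid[OF s] frac_supp_grid[OF t]
  show "0 \<le> a i" "of_nat m * a i \<in> \<int>" by (auto simp: distrib_left)
qed

text \<open>The union of the rings K[[X^(1/m)]] over all m, made a type so that the libraries on
  \<open>poly\<close>, \<open>pderiv\<close> and \<open>det\<close> apply. With all denominators in
  one ring, monomials with any nonnegative rational exponents are available.\<close>

typedef (overloaded) ('n, 'a) fser = "{s :: ('n, 'a::zero) ser. is_fser s}"
  morphisms cf Fser
  by (rule exI[of _ "\<lambda>a. 0"]) (auto simp: is_fser_def frac_supp_def)

setup_lifting type_definition_fser

lemma fser_eqI: "(\<And>a. cf s a = cf t a) \<Longrightarrow> s = t"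
  by (simp add: cf_inject[symmetric] fun_eq_iff)

lemma is_fser_cf: "is_fser (cf s)"
  using cf by auto

lemma frac_supp_cf: obtains m where "frac_supp m (cf s)"
  using is_fser_cf[of s] by (auto simp: is_fser_def)

lemma frac_supp_cf2:
  obtains m where "frac_supp m (cf s)" "frac_supp m (cf t)"
proof -
  obtain m where "frac_supp m (cf s)" by (rule frac_supp_cf)
  moreover obtain m' where "frac_supp m' (cf t)" by (rule frac_supp_cf)
  ultimately show ?thesis using frac_supp_common that by blast
qed

lemma cf_nonneg: "cf s a \<noteq> 0 \<Longrightarrow> 0 \<le> a"
  by (metis frac_supp_cf frac_supp_grid(1) le_funI zero_fun_apply)

lemma is_fserI: "frac_supp m s \<Longrightarrow> is_fser s" by (auto simp: is_fser_def)

lemma frac_supp_ser_one: "0 < m \<Longrightarrow> frac_supp m ser_one"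
  by (auto simp: frac_supp_def ser_one_def)

instantiation fser :: (finite, comm_ring_1) comm_ring_1
begin
lift_definition zero_fser :: "('a, 'b) fser" is "\<lambda>a. 0" by (auto simp: is_fser_def frac_supp_def)
lift_definition one_fser :: "('a, 'b) fser" is ser_one
  by (auto intro: is_fserI frac_supp_ser_one[of 1])
lift_definition plus_fser :: "('a, 'b) fser \<Rightarrow> ('a, 'b) fser \<Rightarrow> ('a, 'b) fser" is "\<lambda>s t a. s a + t a"
proof -
  fix s t :: "('a, 'b) ser" assume "is_fser s" "is_fser t"
  then obtain m m' where "frac_supp m s" "frac_supp m' t" by (auto simp: is_fser_def)
  then have *: "frac_supp (m * m') s" "frac_supp (m * m') t" by (rule frac_supp_common)+
  then have "frac_supp (m * m') (\<lambda>a. s a + t a)" by (force simp: frac_supp_def)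
  then show "is_fser (\<lambda>a. s a + t a)" by (rule is_fserI)
qed
lift_definition uminus_fser :: "('a, 'b) fser \<Rightarrow> ('a, 'b) fser" is "\<lambda>s a. - s a"
  by (auto simp: is_fser_def frac_supp_def)
definition minus_fser :: "('a, 'b) fser \<Rightarrow> ('a, 'b) fser \<Rightarrow> ('a, 'b) fser" where
  "minus_fser s t = s + (- t)"
lift_definition times_fser :: "('a, 'b) fser \<Rightarrow> ('a, 'b) fser \<Rightarrow> ('a, 'b) fser" is ser_mul
proof -
  fix s t :: "('a, 'b) ser" assume "is_fser s" "is_fser t"
  then obtain m m' where "frac_supp m s" "frac_supp m' t" by (auto simp: is_fser_def)
  then have "frac_supp (m * m') s" "frac_supp (m * m') t" by (rule frac_supp_common)+
  then have "frac_supp (m * m') (ser_mul s t)" by (rule frac_supp_ser_mul)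
  then show "is_fser (ser_mul s t)" by (rule is_fserI)
qed
instance
proof
  fix r s t :: "('a, 'b) fser"
  show "r + s + t = r + (s + t)" by transfer (simp add: add.assoc)
  show "r + s = s + r" by transfer (simp add: add.commute)
  show "0 + s = s" by transfer simp
  show "- s + s = 0" by transfer simp
  show "s - t = s + - t" by (simp add: minus_fser_def)
  show "(0::('a, 'b) fser) \<noteq> 1" by transfer (auto simp: ser_one_def fun_eq_iff)
  obtain m where rs: "frac_supp m (cf r)" "frac_supp m (cf s)" by (rule frac_supp_cf2)
  obtain m' where "frac_supp m' (cf t)" by (rule frac_supp_cf)
  define k where "k = m * m'"
  have r: "frac_supp k (cf r)" and s: "frac_supp k (cf s)" and t: "frac_supp k (cf t)"
    unfolding k_def using frac_supp_common[OF rs(1) \<open>frac_supp m' (cf t)\<close>]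
      frac_supp_common(1)[OF rs(2) \<open>frac_supp m' (cf t)\<close>] by simp_all
  have k: "0 < k" using r by (simp add: frac_supp_def)
  have fin: "finite (grid_box k a)" for a :: "'a \<Rightarrow> rat" using k by (rule finite_grid_box)
  show "r * s * t = r * (s * t)"
  proof (rule fser_eqI)
    fix a
    have "cf (r * s * t) a = (\<Sum>b\<in>grid_box k a. \<Sum>c\<in>grid_box k b. cf r c * cf s (b - c) * cf t (a - b))"
      by (simp add: times_fser.rep_eq ser_mul_grid_box[OF frac_supp_ser_mul[OF r s] t]
          ser_mul_grid_box[OF r s] sum_distrib_right)
    \<comment> \<open>Both sides run over the decompositions of \<open>a\<close> into c, d and a - c
      - d; the bijection is b = c + d.\<close>
    also have "\<dots> = (\<Sum>c\<in>grid_box k a. \<Sum>d\<in>grid_box k (a - c). cf r c * (cf s d * cf t (a - c - d)))"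
      unfolding sum.Sigma[OF fin ballI[OF fin]] sum.Sigma[OF fin ballI[OF fin]]
    proof (rule sum.reindex_bij_witness[of _ "\<lambda>(c, d). (c + d, c)" "\<lambda>(b, c). (c, b - c)"])
      fix p assume p: "p \<in> (SIGMA b:grid_box k a. grid_box k b)"
      obtain b c where bc: "p = (b, c)" by (cases p)
      have g: "0 \<le> b i" "b i \<le> a i" "of_nat k * b i \<in> \<int>" "0 \<le> c i" "c i \<le> b i" "of_nat k * c i \<in> \<int>" for i
        using p by (auto simp: bc grid_box_def)
      have "c i \<le> a i" for i using g(2,5)[of i] by simp
      moreover have "of_nat k * (b i - c i) \<in> \<int>" for i using g(3,6)[of i] by (simp add: right_diff_distrib)
      ultimately show "(case p of (b, c) \<Rightarrow> (c, b - c)) \<in> (SIGMA c:grid_box k a. grid_box k (a - c))"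
        using g by (simp add: bc grid_box_def)
      show "(case (case p of (b, c) \<Rightarrow> (c, b - c)) of (c, d) \<Rightarrow> (c + d, c)) = p" by (simp add: bc)
      show "(case case p of (b, c) \<Rightarrow> (c, b - c) of (c, d) \<Rightarrow> cf r c * (cf s d * cf t (a - c - d)))
          = (case p of (b, c) \<Rightarrow> cf r c * cf s (b - c) * cf t (a - b))"
        by (simp add: bc mult.assoc)
    next
      fix p assume p: "p \<in> (SIGMA c:grid_box k a. grid_box k (a - c))"
      obtain c d where cd: "p = (c, d)" by (cases p)
      have g: "0 \<le> c i" "c i \<le> a i" "of_nat k * c i \<in> \<int>" "0 \<le> d i" "d i \<le> a i - c i" "of_nat k * d i \<in> \<int>" for i
        using p by (auto simp: cd grid_box_def)
      have "c i + d i \<le> a i" "0 \<le> c i + d i" for i using g(5)[of i] g(1,4)[of i] by simp_all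
      moreover have "of_nat k * (c i + d i) \<in> \<int>" for i using g(3,6)[of i] by (simp add: distrib_left)
      ultimately show "(case p of (c, d) \<Rightarrow> (c + d, c)) \<in> (SIGMA b:grid_box k a. grid_box k b)"
        using g by (simp add: cd grid_box_def)
      show "(case (case p of (c, d) \<Rightarrow> (c + d, c)) of (b, c) \<Rightarrow> (c, b - c)) = p" by (simp add: cd)
    qed
    also have "\<dots> = cf (r * (s * t)) a"
      by (simp add: times_fser.rep_eq ser_mul_grid_box[OF r frac_supp_ser_mul[OF s t]]
          ser_mul_grid_box[OF s t] sum_distrib_left)
    finally show "cf (r * s * t) a = cf (r * (s * t)) a" .
  qed
  show "r * s = s * r"
  proof (rule fser_eqI)
    fix a
    show "cf (r * s) a = cf (s * r) a"
      unfolding times_fser.rep_eq ser_mul_def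
      by (rule sum.reindex_bij_witness[of _ "\<lambda>b i. a i - b i" "\<lambda>b i. a i - b i"])
        (auto simp: mult.commute)
  qed
  show "1 * s = s"
  proof (rule fser_eqI)
    fix a
    have "cf (1 * s) a = (\<Sum>b\<in>{b. b = (\<lambda>i::'a. 0::rat) \<and> cf s a \<noteq> 0}. cf s a)"
      unfolding times_fser.rep_eq one_fser.rep_eq ser_mul_def
      by (rule sum.cong) (auto simp: ser_one_def)
    also have "\<dots> = cf s a" by (cases "cf s a = 0") auto
    finally show "cf (1 * s) a = cf s a" .
  qed
  show "(r + s) * t = r * t + s * t"
  proof (rule fser_eqI)
    fix a
    have rs': "frac_supp k (cf (r + s))" unfolding frac_supp_def
    proof (intro conjI allI impI)
      fix a i assume "cf (r + s) a \<noteq> 0"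
      then have "cf r a \<noteq> 0 \<or> cf s a \<noteq> 0" by (auto simp: plus_fser.rep_eq)
      then show "0 \<le> a i" "of_nat k * a i \<in> \<int>" using frac_supp_grid[OF r] frac_supp_grid[OF s] by auto
    qed (rule k)
    show "cf ((r + s) * t) a = cf (r * t + s * t) a"
      by (simp add: times_fser.rep_eq plus_fser.rep_eq ser_mul_grid_box[OF r t] ser_mul_grid_box[OF s t]
          ser_mul_grid_box[OF rs'[unfolded plus_fser.rep_eq] t] distrib_right sum.distrib)
  qed
qed
end

lemma cf_add [simp]: "cf (s + t) a = cf s a + cf t a" by (simp add: plus_fser.rep_eq)
lemma cf_zero [simp]: "cf 0 a = 0" by (simp add: zero_fser.rep_eq)
lemma cf_uminus [simp]: "cf (- s) a = - cf s a" by (simp add: uminus_fser.rep_eq)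
lemma cf_diff [simp]: "cf (s - t) a = cf s a - cf t a" using cf_add[of s "- t" a] by simp
lemma cf_one: "cf 1 a = (if a = 0 then 1 else 0)" by (simp add: one_fser.rep_eq ser_one_def zero_fun_def)
lemma cf_sum [simp]: "cf (sum f A) a = (\<Sum>x\<in>A. cf (f x) a)"
  by (induction A rule: infinite_finite_induct) auto

lemma cf_mult: "cf (s * t) a = (\<Sum>b\<in>{b. cf s b \<noteq> 0 \<and> cf t (a - b) \<noteq> 0}. cf s b * cf t (a - b))"
  by (simp add: times_fser.rep_eq ser_mul_def fun_diff_def)

lemma cf_mult_nz:
  assumes "cf (s * t) a \<noteq> 0"
  obtains b c where "cf s b \<noteq> 0" "cf t c \<noteq> 0" "a = b + c"
  using assms ser_mul_nz by (metis times_fser.rep_eq)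

text \<open>If only one pair of exponents contributes, the Cauchy product has a single summand. The
  product rules for coefficients at \<open>lm\<close> and at \<open>mdvd\<close> exponents are both
  instances.\<close>

lemma cf_mult_unique:
  assumes "\<And>b c. cf s b \<noteq> 0 \<Longrightarrow> cf t c \<noteq> 0 \<Longrightarrow> b + c = b0 + c0 \<Longrightarrow> b = b0"
  shows "cf (s * t) (b0 + c0) = cf s b0 * cf t c0"
proof -
  have "{b. cf s b \<noteq> 0 \<and> cf t (b0 + c0 - b) \<noteq> 0} \<subseteq> {b0}"
  proof
    fix b assume "b \<in> {b. cf s b \<noteq> 0 \<and> cf t (b0 + c0 - b) \<noteq> 0}"
    then have "b = b0" by (intro assms[of b "b0 + c0 - b"]) auto
    then show "b \<in> {b0}" by simp
  qed
  then have "cf (s * t) (b0 + c0) = (\<Sum>b\<in>{b0}. cf s b * cf t (b0 + c0 - b))"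
    unfolding cf_mult by (intro sum.mono_neutral_left) auto
  then show ?thesis by simp
qed

lift_definition kconst :: "'a::zero \<Rightarrow> ('n, 'a) fser" is "\<lambda>c a. if a = 0 then c else 0"
  by (rule is_fserI[of 1]) (auto simp: frac_supp_def)

lemma cf_kconst: "cf (kconst c) a = (if a = 0 then c else 0)" by (simp add: kconst.rep_eq)

lemma ex_common_denominator: "\<exists>m. 0 < m \<and> (\<forall>i. of_nat m * (e :: 'n::finite \<Rightarrow> rat) i \<in> \<int>)"
proof -
  define m where "m = (\<Prod>i\<in>UNIV. nat (snd (quotient_of (e i))))"
  have p: "0 < snd (quotient_of x)" for x by (rule quotient_of_denom_pos')
  have "of_nat m * e i \<in> \<int>" for i
  proof -
    obtain a b where ab: "quotient_of (e i) = (a, b)" by (cases "quotient_of (e i)")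
    have b: "0 < b" using p[of "e i"] ab by simp
    have e: "e i = of_int a / of_int b" using ab by (rule quotient_of_div)
    have "nat (snd (quotient_of (e i))) dvd m" unfolding m_def by (rule dvd_prodI) auto
    then obtain r where "m = nat b * r" using ab by auto
    then have "of_nat m * e i = of_nat r * of_int a" using b by (simp add: e field_simps)
    then show ?thesis by simp
  qed
  moreover have "0 < m" unfolding m_def using p by (intro prod_pos) auto
  ultimately show ?thesis by blast
qed

text \<open>Meaningful only for \<open>0 \<le> e\<close>: otherwise \<open>ser_monom e\<close> lies
  outside the type and the value of \<open>Fser\<close> is unspecified.\<close>

definition xmonom :: "('n::finite \<Rightarrow> rat) \<Rightarrow> ('n, 'a::comm_ring_1) fser" where
  "xmonom e = Fser (ser_monom e)"

lemma cf_xmonom: "0 \<le> e \<Longrightarrow> cf (xmonom e) = ser_monom e"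
proof -
  assume e: "0 \<le> e"
  obtain m where "0 < m" "\<forall>i. of_nat m * e i \<in> \<int>" using ex_common_denominator by blast
  then have "frac_supp m (ser_monom e)" using e by (auto simp: frac_supp_def ser_monom_def le_fun_def)
  then show ?thesis unfolding xmonom_def by (intro Fser_inverse) (auto intro: is_fserI)
qed

lemma ser_mul_monom:
  fixes s :: "('n, 'a::comm_ring_1) ser"
  shows "ser_mul s (ser_monom e) a = s (a - e)"
proof -
  have "ser_mul s (ser_monom e) a = (\<Sum>b\<in>{b. b = a - e \<and> s (a - e) \<noteq> 0}. s (a - e))"
    unfolding ser_mul_def
  proof (rule sum.cong)
    have "(\<lambda>i. a i - b i) = e \<longleftrightarrow> b = a - e" for b by (auto simp: fun_eq_iff algebra_simps)
    then show "{b. s b \<noteq> 0 \<and> ser_monom e (\<lambda>i. a i - b i) \<noteq> (0::'a)} = {b. b = a - e \<and> s (a - e) \<noteq> 0}"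
      by (auto simp: ser_monom_def)
  qed (auto simp: ser_monom_def fun_diff_def)
  also have "\<dots> = s (a - e)" by (cases "s (a - e) = 0") auto
  finally show ?thesis .
qed

lemma cf_mult_xmonom: "0 \<le> e \<Longrightarrow> cf (s * xmonom e) a = cf s (a - e)"
  by (simp add: times_fser.rep_eq cf_xmonom ser_mul_monom)

section \<open>Lexicographic valuations\<close>

text \<open>The list fixes the priority of the variables. The order is total once the list exhausts
  the index type, it refines the pointwise order, and its head controls one chosen coordinate
  (\<open>rlex_hd\<close>).\<close>

primrec rlex :: "'n list \<Rightarrow> ('n \<Rightarrow> rat) \<Rightarrow> ('n \<Rightarrow> rat) \<Rightarrow> bool" where
  "rlex [] a b \<longleftrightarrow> False"
| "rlex (x # xs) a b \<longleftrightarrow> a x < b x \<or> a x = b x \<and> rlex xs a b"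

lemma rlex_irrefl [simp]: "\<not> rlex xs a a"
  by (induction xs) auto

lemma rlex_trans: "rlex xs a b \<Longrightarrow> rlex xs b c \<Longrightarrow> rlex xs a c"
  by (induction xs) auto

lemma rlex_total_aux: "\<not> rlex xs a b \<Longrightarrow> \<not> rlex xs b a \<Longrightarrow> x \<in> set xs \<Longrightarrow> a x = b x"
  by (induction xs) auto

lemma rlex_total: "set xs = UNIV \<Longrightarrow> a = b \<or> rlex xs a b \<or> rlex xs b a"
  using rlex_total_aux[of xs a b] by (auto simp: fun_eq_iff)

lemma rlex_add_right [simp]: "rlex xs (a + c) (b + c) \<longleftrightarrow> rlex xs a b"
  by (induction xs) auto

lemma rlex_add_left [simp]: "rlex xs (c + a) (c + b) \<longleftrightarrow> rlex xs a b"
  by (induction xs) auto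

lemma not_rlex_le: "b \<le> a \<Longrightarrow> \<not> rlex xs a b"
  by (induction xs) (auto simp: le_fun_def not_less)

lemma rlex_le: "set xs = UNIV \<Longrightarrow> a \<le> b \<Longrightarrow> a = b \<or> rlex xs a b"
  using rlex_total not_rlex_le by blast

lemma rlex_hd: "rlex (j # xs) a b \<Longrightarrow> a j \<le> b j"
  by auto

lemma rlex_add_mono:
  assumes "a = a' \<or> rlex xs a a'" "b = b' \<or> rlex xs b b'"
  shows "a + b = a' + b' \<or> rlex xs (a + b) (a' + b')"
  using assms rlex_trans[of xs "a + b" "a' + b" "a' + b'"] by auto

lemma rlex_add_eq:
  assumes "set xs = UNIV" "a = a' \<or> rlex xs a a'" "b = b' \<or> rlex xs b b'" "a' + b' = a + b"
  shows "a' = a"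
proof (rule ccontr)
  assume "a' \<noteq> a"
  then have "rlex xs (a + b) (a' + b)" using assms(2) by auto
  then have "rlex xs (a + b) (a' + b')"
    using assms(3) rlex_trans[of xs "a + b" "a' + b" "a' + b'"] by auto
  then show False using assms(4) by simp
qed

text \<open>Multiplication by m embeds S into N^d and preserves comparisons in each coordinate, the
  floor being exact on integers; the lexicographic order on N^d is well-founded by
  \<open>wf_measures\<close>.\<close>

lemma rlex_min:
  fixes S :: "('n \<Rightarrow> rat) set"
  assumes xs: "set xs = UNIV" and m: "0 < m" and ne: "S \<noteq> {}"
    and S: "\<And>a i. a \<in> S \<Longrightarrow> 0 \<le> a i \<and> of_nat m * a i \<in> \<int>"
  shows "\<exists>a\<in>S. \<forall>b\<in>S. b = a \<or> rlex xs a b"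
proof -
  define r where "r = (\<lambda>j (a :: 'n \<Rightarrow> rat). nat \<lfloor>of_nat m * a j\<rfloor>)"
  have r_iff: "r j a < r j b \<longleftrightarrow> a j < b j" "r j a = r j b \<longleftrightarrow> a j = b j" if "a \<in> S" "b \<in> S" for a b j
  proof -
    have "of_nat m * a j \<in> \<int>" "of_nat m * b j \<in> \<int>" using S that by auto
    then obtain z y where z: "of_nat m * a j = of_int z" "of_nat m * b j = of_int y"
      by (auto elim!: Ints_cases)
    have a: "a j = of_int z / of_nat m" and b: "b j = of_int y / of_nat m"
      using z m by (simp_all add: field_simps)
    have "0 \<le> a j" "0 \<le> b j" using S that by auto
    then have "0 \<le> z" "0 \<le> y" using m by (auto simp: a b zero_le_divide_iff)
    then show "r j a < r j b \<longleftrightarrow> a j < b j" "r j a = r j b \<longleftrightarrow> a j = b j"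
      using m by (auto simp: r_def z) (auto simp: a b divide_less_cancel)
  qed
  have meas: "(a, b) \<in> measures (map r ys) \<longleftrightarrow> rlex ys a b" if "a \<in> S" "b \<in> S" for a b ys
    by (induction ys) (use r_iff that in auto)
  obtain a where a: "a \<in> S" "\<And>b. (b, a) \<in> measures (map r xs) \<Longrightarrow> b \<notin> S"
    using ne wfE_min[OF wf_measures[of "map r xs"]] by (metis ex_in_conv)
  then have "b = a \<or> rlex xs a b" if "b \<in> S" for b
    using meas[OF that a(1), of xs] rlex_total[OF xs, of a b] that by blast
  then show ?thesis using a(1) by blast
qed

text \<open>A valuation with values in Q^d ordered by \<open>rlex xs\<close>; nothing is claimed
  about its value at the zero series.\<close>

definition lm :: "'n list \<Rightarrow> ('n::finite, 'a::comm_ring_1) fser \<Rightarrow> ('n \<Rightarrow> rat)" where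
  "lm xs s = (SOME a. cf s a \<noteq> 0 \<and> (\<forall>b. cf s b \<noteq> 0 \<longrightarrow> b = a \<or> rlex xs a b))"

lemma
  assumes xs: "set xs = UNIV" and s: "s \<noteq> 0"
  shows cf_lm: "cf s (lm xs s) \<noteq> 0"
    and lm_min: "cf s b \<noteq> 0 \<Longrightarrow> b = lm xs s \<or> rlex xs (lm xs s) b"
proof -
  obtain m where m: "frac_supp m (cf s)" by (rule frac_supp_cf)
  have "\<exists>a\<in>{a. cf s a \<noteq> 0}. \<forall>b\<in>{a. cf s a \<noteq> 0}. b = a \<or> rlex xs a b"
  proof (rule rlex_min[OF xs])
    show "{a. cf s a \<noteq> 0} \<noteq> {}" using s fser_eqI[of s 0] by auto
    show "0 < m" using m by (auto simp: frac_supp_def)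
    show "0 \<le> a i \<and> of_nat m * a i \<in> \<int>" if "a \<in> {a. cf s a \<noteq> 0}" for a i
      using frac_supp_grid[OF m] that by auto
  qed
  then have "\<exists>a. cf s a \<noteq> 0 \<and> (\<forall>b. cf s b \<noteq> 0 \<longrightarrow> b = a \<or> rlex xs a b)" by blast
  from someI_ex[OF this] have *: "cf s (lm xs s) \<noteq> 0 \<and> (\<forall>b. cf s b \<noteq> 0 \<longrightarrow> b = lm xs s \<or> rlex xs (lm xs s) b)"
    unfolding lm_def .
  then show "cf s (lm xs s) \<noteq> 0" by blast
  from * show "b = lm xs s \<or> rlex xs (lm xs s) b" if "cf s b \<noteq> 0" using that by blast
qed

lemma lm_eqI:
  assumes xs: "set xs = UNIV" and a: "cf s a \<noteq> 0" "\<And>b. cf s b \<noteq> 0 \<Longrightarrow> b = a \<or> rlex xs a b"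
  shows "lm xs s = a"
proof -
  have s: "s \<noteq> 0" using a by auto
  show ?thesis
    using lm_min[OF xs s a(1)] a(2)[OF cf_lm[OF xs s]] rlex_trans[of xs a "lm xs s" a] by auto
qed

lemma cf_mult_lm:
  assumes xs: "set xs = UNIV" and s: "s \<noteq> 0" and t: "t \<noteq> 0"
  shows "cf (s * t) (lm xs s + lm xs t) = cf s (lm xs s) * cf t (lm xs t)"
proof (rule cf_mult_unique)
  fix b c assume "cf s b \<noteq> 0" "cf t c \<noteq> 0" "b + c = lm xs s + lm xs t"
  then show "b = lm xs s"
    using lm_min[OF xs s, of b] lm_min[OF xs t, of c]
    by (intro rlex_add_eq[OF xs, of "lm xs s" b "lm xs t" c]) metis+
qed

text \<open>The product of the two least monomials cannot be cancelled by any other product of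
  monomials.\<close>

instance fser :: (finite, idom) idom
proof
  fix s t :: "('a, 'b) fser" assume st: "s \<noteq> 0" "t \<noteq> 0"
  obtain xs :: "'a list" where xs: "set xs = UNIV" using finite_list[OF finite] by blast
  have "cf (s * t) (lm xs s + lm xs t) \<noteq> 0" using cf_mult_lm[OF xs st] cf_lm[OF xs st(1)] cf_lm[OF xs st(2)] by simp
  then show "s * t \<noteq> 0" by auto
qed

lemma lm_mult:
  fixes s t :: "('n::finite, 'a::idom) fser"
  assumes xs: "set xs = UNIV" and s: "s \<noteq> 0" and t: "t \<noteq> 0"
  shows "lm xs (s * t) = lm xs s + lm xs t"
proof (rule lm_eqI[OF xs])
  show "cf (s * t) (lm xs s + lm xs t) \<noteq> 0" using cf_mult_lm[OF xs s t] cf_lm[OF xs s] cf_lm[OF xs t] by simp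
  fix b assume "cf (s * t) b \<noteq> 0"
  then obtain c d where "cf s c \<noteq> 0" "cf t d \<noteq> 0" "b = c + d" by (rule cf_mult_nz)
  with lm_min[OF xs s, of c] lm_min[OF xs t, of d]
  have "lm xs s = c \<or> rlex xs (lm xs s) c" "lm xs t = d \<or> rlex xs (lm xs t) d" by auto
  from rlex_add_mono[OF this] show "b = lm xs s + lm xs t \<or> rlex xs (lm xs s + lm xs t) b"
    using \<open>b = c + d\<close> by auto
qed

lemma lm_one [simp]: "set xs = UNIV \<Longrightarrow> lm xs (1 :: ('n::finite, 'a::comm_ring_1) fser) = 0"
  by (rule lm_eqI) (auto simp: cf_one split: if_splits)

definition nsm :: "nat \<Rightarrow> ('n \<Rightarrow> rat) \<Rightarrow> ('n \<Rightarrow> rat)" where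
  "nsm n a = (\<lambda>i. of_nat n * a i)"

lemma nsm_0 [simp]: "nsm 0 a = 0" by (simp add: nsm_def fun_eq_iff)
lemma nsm_Suc: "nsm (Suc n) a = a + nsm n a" by (simp add: nsm_def fun_eq_iff algebra_simps)
lemma nsm_1 [simp]: "nsm (Suc 0) a = a" by (simp add: nsm_def)
lemma nsm_apply [simp]: "nsm n a i = of_nat n * a i" by (simp add: nsm_def)

lemma lm_prod:
  fixes s :: "'b \<Rightarrow> ('n::finite, 'a::idom) fser"
  assumes xs: "set xs = UNIV" and "finite A" "\<And>x. x \<in> A \<Longrightarrow> s x \<noteq> 0"
  shows "lm xs (\<Prod>x\<in>A. s x) = (\<Sum>x\<in>A. lm xs (s x))"
  using assms(2,3) by (induction A) (simp_all add: xs lm_mult)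

lemma rlex_finite_min:
  assumes xs: "set xs = UNIV" and "finite I" "I \<noteq> {}"
  shows "\<exists>x\<in>I. \<forall>y\<in>I. f y = f x \<or> rlex xs (f x) (f y)"
  using assms(2,3)
proof (induction I rule: finite_ne_induct)
  case (insert y F)
  then obtain x where x: "x \<in> F" "\<forall>y\<in>F. f y = f x \<or> rlex xs (f x) (f y)" by blast
  show ?case
  proof (cases "f y = f x \<or> rlex xs (f x) (f y)")
    case True
    then show ?thesis using x by blast
  next
    case False
    then have "rlex xs (f y) (f x)" using rlex_total[OF xs] by blast
    then have "\<forall>z\<in>insert y F. f z = f y \<or> rlex xs (f y) (f z)"
      using x rlex_trans by (metis insert_iff)
    then show ?thesis by blast
  qed
qed simp

text \<open>The non-Archimedean principle: among summands with pairwise different least exponents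
  the smallest one meets no other term, so it survives in the sum and bounds all summands from
  below.\<close>

lemma lm_sum_distinct:
  fixes s :: "'b \<Rightarrow> ('n::finite, 'a::idom) fser"
  assumes xs: "set xs = UNIV" and I: "finite I" and nz: "z \<in> I" "s z \<noteq> 0"
    and dist: "\<And>x y. x \<in> I \<Longrightarrow> y \<in> I \<Longrightarrow> s x \<noteq> 0 \<Longrightarrow> s y \<noteq> 0 \<Longrightarrow> lm xs (s x) = lm xs (s y) \<Longrightarrow> x = y"
  shows "(\<Sum>x\<in>I. s x) \<noteq> 0"
    and "\<exists>x\<in>I. s x \<noteq> 0 \<and> lm xs (\<Sum>x\<in>I. s x) = lm xs (s x)"
    and "lm xs (s z) = lm xs (\<Sum>x\<in>I. s x) \<or> rlex xs (lm xs (\<Sum>x\<in>I. s x)) (lm xs (s z))"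
proof -
  define J where "J = {x\<in>I. s x \<noteq> 0}"
  have J: "finite J" "z \<in> J" using I nz by (auto simp: J_def)
  then obtain x where x: "x \<in> J" and min: "\<And>y. y \<in> J \<Longrightarrow> lm xs (s y) = lm xs (s x) \<or> rlex xs (lm xs (s x)) (lm xs (s y))"
    using rlex_finite_min[OF xs, of J "\<lambda>y. lm xs (s y)"] by blast
  have sum: "(\<Sum>x\<in>I. s x) = (\<Sum>x\<in>J. s x)" unfolding J_def
    by (rule sum.mono_neutral_right) (use I in auto)
  have zero: "cf (s y) (lm xs (s x)) = 0" if "y \<in> J - {x}" for y
  proof (rule ccontr)
    assume *: "cf (s y) (lm xs (s x)) \<noteq> 0"
    have ne: "lm xs (s y) \<noteq> lm xs (s x)" using dist[of y x] that x by (auto simp: J_def)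
    then have 1: "rlex xs (lm xs (s x)) (lm xs (s y))" using min[of y] that by auto
    have "lm xs (s x) = lm xs (s y) \<or> rlex xs (lm xs (s y)) (lm xs (s x))"
      using lm_min[OF xs _ *] that by (auto simp: J_def)
    then show False using 1 ne rlex_trans rlex_irrefl by metis
  qed
  have "cf (\<Sum>x\<in>J. s x) (lm xs (s x)) = cf (s x) (lm xs (s x))"
    using sum.remove[OF J(1) x, of "\<lambda>y. cf (s y) (lm xs (s x))"] zero by simp
  then have cx: "cf (\<Sum>x\<in>J. s x) (lm xs (s x)) \<noteq> 0" using cf_lm[OF xs] x by (auto simp: J_def)
  have L: "lm xs (\<Sum>x\<in>J. s x) = lm xs (s x)"
  proof (rule lm_eqI[OF xs cx])
    fix b assume "cf (\<Sum>x\<in>J. s x) b \<noteq> 0"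
    then obtain y where y: "y \<in> J" "cf (s y) b \<noteq> 0" by (auto elim: sum.not_neutral_contains_not_neutral)
    then have "b = lm xs (s y) \<or> rlex xs (lm xs (s y)) b" using lm_min[OF xs] by (auto simp: J_def)
    then show "b = lm xs (s x) \<or> rlex xs (lm xs (s x)) b" using min[OF y(1)] rlex_trans by metis
  qed
  show "(\<Sum>x\<in>I. s x) \<noteq> 0" using cx sum by (metis cf_zero)
  show "\<exists>x\<in>I. s x \<noteq> 0 \<and> lm xs (\<Sum>x\<in>I. s x) = lm xs (s x)" using x L sum by (auto simp: J_def)
  show "lm xs (s z) = lm xs (\<Sum>x\<in>I. s x) \<or> rlex xs (lm xs (\<Sum>x\<in>I. s x)) (lm xs (s z))"
    using min[OF J(2)] L sum by simp
qed

section \<open>Divisibility by monomials\<close>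

text \<open>Divisibility by X^e, phrased by the support so that it makes sense for every e in Q^d.
  Exponents with negative components may arise as differences such as
  \<open>e - nsm a (bb i)\<close>.\<close>

definition mdvd :: "('n::finite \<Rightarrow> rat) \<Rightarrow> ('n, 'a::comm_ring_1) fser \<Rightarrow> bool" where
  "mdvd e s \<longleftrightarrow> (\<forall>a. cf s a \<noteq> 0 \<longrightarrow> e \<le> a)"

text \<open>Expresses that s / X^e lies in the maximal ideal.\<close>

definition sdvd :: "('n::finite \<Rightarrow> rat) \<Rightarrow> ('n, 'a::comm_ring_1) fser \<Rightarrow> bool" where
  "sdvd e s \<longleftrightarrow> (\<forall>a. cf s a \<noteq> 0 \<longrightarrow> e < a)"

text \<open>The form s = u X^h with u(0) nonzero that is required of discriminants and of
  differences of roots.\<close>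

definition lead :: "('n::finite \<Rightarrow> rat) \<Rightarrow> ('n, 'a::comm_ring_1) fser \<Rightarrow> bool" where
  "lead h s \<longleftrightarrow> mdvd h s \<and> cf s h \<noteq> 0"

lemma sdvd_iff: "sdvd e s \<longleftrightarrow> mdvd e s \<and> cf s e = 0"
  unfolding sdvd_def mdvd_def by (metis less_le)

lemma mdvd_0 [simp]: "mdvd e 0" and sdvd_0 [simp]: "sdvd e 0"
  by (auto simp: mdvd_def sdvd_def)

lemma mdvd_zero [simp]: "mdvd 0 s"
  using cf_nonneg by (auto simp: mdvd_def)

lemma mdvd_imp_sdvd: "mdvd e s \<Longrightarrow> e' < e \<Longrightarrow> sdvd e' s"
  unfolding mdvd_def sdvd_def by (meson order.strict_trans2)

lemma mdvd_add: "mdvd e s \<Longrightarrow> mdvd e t \<Longrightarrow> mdvd e (s + t)"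
  unfolding mdvd_def by (metis cf_add add.right_neutral)

lemma mdvd_uminus: "mdvd e s \<Longrightarrow> mdvd e (- s)"
  by (simp add: mdvd_def)

lemma mdvd_diff: "mdvd e s \<Longrightarrow> mdvd e t \<Longrightarrow> mdvd e (s - t)"
  using mdvd_add[of e s "- t"] mdvd_uminus[of e t] by simp

lemma sdvd_diff: "sdvd e s \<Longrightarrow> sdvd e t \<Longrightarrow> sdvd e (s - t)"
  by (auto simp: sdvd_iff mdvd_diff)

lemma mdvd_sum: "(\<And>x. x \<in> A \<Longrightarrow> mdvd e (s x)) \<Longrightarrow> mdvd e (\<Sum>x\<in>A. s x)"
  by (induction A rule: infinite_finite_induct) (auto intro: mdvd_add)

lemma mdvd_mult: "mdvd e s \<Longrightarrow> mdvd e' t \<Longrightarrow> mdvd (e + e') (s * t)"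
  unfolding mdvd_def by (metis add_mono cf_mult_nz)

lemma cf_mult_mdvd:
  assumes "mdvd e s" "mdvd e' t"
  shows "cf (s * t) (e + e') = cf s e * cf t e'"
proof (rule cf_mult_unique)
  fix b c assume bc: "cf s b \<noteq> 0" "cf t c \<noteq> 0" "b + c = e + e'"
  then have "e \<le> b" "e' \<le> c" using assms by (auto simp: mdvd_def)
  then have "e i \<le> b i" "e' i \<le> c i" "b i + c i = e i + e' i" for i
    using bc(3) by (auto simp: le_fun_def fun_eq_iff)
  then have "b i = e i" for i by (metis add_le_cancel_left add_le_cancel_right antisym add_mono order_refl order_trans)
  then show "b = e" by auto
qed

lemma sdvd_mult: "sdvd e s \<Longrightarrow> mdvd e' t \<Longrightarrow> sdvd (e + e') (s * t)"
  by (auto simp: sdvd_iff mdvd_mult cf_mult_mdvd)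

lemma lead_mult:
  fixes s t :: "('n::finite, 'a::idom) fser"
  shows "lead e s \<Longrightarrow> lead e' t \<Longrightarrow> lead (e + e') (s * t)"
  by (auto simp: lead_def mdvd_mult cf_mult_mdvd)

lemma lead_one [simp]: "lead 0 1"
  by (simp add: lead_def cf_one)

lemma lead_power:
  fixes s :: "('n::finite, 'a::idom) fser"
  shows "lead e s \<Longrightarrow> lead (nsm n e) (s ^ n)"
  by (induction n) (auto simp: nsm_Suc lead_mult)

lemma lead_prod:
  fixes s :: "'b \<Rightarrow> ('n::finite, 'a::idom) fser"
  shows "(\<And>x. x \<in> A \<Longrightarrow> lead (e x) (s x)) \<Longrightarrow> lead (\<Sum>x\<in>A. e x) (\<Prod>x\<in>A. s x)"
  by (induction A rule: infinite_finite_induct) (auto intro: lead_mult)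

lemma lead_nz: "lead e s \<Longrightarrow> s \<noteq> 0"
  by (auto simp: lead_def)

lemma lead_unique: "lead e s \<Longrightarrow> lead e' s \<Longrightarrow> e = e'"
  unfolding lead_def mdvd_def by (meson antisym)

lemma lead_uminus: "lead e s \<Longrightarrow> lead e (- s)"
  by (simp add: lead_def mdvd_uminus)

lemma lead_minus_commute: "lead e (s - t) \<Longrightarrow> lead e (t - s)"
  using lead_uminus[of e "s - t"] by simp

lemma lead_add_sdvd: "lead e s \<Longrightarrow> sdvd e t \<Longrightarrow> lead e (s + t)"
  by (auto simp: lead_def sdvd_iff mdvd_add)

lemma lm_lead: "set xs = UNIV \<Longrightarrow> lead e s \<Longrightarrow> lm xs s = e"
  by (rule lm_eqI) (auto simp: lead_def mdvd_def dest: rlex_le)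

lemma ex_list_hd: "\<exists>xs. set (j # xs) = (UNIV :: 'n::finite set)"
  by (metis UNIV_I finite finite_list insert_absorb list.simps(15))

lemma mdvd_lm: "set xs = UNIV \<Longrightarrow> s \<noteq> 0 \<Longrightarrow> mdvd e s \<Longrightarrow> e \<le> lm xs s"
  by (simp add: cf_lm mdvd_def)

text \<open>When j heads the list, the j-th component of the least exponent is the minimum of the
  j-th components over the whole support. So the total orders together control the partial
  order.\<close>

lemma mdvdI_lm:
  assumes "\<And>j xs. set (j # xs) = UNIV \<Longrightarrow> s \<noteq> 0 \<Longrightarrow> e j \<le> lm (j # xs) s j"
  shows "mdvd e s"
  unfolding mdvd_def
proof (intro allI impI le_funI)
  fix a j assume a: "cf s a \<noteq> 0"
  obtain xs where xs: "set (j # xs) = (UNIV :: 'a set)" using ex_list_hd by blast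
  have s: "s \<noteq> 0" using a by auto
  have "lm (j # xs) s j \<le> a j" using lm_min[OF xs s a] rlex_hd by auto
  then show "e j \<le> a j" using assms[OF xs s] by simp
qed

text \<open>A \<open>lead\<close> factor has the same exponent h for every enumeration, and
  valuations are additive, so h can be subtracted coordinate by coordinate.\<close>

lemma mdvd_cancel:
  fixes s t :: "('n::finite, 'a::idom) fser"
  assumes t: "lead h t" and st: "mdvd (e + h) (s * t)"
  shows "mdvd e s"
proof (rule mdvdI_lm)
  fix j and xs :: "'n list" assume xs: "set (j # xs) = UNIV" and s: "s \<noteq> 0"
  have "e + h \<le> lm (j # xs) (s * t)" using mdvd_lm[OF xs _ st] s lead_nz[OF t] by simp
  also have "\<dots> = lm (j # xs) s + h" using lm_mult[OF xs s lead_nz[OF t]] lm_lead[OF xs t] by simp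
  finally show "e j \<le> lm (j # xs) s j" by (auto simp: le_fun_def)
qed

text \<open>The componentwise minima e and e' of the two supports add up to h, and the coefficient
  of the product at h is the product of the coefficients at e and e'. Since it is nonzero, e itself
  belongs to the support of s.\<close>

lemma lead_factor:
  fixes s t :: "('n::finite, 'a::idom) fser"
  assumes st: "lead h (s * t)"
  shows "\<exists>e. lead e s"
proof -
  have nz: "s \<noteq> 0" "t \<noteq> 0" using lead_nz[OF st] by auto
  have "\<forall>j :: 'n. \<exists>xs. set (j # xs) = UNIV" using ex_list_hd by blast
  from choice[OF this] obtain L where L: "\<And>j :: 'n. set (j # L j) = UNIV" by blast
  define e e' where "e = (\<lambda>j. lm (j # L j) s j)" and "e' = (\<lambda>j. lm (j # L j) t j)"
  have "cf u a \<noteq> 0 \<Longrightarrow> lm (j # L j) u j \<le> a j" for u :: "('n, 'a) fser" and a j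
    using lm_min[OF L, of u a j] rlex_hd by (cases "u = 0") auto
  then have m: "mdvd e s" "mdvd e' t" by (auto simp: mdvd_def e_def e'_def le_fun_def)
  have "e + e' = h"
  proof
    fix j
    show "(e + e') j = h j" using lm_mult[OF L nz, of j] lm_lead[OF L st, of j] by (simp add: e_def e'_def)
  qed
  then have "cf s e * cf t e' \<noteq> 0" using cf_mult_mdvd[OF m] st by (simp add: lead_def)
  then show ?thesis using m by (auto simp: lead_def)
qed

text \<open>No summand lies below the sum for any enumeration, so divisibility of the sum passes to
  every summand. Distinctness is demanded for all enumerations because each coordinate is tested
  with its own.\<close>

lemma
  fixes s :: "'b \<Rightarrow> ('n::finite, 'a::idom) fser"
  assumes I: "finite I" and z: "z \<in> I"
    and dist: "\<And>xs x y. set xs = UNIV \<Longrightarrow> x \<in> I \<Longrightarrow> y \<in> I \<Longrightarrow> s x \<noteq> 0 \<Longrightarrow> s y \<noteq> 0 \<Longrightarrow>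
       lm xs (s x) = lm xs (s y) \<Longrightarrow> x = y"
  shows mdvd_sum_distinct: "mdvd e (\<Sum>x\<in>I. s x) \<Longrightarrow> mdvd e (s z)"
    and sdvd_sum_distinct: "sdvd e (\<Sum>x\<in>I. s x) \<Longrightarrow> sdvd e (s z)"
proof -
  show m: "mdvd e (s z)" if e: "mdvd e (\<Sum>x\<in>I. s x)"
  proof (rule mdvdI_lm)
    fix j and xs :: "'n list" assume xs: "set (j # xs) = UNIV" and "s z \<noteq> 0"
    have L: "(\<Sum>x\<in>I. s x) \<noteq> 0"
      "lm (j # xs) (s z) = lm (j # xs) (\<Sum>x\<in>I. s x) \<or>
       rlex (j # xs) (lm (j # xs) (\<Sum>x\<in>I. s x)) (lm (j # xs) (s z))"
      by (rule lm_sum_distinct[of "j # xs" I z s], (fact xs I z \<open>s z \<noteq> 0\<close>)+, erule (4) dist[OF xs])+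
    have "e j \<le> lm (j # xs) (\<Sum>x\<in>I. s x) j"
      using mdvd_lm[OF xs L(1) e] by (rule le_funD)
    also have "\<dots> \<le> lm (j # xs) (s z) j" using L(2) by (elim disjE) (simp, rule rlex_hd)
    finally show "e j \<le> lm (j # xs) (s z) j" .
  qed
  show "sdvd e (s z)" if e: "sdvd e (\<Sum>x\<in>I. s x)"
  proof (rule ccontr)
    assume "\<not> sdvd e (s z)"
    moreover have "mdvd e (s z)" using m e by (simp add: sdvd_iff)
    ultimately have l: "lead e (s z)" by (auto simp: sdvd_iff lead_def)
    obtain xs :: "'n list" where xs: "set xs = UNIV" using finite_list[OF finite] by blast
    have L: "(\<Sum>x\<in>I. s x) \<noteq> 0"
      "lm xs (s z) = lm xs (\<Sum>x\<in>I. s x) \<or> rlex xs (lm xs (\<Sum>x\<in>I. s x)) (lm xs (s z))"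
      by (rule lm_sum_distinct[of xs I z s], (fact xs I z lead_nz[OF l])+, erule (4) dist[OF xs])+
    have "e < lm xs (\<Sum>x\<in>I. s x)" using cf_lm[OF xs L(1)] e unfolding sdvd_def by blast
    moreover have "lm xs (\<Sum>x\<in>I. s x) = e \<or> rlex xs (lm xs (\<Sum>x\<in>I. s x)) e"
      using L(2) lm_lead[OF xs l] by metis
    ultimately show False using not_rlex_le[of e "lm xs (\<Sum>x\<in>I. s x)" xs] less_le by metis
  qed
qed

section \<open>Characters of the exponent group and their action on series\<close>

definition zlat :: "('n::finite \<Rightarrow> rat) set" where
  "zlat = {a. \<forall>i. a i \<in> \<int>}"

text \<open>Values are automatically units, because \<chi>(-a) \<chi>(a) = \<chi>(0) = 1. These
  characters act as the Galois group of the fractional series over the series with integral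
  exponents.\<close>

definition chars :: "(('n::finite \<Rightarrow> rat) \<Rightarrow> 'a::field) set" where
  "chars = {\<chi>. (\<forall>a b. \<chi> (a + b) = \<chi> a * \<chi> b) \<and> (\<forall>a\<in>zlat. \<chi> a = 1)}"

lemma zlat_0 [simp]: "0 \<in> zlat" by (simp add: zlat_def)
lemma zlat_diff: "a \<in> zlat \<Longrightarrow> b \<in> zlat \<Longrightarrow> a - b \<in> zlat" by (simp add: zlat_def)

lemma chars_add: "\<chi> \<in> chars \<Longrightarrow> \<chi> (a + b) = \<chi> a * \<chi> b" by (simp add: chars_def)
lemma chars_zlat: "\<chi> \<in> chars \<Longrightarrow> a \<in> zlat \<Longrightarrow> \<chi> a = 1" by (simp add: chars_def)
lemma chars_0 [simp]: "\<chi> \<in> chars \<Longrightarrow> \<chi> 0 = 1" by (simp add: chars_zlat)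

lemma chars_uminus_mult: "\<chi> \<in> chars \<Longrightarrow> \<chi> (- a) * \<chi> a = 1"
  using chars_add[of \<chi> "- a" a] by simp

lemma chars_nz [simp]: "\<chi> \<in> chars \<Longrightarrow> \<chi> a \<noteq> 0"
  using chars_uminus_mult[of \<chi> a] by auto

lemma chars_uminus: "\<chi> \<in> chars \<Longrightarrow> \<chi> (- a) = inverse (\<chi> a)"
  using chars_uminus_mult[of \<chi> a] by (simp add: field_simps)

lemma chars_nsm: "\<chi> \<in> chars \<Longrightarrow> \<chi> (nsm k a) = \<chi> a ^ k"
  by (induction k) (simp_all add: nsm_Suc chars_add)

lemma chars_one [simp]: "(\<lambda>a. 1) \<in> chars" by (simp add: chars_def)

lemma chars_mult: "\<chi> \<in> chars \<Longrightarrow> \<psi> \<in> chars \<Longrightarrow> (\<lambda>a. \<chi> a * \<psi> a) \<in> chars"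
  by (auto simp: chars_def)

lemma chars_inverse: "\<chi> \<in> chars \<Longrightarrow> (\<lambda>a. inverse (\<chi> a)) \<in> chars"
  by (auto simp: chars_def)

lift_definition act :: "(('n::finite \<Rightarrow> rat) \<Rightarrow> 'a) \<Rightarrow> ('n, 'a::comm_ring_1) fser \<Rightarrow> ('n, 'a) fser"
  is "\<lambda>\<chi> s a. \<chi> a * s a"
  by (auto simp: is_fser_def frac_supp_def) (metis mult_zero_right)

lift_definition trunc :: "('n::finite \<Rightarrow> rat) set \<Rightarrow> ('n, 'a::zero) fser \<Rightarrow> ('n, 'a) fser"
  is "\<lambda>M s a. if a \<in> M then s a else 0"
  by (auto simp: is_fser_def frac_supp_def)

lemma cf_act [simp]: "cf (act \<chi> s) a = \<chi> a * cf s a" by (simp add: act.rep_eq)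
lemma cf_trunc: "cf (trunc M s) a = (if a \<in> M then cf s a else 0)" by (simp add: trunc.rep_eq)

lemma act_0 [simp]: "act \<chi> 0 = 0" by (rule fser_eqI) simp
lemma act_add: "act \<chi> (s + t) = act \<chi> s + act \<chi> t" by (rule fser_eqI) (simp add: distrib_left)
lemma act_diff: "act \<chi> (s - t) = act \<chi> s - act \<chi> t" by (rule fser_eqI) (simp add: right_diff_distrib)
lemma act_uminus: "act \<chi> (- s) = - act \<chi> s" by (rule fser_eqI) simp
lemma act_one_char [simp]: "act (\<lambda>a. 1) s = s" by (rule fser_eqI) simp
lemma act_act: "act \<chi> (act \<psi> s) = act (\<lambda>a. \<chi> a * \<psi> a) s" by (rule fser_eqI) (simp add: mult.assoc)

lemma act_1 [simp]: "\<chi> \<in> chars \<Longrightarrow> act \<chi> 1 = 1"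
  by (rule fser_eqI) (auto simp: cf_one)

lemma act_mult:
  fixes s t :: "('n::finite, 'a::field) fser"
  assumes "\<chi> \<in> chars"
  shows "act \<chi> (s * t) = act \<chi> s * act \<chi> t"
proof (rule fser_eqI)
  fix a
  have "\<chi> a = \<chi> b * \<chi> (a - b)" for b using chars_add[OF assms, of b "a - b"] by simp
  then have *: "\<chi> a * (cf s b * cf t (a - b)) = \<chi> b * cf s b * (\<chi> (a - b) * cf t (a - b))" for b
    by (metis (no_types) mult.assoc mult.left_commute)
  show "cf (act \<chi> (s * t)) a = cf (act \<chi> s * act \<chi> t) a"
    unfolding cf_mult cf_act sum_distrib_left by (rule sum.cong) (simp_all add: assms *)
qed

lemma act_power: "\<chi> \<in> chars \<Longrightarrow> act \<chi> (s ^ k) = act \<chi> (s :: ('n::finite, 'a::field) fser) ^ k"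
  by (induction k) (simp_all add: act_mult)

lemma act_sum: "act \<chi> (\<Sum>x\<in>A. s x) = (\<Sum>x\<in>A. act \<chi> (s x))"
  by (induction A rule: infinite_finite_induct) (simp_all add: act_add)

lemma act_inverse: "\<chi> \<in> chars \<Longrightarrow> act (\<lambda>a. inverse (\<chi> a)) (act \<chi> s) = s"
  by (rule fser_eqI) simp

lemma act_inj: "\<chi> \<in> chars \<Longrightarrow> act \<chi> s = act \<chi> t \<longleftrightarrow> s = t"
  by (metis act_inverse)

lemma act_eq_0 [simp]: "\<chi> \<in> chars \<Longrightarrow> act \<chi> s = 0 \<longleftrightarrow> s = 0"
  using act_inj[of \<chi> s 0] by simp

lemma mdvd_act [simp]: "\<chi> \<in> chars \<Longrightarrow> mdvd e (act \<chi> s) \<longleftrightarrow> mdvd e s"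
  by (simp add: mdvd_def)

lemma sdvd_act [simp]: "\<chi> \<in> chars \<Longrightarrow> sdvd e (act \<chi> s) \<longleftrightarrow> sdvd e s"
  by (simp add: sdvd_def)

lemma lead_act [simp]: "\<chi> \<in> chars \<Longrightarrow> lead e (act \<chi> s) \<longleftrightarrow> lead e s"
  by (simp add: lead_def)

lemma lm_act [simp]: "\<chi> \<in> chars \<Longrightarrow> lm xs (act \<chi> s) = lm xs s"
  by (simp add: lm_def)

lemma act_zlat: "\<chi> \<in> chars \<Longrightarrow> (\<And>a. cf s a \<noteq> 0 \<Longrightarrow> \<chi> a = 1) \<Longrightarrow> act \<chi> s = s"
  by (rule fser_eqI) (metis cf_act mult_1 mult_zero_right)

section \<open>Extension of characters\<close>

definition zsm :: "int \<Rightarrow> ('n::finite \<Rightarrow> rat) \<Rightarrow> ('n \<Rightarrow> rat)" where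
  "zsm k a = (\<lambda>i. of_int k * a i)"

text \<open>The graph of a homomorphism into the units of K, defined on a subgroup of Q^d that
  contains Z^d and trivial on Z^d. Graphs are ordered by inclusion, which suits Zorn's lemma;
  single-valuedness is encoded by the fibre over 0 alone.\<close>

definition partial_char :: "(('n::finite \<Rightarrow> rat) \<times> 'a::field) set \<Rightarrow> bool" where
  "partial_char G \<longleftrightarrow> (\<forall>a\<in>zlat. (a, 1) \<in> G) \<and>
     (\<forall>a x b y. (a, x) \<in> G \<longrightarrow> (b, y) \<in> G \<longrightarrow> (a - b, x / y) \<in> G) \<and>
     (\<forall>x. (0, x) \<in> G \<longrightarrow> x = 1) \<and> (\<forall>a x. (a, x) \<in> G \<longrightarrow> x \<noteq> 0)"

lemma partial_charD:
  assumes "partial_char G"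
  shows "a \<in> zlat \<Longrightarrow> (a, 1) \<in> G" "(a, x) \<in> G \<Longrightarrow> (b, y) \<in> G \<Longrightarrow> (a - b, x / y) \<in> G"
    "(0, x) \<in> G \<Longrightarrow> x = 1" "(a, x) \<in> G \<Longrightarrow> x \<noteq> 0"
  using assms unfolding partial_char_def by blast+

lemma partial_char_add:
  assumes G: "partial_char G" and "(a, x) \<in> G" "(b, y) \<in> G"
  shows "(a + b, x * y) \<in> G"
proof -
  have "(0 - b, 1 / y) \<in> G" by (rule partial_charD(2)[OF G partial_charD(1)[OF G zlat_0] assms(3)])
  from partial_charD(2)[OF G assms(2) this] show ?thesis by simp
qed

lemma partial_char_fun:
  assumes G: "partial_char G" and "(a, x) \<in> G" "(a, y) \<in> G"
  shows "x = y"
proof -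
  have "(0, x / y) \<in> G" using partial_charD(2)[OF G assms(2,3)] by simp
  then show ?thesis using partial_charD(3)[OF G] partial_charD(4)[OF G assms(3)] by force
qed

lemma partial_char_nsm:
  assumes G: "partial_char G" and "(a, x) \<in> G"
  shows "(nsm k a, x ^ k) \<in> G"
  by (induction k)
    (simp_all only: nsm_0 nsm_Suc power_0 power_Suc partial_charD(1)[OF G zlat_0] partial_char_add[OF G assms(2)])

lemma partial_char_zsm:
  assumes G: "partial_char G" and "(a, x) \<in> G"
  shows "(zsm k a, x powi k) \<in> G"
proof (cases "0 \<le> k")
  case True
  have "zsm k a = nsm (nat k) a" using True by (simp add: zsm_def nsm_def fun_eq_iff)
  then show ?thesis using partial_char_nsm[OF assms, of "nat k"] True by (simp add: power_int_def)
next
  case False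
  have "zsm k a = 0 - nsm (nat (- k)) a" using False by (simp add: zsm_def nsm_def fun_eq_iff)
  moreover have "x powi k = 1 / x ^ nat (- k)" using False by (simp add: power_int_def field_simps)
  ultimately show ?thesis
    using partial_charD(2)[OF G partial_charD(1)[OF G zlat_0] partial_char_nsm[OF assms, of "nat (- k)"]] by simp
qed

text \<open>Here r is the order of v modulo the domain, so the only relation to respect is the
  prescribed value c at \<open>nsm r v\<close>. Any r-th root of c is then a consistent value at
  v.\<close>

lemma partial_char_step:
  assumes G: "partial_char G" and r: "0 < r" "(nsm r v, c) \<in> G"
    and min: "\<And>k x. 0 < k \<Longrightarrow> k < r \<Longrightarrow> (nsm k v, x) \<notin> G" and w: "w ^ r = c"
  shows "\<exists>G'. partial_char G' \<and> G \<subseteq> G' \<and> (v, w) \<in> G'"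
proof -
  define G' where "G' = {(a + zsm k v, x * w powi k) | a x k. (a, x) \<in> G}"
  have w0: "w \<noteq> 0" using partial_charD(4)[OF G r(2)] w r by auto
  have mem: "(a + zsm k v, x * w powi k) \<in> G'" if "(a, x) \<in> G" for a x k using that by (auto simp: G'_def)
  have z0: "zsm 0 v = 0" "zsm 1 v = v" by (auto simp: zsm_def fun_eq_iff)
  have sub: "G \<subseteq> G'" using mem[where k = 0] z0 by auto
  have "partial_char G'"
    unfolding partial_char_def
  proof (intro conjI allI impI ballI)
    show "(a, 1) \<in> G'" if "a \<in> zlat" for a using sub partial_charD(1)[OF G that] by blast
    fix a x assume "(a, x) \<in> G'"
    then obtain a' x' k where a: "a = a' + zsm k v" "x = x' * w powi k" "(a', x') \<in> G" by (auto simp: G'_def)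
    show "x \<noteq> 0" using partial_charD(4)[OF G a(3)] w0 a(2) by simp
    fix b y assume "(b, y) \<in> G'"
    then obtain b' y' l where b: "b = b' + zsm l v" "y = y' * w powi l" "(b', y') \<in> G" by (auto simp: G'_def)
    have "a - b = (a' - b') + zsm (k - l) v" by (simp add: a b zsm_def fun_eq_iff algebra_simps)
    moreover have "x / y = (x' / y') * w powi (k - l)" using w0 by (simp add: a b power_int_diff)
    ultimately show "(a - b, x / y) \<in> G'" using mem[OF partial_charD(2)[OF G a(3) b(3)]] by simp
  next
    fix x assume "(0, x) \<in> G'"
    then obtain a k y where a: "0 = a + zsm k v" "x = y * w powi k" "(a, y) \<in> G" by (auto simp: G'_def)
    \<comment> \<open>Division with remainder of k by r. The multiple l of v with l < r lies in the
      domain, so minimality of r forces l = 0.\<close>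
    define q where "q = k div int r"
    define l where "l = nat (k mod int r)"
    have k: "k = int r * q + int l" using r by (simp add: q_def l_def)
    have l: "l < r" using r by (simp add: l_def nat_less_iff)
    have "(0 - a, 1 / y) \<in> G" by (rule partial_charD(2)[OF G partial_charD(1)[OF G zlat_0] a(3)])
    moreover have "0 - a = zsm k v" using a(1) by (metis add_diff_cancel_left')
    ultimately have kv: "(zsm k v, 1 / y) \<in> G" by simp
    have qr: "(zsm q (nsm r v), c powi q) \<in> G" by (rule partial_char_zsm[OF G r(2)])
    have "zsm k v - zsm q (nsm r v) = nsm l v" by (simp add: k zsm_def nsm_def fun_eq_iff algebra_simps)
    then have "(nsm l v, 1 / y / c powi q) \<in> G" using partial_charD(2)[OF G kv qr] by simp
    then have l0: "l = 0" using min[of l] l by auto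
    then have "zsm k v = zsm q (nsm r v)" by (simp add: k zsm_def nsm_def fun_eq_iff algebra_simps)
    then have "1 / y = c powi q" using partial_char_fun[OF G kv] qr by simp
    also have "\<dots> = w powi k" using w0 by (simp add: k l0 w[symmetric] power_int_mult)
    finally show "x = 1" using a(2) partial_charD(4)[OF G a(3)] by (simp add: field_simps)
  qed
  moreover have "(v, w) \<in> G'" using mem[OF partial_charD(1)[OF G zlat_0], where k = 1] z0 by simp
  ultimately show ?thesis using sub by blast
qed

lemma ex_nsm_zlat: "\<exists>r>0. nsm r (v :: 'n::finite \<Rightarrow> rat) \<in> zlat"
  using ex_common_denominator[of v] by (auto simp: zlat_def)

lemma ex_root:
  assumes K: "alg_closed_field TYPE('a::field)" and r: "0 < r"
  shows "\<exists>w::'a. w ^ r = c"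
proof -
  have "degree (monom 1 r + [:- c:] :: 'a poly) = r"
    using r by (subst degree_add_eq_left) (auto simp: degree_monom_eq)
  then obtain w where "poly (monom 1 r + [:- c:]) w = 0"
    using K r unfolding alg_closed_field_def by metis
  then show ?thesis by (intro exI[of _ w]) (simp add: poly_monom)
qed

text \<open>A maximal extension is total: some positive multiple of any v lies in Z^d, and K has the
  roots needed to adjoin v. Zorn's lemma is the natural tool since Q^d is not finitely
  generated.\<close>

lemma partial_char_extend:
  fixes G :: "(('n::finite \<Rightarrow> rat) \<times> 'a::field) set"
  assumes K: "alg_closed_field TYPE('a)" and G: "partial_char G"
  shows "\<exists>\<chi>\<in>chars. \<forall>(a, x)\<in>G. \<chi> a = x"
proof -
  define A where "A = {G'. partial_char G' \<and> G \<subseteq> G'}"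
  have "\<forall>C\<in>chains A. \<exists>U\<in>A. \<forall>X\<in>C. X \<subseteq> U"
  proof
    fix C assume C: "C \<in> chains A"
    show "\<exists>U\<in>A. \<forall>X\<in>C. X \<subseteq> U"
    proof (cases "C = {}")
      case True
      then show ?thesis using G by (auto simp: A_def)
    next
      case False
      have CA: "C \<subseteq> A" using C by (auto simp: chains_def)
      have ch: "X \<subseteq> Y \<or> Y \<subseteq> X" if "X \<in> C" "Y \<in> C" for X Y
        using C that by (auto simp: chains_def chain_subset_def)
      have "partial_char (\<Union>C)"
        unfolding partial_char_def
      proof (intro conjI allI impI ballI)
        obtain X where X: "X \<in> C" using False by blast
        show "(a, 1) \<in> \<Union>C" if "a \<in> zlat" for a
          using X CA partial_charD(1)[OF _ that] by (auto simp: A_def)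
        fix a x assume "(a, x) \<in> \<Union>C"
        then obtain X where X: "X \<in> C" "(a, x) \<in> X" by blast
        then show "x \<noteq> 0" using CA partial_charD(4)[of X a x] by (auto simp: A_def)
        fix b y assume "(b, y) \<in> \<Union>C"
        then obtain Y where Y: "Y \<in> C" "(b, y) \<in> Y" by blast
        have pX: "partial_char X" "partial_char Y" using X Y CA by (auto simp: A_def)
        show "(a - b, x / y) \<in> \<Union>C"
          using ch[OF X(1) Y(1)] partial_charD(2)[OF pX(1), of a x b y] partial_charD(2)[OF pX(2), of a x b y] X Y
          by blast
      next
        fix x assume "(0, x) \<in> \<Union>C"
        then obtain X where X: "X \<in> C" "(0, x) \<in> X" by blast
        then have "partial_char X" using CA by (auto simp: A_def)
        then show "x = 1" using partial_charD(3) X by blast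
      qed
      moreover have "G \<subseteq> \<Union>C" using False CA by (auto simp: A_def)
      ultimately show ?thesis by (auto simp: A_def)
    qed
  qed
  from Zorn_Lemma2[OF this] obtain H where H: "H \<in> A" and max: "\<And>X. X \<in> A \<Longrightarrow> H \<subseteq> X \<Longrightarrow> X = H" by blast
  have pH: "partial_char H" and GH: "G \<subseteq> H" using H by (auto simp: A_def)
  have ex: "\<exists>x. (v, x) \<in> H" for v
  proof -
    define P where "P r \<longleftrightarrow> 0 < r \<and> (\<exists>c. (nsm r v, c) \<in> H)" for r
    define r where "r = (LEAST r. P r)"
    have "\<exists>r. P r" using ex_nsm_zlat[of v] partial_charD(1)[OF pH] by (auto simp: P_def)
    then have "P r" unfolding r_def by (rule LeastI_ex)
    then obtain c where r: "0 < r" "(nsm r v, c) \<in> H" by (auto simp: P_def)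
    have min: "(nsm k v, x) \<notin> H" if "0 < k" "k < r" for k x
      using not_less_Least[of k P] that by (auto simp: r_def P_def)
    obtain w where "w ^ r = c" using ex_root[OF K r(1)] by blast
    from partial_char_step[OF pH r min this] obtain H' where "partial_char H'" "H \<subseteq> H'" "(v, w) \<in> H'" by blast
    then have "H' = H" using max[of H'] GH by (auto simp: A_def)
    then show ?thesis using \<open>(v, w) \<in> H'\<close> by blast
  qed
  define \<chi> where "\<chi> = (\<lambda>v. SOME x. (v, x) \<in> H)"
  have \<chi>: "(v, \<chi> v) \<in> H" for v unfolding \<chi>_def by (rule someI_ex[OF ex])
  have eq: "\<chi> v = x" if "(v, x) \<in> H" for v x using partial_char_fun[OF pH \<chi> that] .
  have "\<chi> \<in> chars" unfolding chars_def
    using eq[OF partial_charD(1)[OF pH]] eq[OF partial_char_add[OF pH \<chi> \<chi>]] by auto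
  moreover have "\<forall>(a, x)\<in>G. \<chi> a = x" using eq GH by blast
  ultimately show ?thesis by blast
qed

section \<open>Groups between Z^d and Q^d, and orders of vectors modulo them\<close>

definition lattice :: "('n::finite \<Rightarrow> rat) set \<Rightarrow> bool" where
  "lattice M \<longleftrightarrow> zlat \<subseteq> M \<and> (\<forall>a\<in>M. \<forall>b\<in>M. a - b \<in> M)"

lemma lattice_zlat [simp]: "lattice zlat" by (simp add: lattice_def zlat_diff)

lemma latticeD:
  assumes "lattice M"
  shows "0 \<in> M" "a \<in> M \<Longrightarrow> b \<in> M \<Longrightarrow> a - b \<in> M" "a \<in> zlat \<Longrightarrow> a \<in> M"
    "a \<in> M \<Longrightarrow> - a \<in> M" "a \<in> M \<Longrightarrow> b \<in> M \<Longrightarrow> a + b \<in> M" "a \<in> M \<Longrightarrow> nsm k a \<in> M"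
proof -
  show 1: "0 \<in> M" and 2: "a \<in> M \<Longrightarrow> b \<in> M \<Longrightarrow> a - b \<in> M" and "a \<in> zlat \<Longrightarrow> a \<in> M" for a b
    using assms zlat_0 unfolding lattice_def by blast+
  show 3: "- a \<in> M" if "a \<in> M" for a using 2[OF 1 that] by simp
  show 4: "a + b \<in> M" if "a \<in> M" "b \<in> M" for a b using 2[OF that(1) 3[OF that(2)]] by simp
  show "nsm k a \<in> M" if "a \<in> M" by (induction k) (simp_all only: 1 4 that nsm_0 nsm_Suc)
qed

definition ord_mod :: "('n \<Rightarrow> rat) set \<Rightarrow> ('n \<Rightarrow> rat) \<Rightarrow> nat" where
  "ord_mod M v = (LEAST r. 0 < r \<and> nsm r v \<in> M)"

lemma
  fixes v :: "'n::finite \<Rightarrow> rat"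
  assumes M: "lattice M"
  shows ord_mod_pos: "0 < ord_mod M v" and nsm_ord_mod: "nsm (ord_mod M v) v \<in> M"
    and ord_mod_min: "0 < k \<Longrightarrow> k < ord_mod M v \<Longrightarrow> nsm k v \<notin> M"
proof -
  have "\<exists>r. 0 < r \<and> nsm r v \<in> M" using ex_nsm_zlat[of v] latticeD(3)[OF M] by blast
  from LeastI_ex[OF this] show "0 < ord_mod M v" "nsm (ord_mod M v) v \<in> M" by (auto simp: ord_mod_def)
  show "0 < k \<Longrightarrow> k < ord_mod M v \<Longrightarrow> nsm k v \<notin> M"
    using not_less_Least[of k "\<lambda>r. 0 < r \<and> nsm r v \<in> M"] by (auto simp: ord_mod_def)
qed

text \<open>Start from the trivial character on M, adjoin v with value w, then extend to all of
  Q^d.\<close>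

lemma char_extend:
  fixes M :: "('n::finite \<Rightarrow> rat) set" and w :: "'a::field"
  assumes K: "alg_closed_field TYPE('a)" and M: "lattice M" and w: "w ^ ord_mod M v = 1"
  shows "\<exists>\<chi>\<in>chars. (\<forall>a\<in>M. \<chi> a = 1) \<and> \<chi> v = w"
proof -
  have G: "partial_char (M \<times> {1::'a})"
    using latticeD[OF M] by (auto simp: partial_char_def)
  have "\<exists>G'. partial_char G' \<and> M \<times> {1::'a} \<subseteq> G' \<and> (v, w) \<in> G'"
    by (rule partial_char_step[OF G ord_mod_pos[OF M] _ _ w]) (use nsm_ord_mod[OF M] ord_mod_min[OF M] in auto)
  then obtain G' where G': "partial_char G'" "M \<times> {1} \<subseteq> G'" "(v, w) \<in> G'" by blast
  obtain \<chi> where "\<chi> \<in> chars" "\<forall>(a, x)\<in>G'. \<chi> a = x" using partial_char_extend[OF K G'(1)] by blast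
  with G' show ?thesis by (intro bexI[of _ \<chi>]) auto
qed

lemma card_simple_roots:
  fixes p :: "'a::field_char_0 poly"
  assumes K: "alg_closed_field TYPE('a)" and p: "p \<noteq> 0"
    and simple: "\<And>x. poly p x = 0 \<Longrightarrow> poly (pderiv p) x \<noteq> 0"
  shows "card {x. poly p x = 0} = degree p"
  using p simple
proof (induction "degree p" arbitrary: p)
  case 0
  then obtain c where "p = [:c:]" using degree_eq_zeroE by metis
  then show ?case using 0 by simp
next
  case (Suc n)
  then obtain x where x: "poly p x = 0" using K unfolding alg_closed_field_def by (metis zero_less_Suc)
  then obtain q where q: "p = [:- x, 1:] * q" by (auto simp: poly_eq_0_iff_dvd)
  have q0: "q \<noteq> 0" using Suc.prems q by auto
  have pd: "pderiv p = q + [:- x, 1:] * pderiv q" unfolding q pderiv_mult by (simp add: pderiv_pCons)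
  have "degree p = Suc (degree q)" unfolding q using q0 by (subst degree_mult_eq) auto
  then have dq: "n = degree q" using Suc.hyps by simp
  have "card {y. poly q y = 0} = degree q"
  proof (rule Suc.hyps(1)[OF dq q0])
    fix y assume y: "poly q y = 0"
    then have "poly p y = 0" by (simp add: q)
    from Suc.prems(2)[OF this] y show "poly (pderiv q) y \<noteq> 0" by (auto simp: pd)
  qed
  moreover have "{y. poly p y = 0} = insert x {y. poly q y = 0}" by (auto simp: q)
  moreover have "x \<notin> {y. poly q y = 0}" using Suc.prems(2)[OF x] by (auto simp: pd)
  ultimately show ?case using Suc.hyps(2) dq poly_roots_finite[OF q0] by simp
qed

text \<open>In characteristic zero the derivative r x^(r - 1) vanishes only at 0, so all roots of
  x^r - 1 are simple.\<close>

lemma card_roots_of_unity: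
  assumes K: "alg_closed_field TYPE('a::field_char_0)" and r: "0 < r"
  shows "card {w::'a. w ^ r = 1} = r"
proof -
  define p where "p = (monom 1 r + [:- 1:] :: 'a poly)"
  have dp: "degree p = r"
    unfolding p_def using r by (subst degree_add_eq_left) (auto simp: degree_monom_eq)
  have p: "poly p x = x ^ r - 1" for x by (simp add: p_def poly_monom)
  have "poly (pderiv p) x \<noteq> 0" if "poly p x = 0" for x
  proof -
    have "x \<noteq> 0" using that r by (auto simp: p zero_power)
    moreover have "poly (pderiv p) x = of_nat r * x ^ (r - 1)"
      by (simp add: p_def pderiv_add pderiv_monom poly_monom pderiv_pCons)
    ultimately show ?thesis using r by simp
  qed
  then have "card {x. poly p x = 0} = degree p" using dp r by (intro card_simple_roots[OF K]) auto
  then show ?thesis by (simp add: dp p)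
qed

text \<open>The order of v modulo M exceeds 1, so there is a nontrivial root of unity to prescribe
  at v. Consequently a series fixed by all characters that are trivial on M has its support in
  M.\<close>

lemma char_separate:
  fixes M :: "('n::finite \<Rightarrow> rat) set"
  assumes K: "alg_closed_field TYPE('a::field_char_0)" and M: "lattice M" and v: "v \<notin> M"
  shows "\<exists>\<chi>\<in>chars. (\<forall>a\<in>M. \<chi> a = (1::'a)) \<and> \<chi> v \<noteq> 1"
proof -
  have "ord_mod M v \<noteq> 1" using nsm_ord_mod[OF M, of v] v by auto
  then have "card {w::'a. w ^ ord_mod M v = 1} \<noteq> 1"
    using card_roots_of_unity[OF K ord_mod_pos[OF M]] by metis
  then have "{w::'a. w ^ ord_mod M v = 1} \<noteq> {1}" by force
  then obtain w :: 'a where "w ^ ord_mod M v = 1" "w \<noteq> 1" by force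
  then show ?thesis using char_extend[OF K M] by metis
qed

lemma nsm_mem_iff:
  fixes v :: "'n::finite \<Rightarrow> rat"
  assumes M: "lattice M"
  shows "nsm k v \<in> M \<longleftrightarrow> ord_mod M v dvd k"
proof
  assume k: "nsm k v \<in> M"
  have "nsm (k mod ord_mod M v) v = nsm k v - nsm (k div ord_mod M v) (nsm (ord_mod M v) v)"
  proof
    fix i
    have "rat_of_nat k = of_nat (k div ord_mod M v) * of_nat (ord_mod M v) + of_nat (k mod ord_mod M v)"
      by (metis div_mult_mod_eq of_nat_add of_nat_mult)
    then show "nsm (k mod ord_mod M v) v i = (nsm k v - nsm (k div ord_mod M v) (nsm (ord_mod M v) v)) i"
      by (simp add: algebra_simps)
  qed
  then have "nsm (k mod ord_mod M v) v \<in> M"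
    using k latticeD(2,6)[OF M] nsm_ord_mod[OF M, of v] by metis
  then show "ord_mod M v dvd k"
    using ord_mod_min[OF M, of "k mod ord_mod M v" v] ord_mod_pos[OF M, of v]
    by (meson dvd_eq_mod_eq_0 mod_less_divisor not_gr_zero)
next
  assume "ord_mod M v dvd k"
  then obtain q where "k = ord_mod M v * q" by blast
  then have "nsm k v = nsm q (nsm (ord_mod M v) v)" by (simp add: nsm_def fun_eq_iff)
  then show "nsm k v \<in> M" using latticeD(6)[OF M nsm_ord_mod[OF M]] by metis
qed

text \<open>The cosets are represented by the multiples 0, ..., r - 1 of v with r the order of v
  modulo M. This replaces the indices [M_i : M_(i-1)] by orders of characteristic exponents.\<close>

lemma grp_index_ord_mod:
  fixes v :: "'n::finite \<Rightarrow> rat"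
  assumes M: "lattice M"
  shows "grp_index {a + zsm k v | a k. a \<in> M} M = ord_mod M v"
proof -
  define r where "r = ord_mod M v"
  define M' where "M' = {a + zsm k v | a k. a \<in> M}"
  define C where "C x = {y \<in> M'. (\<lambda>j. y j - x j) \<in> M}" for x
  have C_eq: "C x = C y" if "x - y \<in> M" for x y
  proof -
    have "z - x \<in> M \<longleftrightarrow> z - y \<in> M" for z
      using latticeD(5)[OF M _ that, of "z - x"] latticeD(2)[OF M _ that, of "z - y"]
      by (auto simp: algebra_simps)
    then show ?thesis by (simp add: C_def fun_diff_def)
  qed
  have sub: "C ` M' \<subseteq> (\<lambda>k. C (nsm k v)) ` {..<r}"
  proof
    fix X assume "X \<in> C ` M'"
    then obtain a k where a: "a \<in> M" "X = C (a + zsm k v)" by (auto simp: M'_def)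
    define l where "l = nat (k mod int r)"
    have r: "0 < r" using ord_mod_pos[OF M] by (simp add: r_def)
    have "k = int r * (k div int r) + int l" using r by (simp add: l_def)
    then have k: "rat_of_int k = of_nat r * of_int (k div int r) + of_nat l"
      by (metis of_int_add of_int_mult of_int_of_nat_eq)
    have "zsm (k div int r) (nsm r v) \<in> M"
    proof (cases "0 \<le> k div int r")
      case True
      then have "zsm (k div int r) (nsm r v) = nsm (nat (k div int r)) (nsm r v)"
        by (simp add: zsm_def fun_eq_iff)
      then show ?thesis using latticeD(6)[OF M nsm_ord_mod[OF M]] unfolding r_def by metis
    next
      case False
      then have "zsm (k div int r) (nsm r v) = - nsm (nat (- (k div int r))) (nsm r v)"
        by (simp add: zsm_def fun_eq_iff)
      then show ?thesis using latticeD(4)[OF M latticeD(6)[OF M nsm_ord_mod[OF M]]] unfolding r_def by metis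
    qed
    moreover have "(a + zsm k v) - nsm l v = a + zsm (k div int r) (nsm r v)"
      by (simp add: fun_eq_iff zsm_def k algebra_simps)
    ultimately have "C (a + zsm k v) = C (nsm l v)" using latticeD(5)[OF M a(1)] by (intro C_eq) metis
    moreover have "l < r" using r by (simp add: l_def nat_less_iff)
    ultimately show "X \<in> (\<lambda>k. C (nsm k v)) ` {..<r}" using a by auto
  qed
  have memM': "nsm k v \<in> M'" for k
    unfolding M'_def using latticeD(1)[OF M]
    by (auto intro!: exI[of _ 0] exI[of _ "int k"] simp: zsm_def nsm_def fun_eq_iff)
  have "inj_on (\<lambda>k. C (nsm k v)) {..<r}"
  proof (rule linorder_inj_onI)
    fix k l assume kl: "k < l" "k \<in> {..<r}" "l \<in> {..<r}"
    show "C (nsm k v) \<noteq> C (nsm l v)"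
    proof
      assume "C (nsm k v) = C (nsm l v)"
      moreover have "nsm l v \<in> C (nsm l v)" using memM' latticeD(1)[OF M] by (simp add: C_def zero_fun_def)
      ultimately have "nsm l v \<in> C (nsm k v)" by simp
      then have "nsm l v - nsm k v \<in> M" unfolding C_def fun_diff_def by blast
      moreover have "nsm l v - nsm k v = nsm (l - k) v" using kl by (simp add: fun_eq_iff of_nat_diff algebra_simps)
      moreover have "0 < l - k" "l - k < ord_mod M v" using kl by (auto simp: r_def)
      ultimately show False using ord_mod_min[OF M, of "l - k" v] by simp
    qed
  qed auto
  moreover have "C ` M' = (\<lambda>k. C (nsm k v)) ` {..<r}" using sub memM' by blast
  ultimately have "card (C ` M') = r" by (simp add: card_image)
  moreover have "C = (\<lambda>x. {y \<in> M'. (\<lambda>j. y j - x j) \<in> M})" by (simp add: C_def fun_eq_iff)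
  ultimately show ?thesis unfolding grp_index_def M'_def[symmetric] r_def by simp
qed

section \<open>The groups generated by Z^d and the first characteristic exponents\<close>

lemma char_lat_0: "char_lat (hs :: ('a::finite \<Rightarrow> rat) list) 0 = zlat"
proof -
  have "(\<exists>z. v = (\<lambda>j. of_int (z j))) \<longleftrightarrow> (\<forall>j. v j \<in> \<int>)" for v :: "'a \<Rightarrow> rat"
    by (auto simp: Ints_def fun_eq_iff image_iff intro: choice)
  then show ?thesis by (simp add: char_lat_def zlat_def)
qed

lemma char_lat_Suc: "char_lat hs (Suc i) = {a + zsm k (hs ! i) | a k. a \<in> char_lat hs i}"
proof (intro equalityI subsetI)
  fix v assume "v \<in> char_lat hs (Suc i)"
  then obtain z c where "v = (\<lambda>j. of_int (z j) + (\<Sum>l<Suc i. of_int (c l) * (hs ! l) j))"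
    unfolding char_lat_def by blast
  then have "v = (\<lambda>j. of_int (z j) + (\<Sum>l<i. of_int (c l) * (hs ! l) j)) + zsm (c i) (hs ! i)"
    by (simp add: zsm_def fun_eq_iff)
  moreover have "(\<lambda>j. of_int (z j) + (\<Sum>l<i. of_int (c l) * (hs ! l) j)) \<in> char_lat hs i"
    unfolding char_lat_def by blast
  ultimately show "v \<in> {a + zsm k (hs ! i) | a k. a \<in> char_lat hs i}" by blast
next
  fix v assume "v \<in> {a + zsm k (hs ! i) | a k. a \<in> char_lat hs i}"
  then obtain z c k where "v = (\<lambda>j. of_int (z j) + (\<Sum>l<i. of_int (c l) * (hs ! l) j)) + zsm k (hs ! i)"
    unfolding char_lat_def by blast
  then have "v = (\<lambda>j. of_int (z j) + (\<Sum>l<Suc i. of_int ((c(i := k)) l) * (hs ! l) j))"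
    by (simp add: zsm_def fun_eq_iff)
  then show "v \<in> char_lat hs (Suc i)" unfolding char_lat_def by blast
qed

lemma lattice_char_lat [simp]: "lattice (char_lat (hs :: ('a::finite \<Rightarrow> rat) list) i)"
proof (induction i)
  case 0
  then show ?case by (simp add: char_lat_0)
next
  case (Suc i)
  have *: "a + zsm k v - (b + zsm l v) = (a - b) + zsm (k - l) v" for a b v :: "'a \<Rightarrow> rat" and k l
    by (simp add: zsm_def fun_eq_iff algebra_simps)
  have "zsm 0 v = 0" for v :: "'a \<Rightarrow> rat" by (simp add: zsm_def fun_eq_iff)
  then have "a \<in> char_lat hs (Suc i)" if "a \<in> char_lat hs i" for a
    using that unfolding char_lat_Suc by (metis (mono_tags, lifting) add.right_neutral mem_Collect_eq)
  then show ?case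
    using Suc unfolding lattice_def
    by (smt (verit, best) * char_lat_Suc mem_Collect_eq subset_iff)
qed

lemma char_lat_mono: "i \<le> j \<Longrightarrow> char_lat (hs :: ('a::finite \<Rightarrow> rat) list) i \<subseteq> char_lat hs j"
proof (induction rule: dec_induct)
  case (step n)
  have "zsm 0 v = 0" for v :: "'a \<Rightarrow> rat" by (simp add: zsm_def fun_eq_iff)
  then have "char_lat hs n \<subseteq> char_lat hs (Suc n)"
    unfolding char_lat_Suc by (smt (verit) add.right_neutral mem_Collect_eq subsetI)
  then show ?case using step by blast
qed simp

lemma nth_mem_char_lat: "l < i \<Longrightarrow> (hs :: ('a::finite \<Rightarrow> rat) list) ! l \<in> char_lat hs i"
proof -
  assume "l < i"
  have "zsm 1 v = v" for v :: "'a \<Rightarrow> rat" by (simp add: zsm_def fun_eq_iff)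
  then have "hs ! l \<in> char_lat hs (Suc l)"
    unfolding char_lat_Suc using latticeD(1)[OF lattice_char_lat]
    by (metis (mono_tags, lifting) add_0 mem_Collect_eq)
  then show ?thesis using char_lat_mono[of "Suc l" i hs] \<open>l < i\<close> by auto
qed

lemma char_n_Suc: "char_n (hs :: ('n::finite \<Rightarrow> rat) list) (Suc i) = ord_mod (char_lat hs i) (hs ! i)"
  unfolding char_n_def char_lat_Suc diff_Suc_1 by (rule grp_index_ord_mod) simp

lemma char_trivial_char_lat:
  assumes "\<chi> \<in> chars" "\<And>l. l < i \<Longrightarrow> \<chi> (hs ! l) = 1" "a \<in> char_lat hs i"
  shows "\<chi> a = 1"
  using assms(2,3)
proof (induction i arbitrary: a)
  case 0
  then show ?case using assms(1) by (simp add: char_lat_0 chars_zlat)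
next
  case (Suc i)
  then obtain b k where b: "a = b + zsm k (hs ! i)" "b \<in> char_lat hs i" by (auto simp: char_lat_Suc)
  have one: "\<chi> (nsm l (hs ! i)) = 1" for l using Suc.prems(1)[of i] by (simp add: chars_nsm[OF assms(1)])
  have "\<chi> (zsm k (hs ! i)) = 1"
  proof (cases "0 \<le> k")
    case True
    then have "zsm k (hs ! i) = nsm (nat k) (hs ! i)" by (simp add: zsm_def fun_eq_iff)
    then show ?thesis using one by metis
  next
    case False
    then have "zsm k (hs ! i) = - nsm (nat (- k)) (hs ! i)" by (simp add: zsm_def fun_eq_iff)
    then show ?thesis using one chars_uminus[OF assms(1)] by (metis inverse_1)
  qed
  moreover have "\<chi> b = 1" using Suc.IH[OF _ b(2)] Suc.prems(1) by simp
  ultimately show ?case using chars_add[OF assms(1), of b "zsm k (hs ! i)"] b(1) by (metis mult_1)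
qed

section \<open>Hensel's lemma for fractional power series\<close>

definition wt :: "('n::finite \<Rightarrow> rat) \<Rightarrow> rat" where
  "wt a = (\<Sum>i\<in>UNIV. a i)"

text \<open>The t-th power of the maximal ideal of K[[X^(1/m)]]: \<open>of_nat m * wt a\<close> is
  the total degree in the variables X_i^(1/m). With m fixed these degrees are integers, so that each
  step of an iteration can gain a full unit.\<close>

definition fil :: "nat \<Rightarrow> nat \<Rightarrow> ('n::finite, 'a::field) fser \<Rightarrow> bool" where
  "fil m t s \<longleftrightarrow> frac_supp m (cf s) \<and> (\<forall>a. cf s a \<noteq> 0 \<longrightarrow> of_nat t \<le> of_nat m * wt a)"

lemma filI: "frac_supp m (cf s) \<Longrightarrow> (\<And>a. cf s a \<noteq> 0 \<Longrightarrow> of_nat t \<le> of_nat m * wt a) \<Longrightarrow> fil m t s"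
  by (simp add: fil_def)

lemma wt_add: "wt (a + b) = wt a + wt b"
  by (simp add: wt_def sum.distrib)

lemma frac_supp_fil: "fil m t s \<Longrightarrow> frac_supp m (cf s)"
  by (simp add: fil_def)

lemma wt_nonneg: "0 \<le> a \<Longrightarrow> 0 \<le> wt a"
  by (simp add: wt_def le_fun_def sum_nonneg)

lemma fil_0_iff: "fil m 0 s \<longleftrightarrow> frac_supp m (cf s)"
proof
  assume s: "frac_supp m (cf s)"
  show "fil m 0 s" by (rule filI[OF s]) (simp add: cf_nonneg wt_nonneg)
qed (rule frac_supp_fil)

lemma fil_mono: "fil m t s \<Longrightarrow> u \<le> t \<Longrightarrow> fil m u s"
  unfolding fil_def by (meson of_nat_mono order_trans)

lemma frac_supp_add: "frac_supp m (cf s) \<Longrightarrow> frac_supp m (cf t) \<Longrightarrow> frac_supp m (cf (s + t))"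
  unfolding frac_supp_def by (metis cf_add add.right_neutral)

lemma frac_supp_mult:
  fixes s t :: "('n::finite, 'a::field) fser"
  shows "frac_supp m (cf s) \<Longrightarrow> frac_supp m (cf t) \<Longrightarrow> frac_supp m (cf (s * t))"
  by (simp add: times_fser.rep_eq frac_supp_ser_mul)

lemma fil_add: "fil m t s \<Longrightarrow> fil m t r \<Longrightarrow> fil m t (s + r)"
  unfolding fil_def by (metis cf_add add.right_neutral frac_supp_add)

lemma fil_uminus: "fil m t s \<Longrightarrow> fil m t (- s)"
  by (auto simp: fil_def frac_supp_def)

lemma fil_diff: "fil m t s \<Longrightarrow> fil m t r \<Longrightarrow> fil m t (s - r)"
  using fil_add[of m t s "- r"] fil_uminus[of m t r] by simp

lemma fil_mult:
  assumes "fil m t s" "fil m u r"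
  shows "fil m (t + u) (s * r)"
proof (rule filI)
  show "frac_supp m (cf (s * r))" using assms by (auto simp: fil_def frac_supp_mult)
  fix a assume "cf (s * r) a \<noteq> 0"
  then obtain b c where "cf s b \<noteq> 0" "cf r c \<noteq> 0" "a = b + c" by (rule cf_mult_nz)
  then have "of_nat t \<le> of_nat m * wt b" "of_nat u \<le> of_nat m * wt c" "a = b + c"
    using assms by (auto simp: fil_def)
  then show "of_nat (t + u) \<le> of_nat m * wt a" by (simp add: wt_add distrib_left)
qed

text \<open>Nonzero exponents of the support have positive integral degree
  \<open>of_nat m * wt a\<close>, hence degree at least 1.\<close>

lemma fil_1_iff: "fil m 1 s \<longleftrightarrow> frac_supp m (cf s) \<and> sdvd 0 s"
proof
  assume s: "fil m 1 s"
  have "cf s 0 = 0"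
    using s by (auto simp: fil_def wt_def)
  then show "frac_supp m (cf s) \<and> sdvd 0 s" using frac_supp_fil[OF s] by (auto simp: sdvd_iff)
next
  assume s: "frac_supp m (cf s) \<and> sdvd 0 s"
  show "fil m 1 s"
  proof (rule filI)
    fix a assume a: "cf s a \<noteq> 0"
    then have a0: "0 < a" using s by (auto simp: sdvd_def)
    then have nn: "0 \<le> a i" for i by (auto simp: less_fun_def le_fun_def)
    obtain i where i: "0 < a i" using a0 nn by (force simp: less_fun_def le_fun_def not_le)
    have m: "0 < m" using s by (simp add: frac_supp_def)
    have "of_nat m * wt a = (\<Sum>i\<in>UNIV. of_nat m * a i)" by (simp add: wt_def sum_distrib_left)
    also have "\<dots> \<in> \<int>" using s a by (intro Ints_sum) (auto simp: frac_supp_def)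
    finally obtain z where z: "of_nat m * wt a = of_int z" by (auto elim: Ints_cases)
    have "0 < wt a" unfolding wt_def by (rule sum_pos2[of _ i]) (use i nn in auto)
    then have "0 < of_nat m * wt a" using m by simp
    then have "1 \<le> z" by (simp add: z)
    then show "of_nat 1 \<le> of_nat m * wt a" by (simp add: z)
  qed (use s in auto)
qed

definition coeffs_in :: "nat \<Rightarrow> ('n::finite, 'a::field) fser poly \<Rightarrow> bool" where
  "coeffs_in m q \<longleftrightarrow> 0 < m \<and> (\<forall>i. fil m 0 (coeff q i))"

lemma coeffs_in_pCons: "coeffs_in m (pCons a p) \<longleftrightarrow> fil m 0 a \<and> coeffs_in m p"
  by (auto simp: coeffs_in_def coeff_pCons split: nat.splits)

lemma fil_zero: "0 < m \<Longrightarrow> fil m t 0" by (simp add: fil_def frac_supp_def)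

lemma fil_poly: "coeffs_in m q \<Longrightarrow> fil m 0 z \<Longrightarrow> fil m 0 (poly q z)"
proof (induction q)
  case 0
  then show ?case by (simp add: coeffs_in_def)
next
  case (pCons a p)
  then have "fil m 0 a" "fil m 0 (z * poly p z)"
    using fil_mult[of m 0 z 0 "poly p z"] by (auto simp: coeffs_in_pCons)
  then show ?case using fil_add[of m 0 a] by simp
qed

lemma fil_poly_diff_coeff0: "coeffs_in m q \<Longrightarrow> fil m 1 z \<Longrightarrow> fil m 1 (poly q z - coeff q 0)"
proof (cases q)
  case (pCons a p)
  assume "coeffs_in m q" "fil m 1 z"
  then have "fil m (1 + 0) (z * poly p z)"
    using fil_mono[of m 1 z 0] by (intro fil_mult) (auto intro: fil_poly simp: pCons coeffs_in_pCons)
  then show ?thesis by (simp add: pCons)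
qed

text \<open>A first-order expansion: for arguments in the maximal ideal the difference quotient
  agrees with the linear coefficient modulo the maximal ideal. This is what makes the iteration in
  \<open>hensel\<close> a contraction.\<close>

lemma poly_diff_factor:
  assumes "coeffs_in m q" "fil m 1 z" "fil m 1 z'"
  shows "\<exists>h. fil m 1 (h - coeff q 1) \<and> poly q z - poly q z' = (z - z') * h"
  using assms
proof (induction q)
  case 0
  then show ?case by (intro exI[of _ 0]) (simp add: fil_zero coeffs_in_def)
next
  case (pCons a p)
  then obtain h where h: "fil m 1 (h - coeff p 1)" "poly p z - poly p z' = (z - z') * h"
    by (auto simp: coeffs_in_pCons)
  have cp: "coeffs_in m p" using pCons.prems by (simp add: coeffs_in_pCons)
  have "fil m 0 (h - coeff p 1 + coeff p 1)"
    using cp h(1) by (intro fil_add) (auto simp: coeffs_in_def intro: fil_mono)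
  then have "fil m (1 + 0) (z * h)" using pCons.prems(2) by (intro fil_mult) auto
  then have "fil m 1 (z * h + (poly p z' - coeff p 0))"
    using fil_poly_diff_coeff0[OF cp pCons.prems(3)] by (intro fil_add) auto
  moreover have "poly (pCons a p) z - poly (pCons a p) z' = z * (poly p z - poly p z') + (z - z') * poly p z'"
    by (simp add: algebra_simps)
  then have "poly (pCons a p) z - poly (pCons a p) z' = (z - z') * (z * h + poly p z')"
    by (simp add: h(2) algebra_simps)
  ultimately show ?case by (intro exI[of _ "z * h + poly p z'"]) (simp add: add_diff_eq)
qed

lemma ex_coeffs_in: "\<exists>m. coeffs_in m (q :: ('n::finite, 'a::field) fser poly)"
proof (induction q)
  case 0
  show ?case by (intro exI[of _ 1]) (simp add: coeffs_in_def fil_zero)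
next
  case (pCons a p)
  then obtain m where m: "coeffs_in m p" by blast
  obtain m' where m': "frac_supp m' (cf a)" by (rule frac_supp_cf)
  have p: "0 < m" "0 < m'" using m m' by (auto simp: coeffs_in_def frac_supp_def)
  have "frac_supp (m * m') (cf a)" using p by (intro frac_supp_dvd[OF m']) auto
  moreover have "frac_supp (m * m') (cf (coeff p i))" for i
    using m p frac_supp_dvd[of m "cf (coeff p i)" "m * m'"] by (simp add: coeffs_in_def fil_0_iff)
  ultimately show ?case using p
    by (intro exI[of _ "m * m'"]) (auto simp: fil_0_iff coeffs_in_def coeff_pCons split: nat.splits)
qed

lemma cf_kconst_mult: "cf (kconst c * s) a = c * cf (s :: ('n::finite, 'a::field) fser) a"
proof -
  have "b = 0" if "cf (kconst c :: ('n, 'a) fser) b \<noteq> 0" for b using that by (auto simp: cf_kconst split: if_splits)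
  then have "cf (kconst c * s) (0 + a) = cf (kconst c :: ('n, 'a) fser) 0 * cf s a" by (intro cf_mult_unique) blast
  then show ?thesis by (simp add: cf_kconst)
qed

text \<open>A simplified Newton iteration z - c G(z) with the constant slope c, the inverse of the
  constant term of the linear coefficient. It raises the order of differences by one, so the
  iterates from 0 converge coefficientwise to a fixed point.\<close>

lemma hensel:
  fixes G :: "('n::finite, 'a::field) fser poly"
  assumes G0: "sdvd 0 (coeff G 0)" and G1: "cf (coeff G 1) 0 \<noteq> 0"
  shows "\<exists>z. sdvd 0 z \<and> poly G z = 0"
proof -
  obtain m where m: "coeffs_in m G" using ex_coeffs_in by blast
  then have m0: "0 < m" by (simp add: coeffs_in_def)
  define c :: "('n, 'a) fser" where "c = kconst (inverse (cf (coeff G 1) 0))"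
  define F where "F z = z - c * poly G z" for z
  have c: "fil m 0 c" unfolding fil_0_iff using m0 by (auto simp: c_def frac_supp_def cf_kconst split: if_splits)
  have F: "fil m 1 (F z)" if z: "fil m 1 z" for z
  proof -
    have "fil m 1 (coeff G 0)" using m G0 by (simp add: fil_1_iff coeffs_in_def fil_0_iff del: One_nat_def)
    then have "fil m 1 (poly G z - coeff G 0 + coeff G 0)"
      using fil_poly_diff_coeff0[OF m z] by (rule fil_add[rotated])
    then have "fil m (0 + 1) (c * poly G z)" using c by (intro fil_mult) auto
    then show ?thesis using z unfolding F_def by (intro fil_diff) auto
  qed
  have contr: "fil m (t + 1) (F z - F z')" if z: "fil m 1 z" "fil m 1 z'" and d: "fil m t (z - z')" for z z' t
  proof -
    obtain h where h: "fil m 1 (h - coeff G 1)" "poly G z - poly G z' = (z - z') * h"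
      using poly_diff_factor[OF m z] by blast
    \<comment> \<open>The contraction factor is 1 - c h. Up to sign it is the sum of
      \<open>c * (h - coeff G 1)\<close> and \<open>c * coeff G 1 - 1\<close>, and both lie in the
      maximal ideal.\<close>
    have "fil m (0 + 1) (c * (h - coeff G 1))" using c h(1) by (rule fil_mult)
    moreover have "fil m (0 + 0) (c * coeff G 1)" using c m by (intro fil_mult) (auto simp: coeffs_in_def)
    then have "frac_supp m (cf (c * coeff G 1 - 1))"
      using m0 by (intro frac_supp_fil[of m 0] fil_diff) (auto simp: fil_0_iff one_fser.rep_eq frac_supp_ser_one)
    moreover have "cf (c * coeff G 1 - 1) 0 = 0" using G1 by (simp add: c_def cf_kconst_mult cf_one)
    ultimately have "fil m 1 (c * (h - coeff G 1))" "fil m 1 (c * coeff G 1 - 1)"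
      by (auto simp: fil_1_iff sdvd_iff simp del: One_nat_def)
    then have "fil m 1 (- (c * (h - coeff G 1) + (c * coeff G 1 - 1)))"
      by (intro fil_uminus fil_add)
    then have "fil m (t + 1) ((z - z') * - (c * (h - coeff G 1) + (c * coeff G 1 - 1)))"
      by (rule fil_mult[OF d])
    moreover have "F z - F z' = (z - z') - c * (poly G z - poly G z')" by (simp add: F_def algebra_simps)
    then have "F z - F z' = (z - z') * - (c * (h - coeff G 1) + (c * coeff G 1 - 1))"
      unfolding h(2) by (simp add: algebra_simps)
    ultimately show ?thesis by simp
  qed
  define Z where "Z t = (F ^^ t) 0" for t
  have Z1: "fil m 1 (Z t)" for t
    by (induction t) (auto simp: Z_def fil_zero m0 F simp del: One_nat_def)
  have step: "fil m (t + 1) (Z (Suc t) - Z t)" for t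
  proof (induction t)
    case 0
    show ?case using Z1[of "Suc 0"] by (simp add: Z_def)
  next
    case (Suc t)
    show ?case using contr[OF Z1 Z1 Suc.IH] by (simp add: Z_def)
  qed
  have cauchy: "fil m (t + 1) (Z (t + d) - Z t)" for t d
  proof (induction d)
    case 0
    show ?case by (simp add: fil_zero m0)
  next
    case (Suc d)
    have "fil m (t + 1) ((Z (Suc (t + d)) - Z (t + d)) + (Z (t + d) - Z t))"
      using Suc.IH step[of "t + d"] by (intro fil_add) (auto intro: fil_mono)
    then show ?case by simp
  qed
  have stable: "cf (Z u) a = cf (Z t) a" if tu: "t \<le> u" "of_nat m * wt a \<le> of_nat t" for u t a
  proof -
    obtain d where d: "u = t + d" using tu(1) le_Suc_ex by blast
    have "cf (Z (t + d) - Z t) a = 0"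
    proof (rule ccontr)
      assume "cf (Z (t + d) - Z t) a \<noteq> 0"
      then have "of_nat (t + 1) \<le> of_nat m * wt a" using cauchy[of t d] unfolding fil_def by blast
      then show False using tu(2) by simp
    qed
    then show ?thesis by (simp add: d)
  qed
  \<comment> \<open>From step \<open>T a\<close> on the coefficient at \<open>a\<close> no longer
    changes, so the limit can be defined by it.\<close>
  define T where "T a = nat \<lceil>of_nat m * wt a\<rceil>" for a :: "'n \<Rightarrow> rat"
  have T: "of_nat m * wt a \<le> of_nat (T a)" for a unfolding T_def by linarith
  define L where "L = Fser (\<lambda>a. cf (Z (T a)) a)"
  have fs: "frac_supp m (\<lambda>a. cf (Z (T a)) a)"
    unfolding frac_supp_def using Z1 m0 unfolding fil_def frac_supp_def by blast
  then have L: "cf L a = cf (Z (T a)) a" for a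
    unfolding L_def by (subst Fser_inverse) (auto intro: is_fserI)
  have LZ: "fil m (t + 1) (L - Z t)" for t
  proof (rule filI)
    have "cf L = (\<lambda>a. cf (Z (T a)) a)" using L by (rule ext)
    then have "fil m 0 L" using fs by (simp add: fil_0_iff)
    moreover have "fil m 0 (Z t)" using Z1[of t] by (rule fil_mono) simp
    ultimately show "frac_supp m (cf (L - Z t))" by (intro frac_supp_fil[of m 0] fil_diff)
    fix a assume a: "cf (L - Z t) a \<noteq> 0"
    show "of_nat (t + 1) \<le> of_nat m * wt a"
    proof (rule ccontr)
      assume "\<not> ?thesis"
      \<comment> \<open>Integrality of the degree turns \<open>< t + 1\<close> into
        \<open>\<le> t\<close>, where the iterates are already stable.\<close>
      moreover have "of_nat m * wt a \<in> \<int>"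
      proof -
        have "of_nat m * wt a = (\<Sum>i\<in>UNIV. of_nat m * a i)" by (simp add: wt_def sum_distrib_left)
        also have "\<dots> \<in> \<int>"
          using \<open>frac_supp m (cf (L - Z t))\<close> a by (intro Ints_sum) (auto simp: frac_supp_def)
        finally show ?thesis .
      qed
      then obtain z where z: "of_nat m * wt a = of_int z" by (auto elim: Ints_cases)
      ultimately have "of_int z < (of_int (int t + 1) :: rat)" by simp
      then have "z \<le> int t" by (simp only: of_int_less_iff)
      then have "(of_int z :: rat) \<le> of_int (int t)" by (simp only: of_int_le_iff)
      then have le: "of_nat m * wt a \<le> of_nat t" by (simp add: z)
      then have "cf (Z (T a)) a = cf (Z t) a"
        using stable[of t "T a" a] stable[of "T a" t a] T[of a] by (cases "t \<le> T a") auto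
      then show False using a by (simp add: L)
    qed
  qed
  have L1: "fil m 1 L" using LZ[of 0] by (simp add: Z_def)
  have fix0: "fil m (t + 1) (F L - L)" for t
  proof -
    have "fil m (t + 1) ((F L - F (Z t)) + (Z (Suc t) - Z t) - (L - Z t))"
      by (rule fil_diff[OF fil_add[OF fil_mono[OF contr[OF L1 Z1 LZ[of t]]] step[of t]] LZ[of t]]) simp
    moreover have "Z (Suc t) = F (Z t)" by (simp add: Z_def)
    ultimately show ?thesis by simp
  qed
  have "F L - L = 0"
  proof (rule fser_eqI, rule ccontr)
    fix a assume "cf (F L - L) a \<noteq> cf 0 a"
    then have "of_nat (T a + 1) \<le> of_nat m * wt a" using fix0[of "T a"] unfolding fil_def by simp
    then show False using T[of a] by simp
  qed
  then have "c * poly G L = 0" by (simp add: F_def)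
  moreover have "cf c 0 \<noteq> 0" using G1 by (simp add: c_def cf_kconst)
  then have "c \<noteq> 0" by auto
  ultimately have "poly G L = 0" by simp
  then show ?thesis using L1 by (auto simp: fil_1_iff simp del: One_nat_def)
qed

section \<open>Polynomials over the ring of power series with integral exponents\<close>

definition iser :: "('n::finite, 'a::field) fser \<Rightarrow> bool" where
  "iser s \<longleftrightarrow> (\<forall>a. cf s a \<noteq> 0 \<longrightarrow> a \<in> zlat)"

definition ipoly :: "('n::finite, 'a::field) fser poly \<Rightarrow> bool" where
  "ipoly p \<longleftrightarrow> (\<forall>i. iser (coeff p i))"

lemma zlat_add: "a \<in> zlat \<Longrightarrow> b \<in> zlat \<Longrightarrow> a + b \<in> zlat"
  by (rule latticeD(5)[OF lattice_zlat])

lemma iser_0 [simp]: "iser 0" by (simp add: iser_def)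
lemma iser_1 [simp]: "iser 1" by (simp add: iser_def cf_one)
lemma iser_add: "iser s \<Longrightarrow> iser t \<Longrightarrow> iser (s + t)"
  unfolding iser_def by (metis add.right_neutral cf_add)
lemma iser_uminus: "iser s \<Longrightarrow> iser (- s)" by (simp add: iser_def)
lemma iser_diff: "iser s \<Longrightarrow> iser t \<Longrightarrow> iser (s - t)"
  using iser_add[of s "- t"] iser_uminus[of t] by simp
lemma iser_mult: "iser s \<Longrightarrow> iser t \<Longrightarrow> iser (s * t)"
  unfolding iser_def by (metis cf_mult_nz zlat_add)
lemma iser_sum: "(\<And>x. x \<in> A \<Longrightarrow> iser (s x)) \<Longrightarrow> iser (\<Sum>x\<in>A. s x)"
  by (induction A rule: infinite_finite_induct) (auto intro: iser_add)

lemma iser_act: "iser s \<Longrightarrow> \<chi> \<in> chars \<Longrightarrow> act \<chi> s = s"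
  by (rule act_zlat) (auto simp: iser_def chars_zlat)

text \<open>Descent to integral exponents: an exponent outside Z^d is moved by some
  character.\<close>

lemma iserI_act:
  fixes s :: "('n::finite, 'a::field_char_0) fser"
  assumes K: "alg_closed_field TYPE('a)" and s: "\<And>\<chi>. \<chi> \<in> chars \<Longrightarrow> act \<chi> s = s"
  shows "iser s"
  unfolding iser_def
proof (intro allI impI, rule ccontr)
  fix a assume a: "cf s a \<noteq> 0" "a \<notin> zlat"
  obtain \<chi> :: "('n \<Rightarrow> rat) \<Rightarrow> 'a" where \<chi>: "\<chi> \<in> chars" "\<chi> a \<noteq> 1"
    using char_separate[OF K lattice_zlat a(2)] by blast
  have "cf (act \<chi> s) a = cf s a" using s[OF \<chi>(1)] by simp
  then show False using a \<chi> by simp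
qed

lemma ipoly_0 [simp]: "ipoly 0" by (simp add: ipoly_def)
lemma ipoly_1 [simp]: "ipoly 1" by (simp add: ipoly_def)
lemma ipoly_add: "ipoly p \<Longrightarrow> ipoly q \<Longrightarrow> ipoly (p + q)" by (simp add: ipoly_def iser_add)
lemma ipoly_diff: "ipoly p \<Longrightarrow> ipoly q \<Longrightarrow> ipoly (p - q)" by (simp add: ipoly_def iser_diff)
lemma ipoly_mult: "ipoly p \<Longrightarrow> ipoly q \<Longrightarrow> ipoly (p * q)"
  by (auto simp: ipoly_def coeff_mult intro!: iser_sum iser_mult)
lemma ipoly_power: "ipoly p \<Longrightarrow> ipoly (p ^ k)"
  by (induction k) (auto intro: ipoly_mult)
lemma ipoly_monom: "iser s \<Longrightarrow> ipoly (monom s k)" by (simp add: ipoly_def)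

lemma poly_act:
  fixes p :: "('n::finite, 'a::field) fser poly"
  assumes "ipoly p" "\<chi> \<in> chars"
  shows "poly p (act \<chi> s) = act \<chi> (poly p s)"
proof -
  have "act \<chi> (coeff p i) = coeff p i" for i using assms iser_act by (auto simp: ipoly_def)
  then show ?thesis using assms(2) by (simp add: poly_altdef act_sum act_mult act_power)
qed

lemma monic_division:
  fixes p g :: "('n::finite, 'a::field) fser poly"
  assumes p: "ipoly p" "lead_coeff p = 1" "0 < degree p" and g: "ipoly g"
  shows "\<exists>q r. ipoly q \<and> ipoly r \<and> g = q * p + r \<and> degree r < degree p"
  using g
proof (induction "degree g" arbitrary: g rule: less_induct)
  case less
  show ?case
  proof (cases "degree g < degree p")
    case True
    then show ?thesis using less.prems by (intro exI[of _ 0] exI[of _ g]) simp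
  next
    case False
    define q where "q = monom (lead_coeff g) (degree g - degree p)"
    have iq: "ipoly q" using less.prems by (simp add: q_def ipoly_monom ipoly_def[of g])
    have "degree (q * p) \<le> degree g"
      using False by (intro order_trans[OF degree_mult_le]) (simp add: q_def order_trans[OF add_right_mono[OF degree_monom_le]])
    then have "degree (g - q * p) \<le> degree g" by (intro degree_diff_le) auto
    moreover have "coeff (q * p) (degree g) = lead_coeff g"
      using False p(2) by (simp add: q_def coeff_monom_mult)
    then have "coeff (g - q * p) (degree g) = 0" by simp
    ultimately have "g - q * p = 0 \<or> degree (g - q * p) < degree g" by (rule eq_zero_or_degree_less)
    then have "degree (g - q * p) < degree g" using False p(3) by auto
    then obtain q' r where "ipoly q'" "ipoly r" "g - q * p = q' * p + r" "degree r < degree p"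
      using less.hyps[of "g - q * p"] ipoly_diff[OF less.prems ipoly_mult[OF iq p(1)]] by blast
    then show ?thesis using iq
      by (intro exI[of _ "q + q'"] exI[of _ r]) (auto simp: ipoly_add algebra_simps)
  qed
qed

lemma adic_expansion:
  fixes p g :: "('n::finite, 'a::field) fser poly"
  assumes p: "ipoly p" "lead_coeff p = 1" "0 < degree p" and g: "ipoly g" "degree g < degree p * n"
  shows "\<exists>c. (\<forall>a. ipoly (c a) \<and> degree (c a) < degree p) \<and> g = (\<Sum>a<n. c a * p ^ a)"
  using g
proof (induction n arbitrary: g)
  case (Suc n)
  obtain q r where q: "ipoly q" "ipoly r" "g = q * p + r" "degree r < degree p"
    using monic_division[OF p Suc.prems(1)] by blast
  show ?case
  proof (cases "q = 0")
    case True
    then have "g = (\<Sum>a<Suc n. (if a = 0 then r else 0) * p ^ a)"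
      using q(3) by (simp add: sum.lessThan_Suc_shift del: sum.lessThan_Suc)
    then show ?thesis using q p(3) by (intro exI[of _ "\<lambda>a. if a = 0 then r else 0"]) simp
  next
    case False
    have "degree (q * p) = degree q + degree p" using False p(3) by (intro degree_mult_eq) auto
    moreover have "degree (q * p + r) = degree (q * p)"
      using q(4) calculation by (intro degree_add_eq_left) simp
    ultimately have "degree q < degree p * n" using Suc.prems(2) q(3) by simp
    then obtain c where c: "\<forall>a. ipoly (c a) \<and> degree (c a) < degree p" "q = (\<Sum>a<n. c a * p ^ a)"
      using Suc.IH[OF q(1)] by blast
    have "g = (\<Sum>a<Suc n. case_nat r c a * p ^ a)"
      by (simp add: q(3) sum.lessThan_Suc_shift c(2) sum_distrib_left mult_ac del: sum.lessThan_Suc)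
    then show ?thesis using c q(2,4) by (intro exI[of _ "case_nat r c"]) (auto split: nat.splits)
  qed
qed simp

text \<open>Dividing by p^b first isolates the top digit u. The remainder has smaller degree than g,
  so u inherits the leading coefficient 1 and can itself be expanded at the next lower
  level.\<close>

lemma monic_adic_expansion:
  fixes p g :: "('n::finite, 'a::field) fser poly"
  assumes p: "ipoly p" "lead_coeff p = 1" "0 < degree p" and g: "ipoly g" "lead_coeff g = 1"
  defines "b \<equiv> degree g div degree p"
  shows "\<exists>u c. ipoly u \<and> lead_coeff u = 1 \<and> degree u = degree g mod degree p \<and>
    (\<forall>a. ipoly (c a) \<and> degree (c a) < degree p) \<and> g = (\<Sum>a<b. c a * p ^ a) + u * p ^ b"
proof (cases "b = 0")
  case True
  then show ?thesis using g p by (intro exI[of _ g] exI[of _ "\<lambda>_. 0"]) (simp add: b_def div_eq_0_iff)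
next
  case False
  have p0: "p \<noteq> 0" using p(2) by auto
  have dpb: "degree (p ^ b) = degree p * b" using p0 by (simp add: degree_power_eq)
  have pb: "ipoly (p ^ b)" "lead_coeff (p ^ b) = 1" "0 < degree (p ^ b)"
    using p False lead_coeff_power[of p b] by (simp_all add: ipoly_power dpb)
  obtain u r where u: "ipoly u" "ipoly r" "g = u * p ^ b + r" "degree r < degree (p ^ b)"
    using monic_division[OF pb g(1)] by blast
  have "degree p * b \<le> degree g" by (simp add: b_def)
  then have rg: "degree r < degree g" using u(4) dpb by simp
  have "degree (g - r) = degree g" "lead_coeff (g - r) = lead_coeff g"
  proof -
    show 1: "degree (g - r) = degree g" using rg
      by (metis degree_add_eq_left degree_minus uminus_add_conv_diff add.commute)
    show "lead_coeff (g - r) = lead_coeff g" using rg by (simp add: 1 coeff_eq_0)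
  qed
  then have dg: "degree (u * p ^ b) = degree g" "lead_coeff (u * p ^ b) = 1" using u(3) g(2) by simp_all
  have u1: "lead_coeff u = 1" using dg(2) pb(2) by (simp add: lead_coeff_mult)
  then have "u \<noteq> 0" by auto
  then have "degree g = degree u + degree p * b" using dg(1) p0 dpb by (simp add: degree_mult_eq)
  then have du: "degree u = degree g mod degree p"
    by (metis add_diff_cancel_right' b_def minus_mult_div_eq_mod)
  obtain c where "\<forall>a. ipoly (c a) \<and> degree (c a) < degree p" "r = (\<Sum>a<b. c a * p ^ a)"
    using adic_expansion[OF p u(2)] u(4) dpb by metis
  then show ?thesis using u u1 du by (intro exI[of _ u] exI[of _ c]) (simp add: add.commute)
qed

section \<open>Resultants of split polynomials\<close>

definition sylv :: "'a::comm_ring_1 poly \<Rightarrow> 'a poly \<Rightarrow> nat \<Rightarrow> nat \<Rightarrow> 'a mat" where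
  "sylv f g n m = mat (n + m) (n + m) (\<lambda>(i, j).
     if i < m then (if i \<le> j \<and> j \<le> i + n then coeff f (n + i - j) else 0)
     else (if i - m \<le> j \<and> j \<le> i - m + m then coeff g (m + (i - m) - j) else 0))"

text \<open>A row of the Sylvester matrix lists the coefficients of p times a power of Y by
  descending degree; pairing it with descending powers of x evaluates this multiple of p at
  x.\<close>

lemma sum_shifted_coeffs:
  fixes p :: "'a::comm_ring_1 poly"
  assumes "degree p \<le> n" "i + n < N"
  shows "(\<Sum>k<N. (if i \<le> k \<and> k \<le> i + n then coeff p (n + i - k) else 0) * x ^ (N - 1 - k))
    = x ^ (N - 1 - i - n) * poly p x"
proof -
  have "(\<Sum>k<N. (if i \<le> k \<and> k \<le> i + n then coeff p (n + i - k) else 0) * x ^ (N - 1 - k))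
      = (\<Sum>k\<in>{i..i+n}. coeff p (n + i - k) * x ^ (N - 1 - k))"
    using assms(2) by (intro sum.mono_neutral_cong_right) auto
  also have "\<dots> = (\<Sum>l\<le>n. coeff p l * x ^ (N - 1 - (n + i - l)))"
    by (rule sum.reindex_bij_witness[of _ "\<lambda>l. n + i - l" "\<lambda>k. n + i - k"]) auto
  also have "\<dots> = (\<Sum>l\<le>n. x ^ (N - 1 - i - n) * (coeff p l * x ^ l))"
  proof (rule sum.cong)
    fix l assume "l \<in> {..n}"
    then have "N - 1 - (n + i - l) = (N - 1 - i - n) + l" using assms(2) by auto
    then show "coeff p l * x ^ (N - 1 - (n + i - l)) = x ^ (N - 1 - i - n) * (coeff p l * x ^ l)"
      by (simp add: power_add mult_ac)
  qed simp
  also have "\<dots> = x ^ (N - 1 - i - n) * (\<Sum>l\<le>n. coeff p l * x ^ l)"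
    by (simp add: sum_distrib_left)
  also have "(\<Sum>l\<le>n. coeff p l * x ^ l) = poly p x"
    unfolding poly_altdef using assms(1) by (intro sum.mono_neutral_right) (auto simp: coeff_eq_0)
  finally show ?thesis .
qed

text \<open>A kernel vector would be the coefficient list of a nonzero polynomial of degree below n
  with n distinct roots.\<close>

lemma det_vandermonde_nz:
  fixes xs :: "'a::idom list"
  assumes "distinct xs"
  shows "det (mat (length xs) (length xs) (\<lambda>(i, j). (xs ! i) ^ (length xs - 1 - j))) \<noteq> 0"
proof
  define n where "n = length xs"
  define A where "A = mat n n (\<lambda>(i, j). (xs ! i) ^ (n - 1 - j))"
  assume "det (mat (length xs) (length xs) (\<lambda>(i, j). (xs ! i) ^ (length xs - 1 - j))) = 0"
  then have "det A = 0" by (simp add: A_def n_def)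
  moreover have A: "A \<in> carrier_mat n n" by (simp add: A_def)
  ultimately obtain v where v: "v \<in> carrier_vec n" "v \<noteq> 0\<^sub>v n" "A *\<^sub>v v = 0\<^sub>v n"
    using det_0_iff_vec_prod_zero[OF A] by blast
  define p where "p = (\<Sum>j<n. monom (v $ j) (n - 1 - j))"
  have cp: "coeff p (n - 1 - j) = v $ j" if "j < n" for j
  proof -
    have "coeff p (n - 1 - j) = (\<Sum>k<n. if k = j then v $ k else 0)"
      unfolding p_def coeff_sum coeff_monom by (rule sum.cong) (use that in auto)
    also have "\<dots> = v $ j" using that by simp
    finally show ?thesis .
  qed
  obtain j where "j < n" "v $ j \<noteq> 0" using v(1,2) by (auto simp: vec_eq_iff)
  then have p0: "p \<noteq> 0" using cp by force
  then have n0: "0 < n" using \<open>j < n\<close> by simp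
  have "degree p \<le> n - 1" unfolding p_def
    by (intro degree_sum_le) (auto intro!: order_trans[OF degree_monom_le])
  then have dp: "degree p < n" using n0 by simp
  have "poly p (xs ! i) = 0" if i: "i < n" for i
  proof -
    have "(A *\<^sub>v v) $ i = (\<Sum>j<n. (xs ! i) ^ (n - 1 - j) * v $ j)"
      using i v(1) by (simp add: A_def scalar_prod_def lessThan_atLeast0)
    then have "(\<Sum>j<n. (xs ! i) ^ (n - 1 - j) * v $ j) = 0" using v(3) i by simp
    then show ?thesis by (simp add: p_def poly_sum poly_monom mult.commute)
  qed
  then have "set xs \<subseteq> {x. poly p x = 0}" by (auto simp: in_set_conv_nth n_def)
  then have "card (set xs) \<le> card {x. poly p x = 0}" using poly_roots_finite[OF p0] by (rule card_mono[rotated])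
  also have "\<dots> \<le> degree p" by (rule card_poly_roots_bound[OF p0])
  finally show False using dp assms by (simp add: distinct_card n_def)
qed

lemma prod_diag_upper_one:
  assumes A: "A \<in> carrier_mat m m" "upper_triangular A" and d: "\<And>i. i < m \<Longrightarrow> A $$ (i, i) = d i"
  shows "det A = (\<Prod>i<m. d i)"
proof -
  have "det A = prod_list (diag_mat A)" using A by (intro det_upper_triangular)
  also have "\<dots> = (\<Prod>i<m. d i)"
    using A(1) d by (auto simp: diag_mat_def prod.list_conv_set_nth lessThan_atLeast0 intro!: prod.cong)
  finally show ?thesis .
qed

text \<open>
  The columns of the Vandermonde block consist of the powers of a root of \<open>f\<close>, so that multiplying the
  Sylvester matrix by it kills the rows of \<open>f\<close> and evaluates the rows of \<open>g\<close>.
\<close>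

lemma det_sylv_split:
  fixes g :: "'a::idom poly"
  assumes A: "finite A" and f: "f = (\<Prod>x\<in>A. [:- x, 1:])" and n: "n = card A" and g: "degree g \<le> m"
  shows "det (sylv f g n m) = (\<Prod>x\<in>A. poly g x)"
proof -
  obtain xs where xs: "set xs = A" "distinct xs" using finite_distinct_list[OF A] by blast
  have len: "length xs = n" using xs distinct_card n by metis
  have df: "degree f = n"
    unfolding f n by (subst degree_prod_eq_sum_degree) auto
  have lf: "coeff f n = 1"
    using lead_coeff_prod[of "\<lambda>x. [:- x, 1:]" A] by (simp add: f[symmetric] df)
  have fx: "poly f (xs ! i) = 0" if "i < n" for i
    using that xs A len unfolding f poly_prod by (auto simp: prod_zero_iff)
  define V0 where "V0 = mat n n (\<lambda>(i, j). (xs ! j) ^ (n - 1 - i))"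
  define V1 where "V1 = mat m n (\<lambda>(i, j). (xs ! j) ^ (n + m - 1 - i))"
  define W where "W = four_block_mat (1\<^sub>m m) V1 (0\<^sub>m n m) V0"
  define B where "B = mat m m (\<lambda>ij. sylv f g n m $$ ij)"
  define C where "C = mat n m (\<lambda>(i, j). sylv f g n m $$ (i + m, j))"
  define D where "D = mat n n (\<lambda>(i, j). (xs ! j) ^ (n - 1 - i) * poly g (xs ! j))"
  define G where "G = mat n n (\<lambda>(i, j). if i = j then poly g (xs ! j) else 0)"
  have W: "W \<in> carrier_mat (n + m) (n + m)"
    by (rule carrier_matI) (simp_all add: W_def V0_def)
  have S: "sylv f g n m \<in> carrier_mat (n + m) (n + m)" by (simp add: sylv_def)
  have Wij: "W $$ (i, j) = (if j < m then (if i = j then 1 else 0) else (xs ! (j - m)) ^ (n + m - 1 - i))"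
    if "i < n + m" "j < n + m" for i j
  proof -
    have "n - 1 - (i - m) = n + m - 1 - i" if "m \<le> i" "i < n + m" using that by auto
    then show ?thesis using that by (auto simp: W_def V0_def V1_def)
  qed
  have SW: "sylv f g n m * W = four_block_mat B (0\<^sub>m m n) C D"
  proof (rule eq_matI)
    show "dim_row (sylv f g n m * W) = dim_row (four_block_mat B (0\<^sub>m m n) C D)"
      "dim_col (sylv f g n m * W) = dim_col (four_block_mat B (0\<^sub>m m n) C D)"
      using S W by (auto simp: B_def C_def D_def)
    fix i j assume "i < dim_row (four_block_mat B (0\<^sub>m m n) C D)" "j < dim_col (four_block_mat B (0\<^sub>m m n) C D)"
    then have ij: "i < n + m" "j < n + m" by (auto simp: B_def C_def D_def)
    have e: "(sylv f g n m * W) $$ (i, j) = (\<Sum>k<n + m. sylv f g n m $$ (i, k) * W $$ (k, j))"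
      using S W ij by (simp add: scalar_prod_def lessThan_atLeast0)
    show "(sylv f g n m * W) $$ (i, j) = four_block_mat B (0\<^sub>m m n) C D $$ (i, j)"
    proof (cases "j < m")
      case True
      have "(\<Sum>k<n + m. sylv f g n m $$ (i, k) * W $$ (k, j))
          = (\<Sum>k<n + m. if k = j then sylv f g n m $$ (i, k) else 0)"
        by (rule sum.cong) (use True ij in \<open>auto simp: Wij\<close>)
      also have "\<dots> = sylv f g n m $$ (i, j)" using ij by simp
      finally show ?thesis using True ij unfolding e by (auto simp: B_def C_def D_def)
    next
      case False
      let ?x = "xs ! (j - m)"
      have jm: "j - m < n" using False ij by auto
      have "(\<Sum>k<n + m. sylv f g n m $$ (i, k) * W $$ (k, j))
          = (\<Sum>k<n + m. sylv f g n m $$ (i, k) * ?x ^ (n + m - 1 - k))"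
        by (rule sum.cong) (use False ij in \<open>auto simp: Wij\<close>)
      also have "\<dots> = (if i < m then 0 else ?x ^ (n - 1 - (i - m)) * poly g ?x)"
      proof (cases "i < m")
        case True
        have "(\<Sum>k<n + m. sylv f g n m $$ (i, k) * ?x ^ (n + m - 1 - k))
            = (\<Sum>k<n + m. (if i \<le> k \<and> k \<le> i + n then coeff f (n + i - k) else 0) * ?x ^ (n + m - 1 - k))"
          by (rule sum.cong) (use True ij in \<open>auto simp: sylv_def\<close>)
        also have "\<dots> = ?x ^ (n + m - 1 - i - n) * poly f ?x"
          by (rule sum_shifted_coeffs) (use True df in auto)
        finally show ?thesis using True fx[OF jm] by simp
      next
        case False
        have "(\<Sum>k<n + m. sylv f g n m $$ (i, k) * ?x ^ (n + m - 1 - k))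
            = (\<Sum>k<n + m. (if i - m \<le> k \<and> k \<le> i - m + m then coeff g (m + (i - m) - k) else 0) * ?x ^ (n + m - 1 - k))"
          by (rule sum.cong) (use False ij in \<open>auto simp: sylv_def\<close>)
        also have "\<dots> = ?x ^ (n + m - 1 - (i - m) - m) * poly g ?x"
          by (rule sum_shifted_coeffs) (use False ij g in auto)
        also have "n + m - 1 - (i - m) - m = n - 1 - (i - m)" by simp
        finally show ?thesis using False by simp
      qed
      also have "\<dots> = four_block_mat B (0\<^sub>m m n) C D $$ (i, j)"
        using False ij by (auto simp: B_def C_def D_def)
      finally show ?thesis unfolding e .
    qed
  qed
  have detB: "det B = 1"
  proof -
    have "det B = (\<Prod>i<m. 1)"
      by (rule prod_diag_upper_one) (auto simp: B_def sylv_def lf)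
    then show ?thesis by simp
  qed
  have "det W = det (1\<^sub>m m :: 'a mat) * det V0"
    unfolding W_def by (rule det_four_block_mat_lower_left_zero) (auto simp: V0_def V1_def)
  then have detW: "det W = det V0" by simp
  have "D = V0 * G"
  proof (rule eq_matI)
    fix i j assume "i < dim_row (V0 * G)" "j < dim_col (V0 * G)"
    then have ij: "i < n" "j < n" by (auto simp: V0_def G_def)
    have "(V0 * G) $$ (i, j) = (\<Sum>k<n. if k = j then (xs ! j) ^ (n - 1 - i) * poly g (xs ! j) else 0)"
    proof -
      have "(V0 * G) $$ (i, j) = (\<Sum>k<n. V0 $$ (i, k) * G $$ (k, j))"
        using ij by (simp add: V0_def G_def scalar_prod_def lessThan_atLeast0)
      also have "\<dots> = (\<Sum>k<n. if k = j then (xs ! j) ^ (n - 1 - i) * poly g (xs ! j) else 0)"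
        by (rule sum.cong) (use ij in \<open>auto simp: V0_def G_def\<close>)
      finally show ?thesis .
    qed
    also have "\<dots> = D $$ (i, j)" using ij by (simp add: D_def)
    finally show "D $$ (i, j) = (V0 * G) $$ (i, j)" by simp
  qed (auto simp: D_def V0_def G_def)
  moreover have "V0 \<in> carrier_mat n n" "G \<in> carrier_mat n n" by (auto simp: V0_def G_def)
  ultimately have "det D = det V0 * det G" by (simp add: det_mult)
  moreover have "det G = (\<Prod>i<n. poly g (xs ! i))"
    by (rule prod_diag_upper_one) (auto simp: G_def)
  moreover have "(\<Prod>i<n. poly g (xs ! i)) = (\<Prod>x\<in>A. poly g x)"
    using prod.distinct_set_conv_list[OF xs(2), of "poly g"] xs(1) len
    by (simp add: prod.list_conv_set_nth lessThan_atLeast0)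
  ultimately have detD: "det D = det V0 * (\<Prod>x\<in>A. poly g x)" by simp
  \<comment> \<open>B is triangular with diagonal 1 because f is monic; the factor
    \<open>det V0\<close> occurs on both sides and is nonzero because the roots are
    distinct.\<close>
  have "det (sylv f g n m) * det W = det (four_block_mat B (0\<^sub>m m n) C D)"
    unfolding SW[symmetric] using det_mult[OF S W] by simp
  also have "\<dots> = det B * det D"
    by (rule det_four_block_mat_upper_right_zero) (auto simp: B_def C_def D_def)
  finally have "det V0 * det (sylv f g n m) = det V0 * (\<Prod>x\<in>A. poly g x)"
    by (simp add: detW detB detD mult.commute)
  moreover have "det V0 \<noteq> 0"
  proof -
    have "mat n n (\<lambda>(i, j). (xs ! i) ^ (n - 1 - j)) = transpose_mat V0"
      by (rule eq_matI) (auto simp: V0_def)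
    then have "det (transpose_mat V0) \<noteq> 0"
      using det_vandermonde_nz[OF xs(2)] by (simp add: len)
    moreover have "det (transpose_mat V0) = det V0" by (rule det_transpose[of _ n]) (simp add: V0_def)
    ultimately show ?thesis by simp
  qed
  ultimately show ?thesis by simp
qed

section \<open>Polynomials with coefficient functions and typed polynomials\<close>

text \<open>The bridge from the coefficient functions of the statement to typed polynomials:
  restricted to \<open>ipoly\<close> it is a bijection onto \<open>ypoly\<close>.\<close>

definition ypol_of :: "('n::finite, 'a::field) fser poly \<Rightarrow> ('n, 'a) ypol" where
  "ypol_of p = (\<lambda>i. cf (coeff p i))"

lemma is_pser_cf: "is_pser (cf s) \<longleftrightarrow> iser s"
  using cf_nonneg by (fastforce simp: is_pser_def frac_supp_def iser_def zlat_def le_fun_def)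

lemma ser_zero_cf: "ser_zero = cf 0" by (simp add: ser_zero_def fun_eq_iff)
lemma ser_one_cf: "ser_one = cf 1" by (simp add: one_fser.rep_eq)

lemma is_pser_imp_cf:
  assumes "is_pser s" obtains t where "s = cf t" "iser t"
proof -
  have "is_fser s" using assms by (auto simp: is_pser_def is_fser_def)
  then have "s = cf (Fser s)" by (simp add: Fser_inverse)
  then show ?thesis using that assms is_pser_cf by metis
qed

lemma ypoly_ypol_of: "ypoly (ypol_of p) \<longleftrightarrow> ipoly p"
proof -
  have "{i. coeff p i \<noteq> 0} \<subseteq> {..degree p}" using le_degree by auto
  then have "finite {i. coeff p i \<noteq> 0}" by (rule finite_subset) simp
  then show ?thesis by (simp add: ypoly_def ypol_of_def is_pser_cf ipoly_def ser_zero_cf cf_inject)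
qed

lemma ypoly_imp_ypol_of:
  assumes "ypoly F" obtains p where "F = ypol_of p" "ipoly p"
proof -
  have "\<forall>i. \<exists>t. F i = cf t" using assms is_pser_imp_cf unfolding ypoly_def by metis
  then obtain c where c: "\<And>i. F i = cf (c i)" by metis
  have "finite {i. c i \<noteq> 0}" using assms by (simp add: ypoly_def c ser_zero_cf cf_inject)
  then have "coeff (Abs_poly c) = c" by (intro Abs_poly_inverse) (simp add: eventually_cofinite)
  then have "F = ypol_of (Abs_poly c)" by (simp add: ypol_of_def c fun_eq_iff)
  then show ?thesis using that assms ypoly_ypol_of by metis
qed

lemma ypol_of_inject: "ypol_of p = ypol_of q \<longleftrightarrow> p = q"
  by (auto simp: ypol_of_def fun_eq_iff poly_eq_iff cf_inject[symmetric])

lemma ypol_of_0: "ypol_of 0 = (\<lambda>k. ser_zero)"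
  by (simp add: ypol_of_def ser_zero_cf)

lemma ypol_of_1: "ypol_of 1 = yone"
  by (simp add: ypol_of_def yone_def ser_zero_cf ser_one_cf fun_eq_iff)

lemma ymul_ypol_of: "ymul (ypol_of p) (ypol_of q) = ypol_of (p * q)"
  by (simp add: ymul_def ypol_of_def coeff_mult fun_eq_iff times_fser.rep_eq)

lemma ydeg_ypol_of: "ydeg (ypol_of p) = degree p"
proof -
  have eq: "{i. ypol_of p i \<noteq> ser_zero} = {i. coeff p i \<noteq> 0}"
    by (simp add: ypol_of_def ser_zero_cf cf_inject)
  have sub: "{i. coeff p i \<noteq> 0} \<subseteq> {..degree p}" using le_degree by auto
  show ?thesis unfolding ydeg_def eq
  proof (rule Max_eqI)
    show "finite ({i. coeff p i \<noteq> 0} \<union> {0})" using sub by (auto intro: finite_subset)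
    show "degree p \<in> {i. coeff p i \<noteq> 0} \<union> {0}" by (cases "p = 0") auto
  qed (use sub in auto)
qed

lemma ymonic_ypol_of: "ymonic (ypol_of p) \<longleftrightarrow> ipoly p \<and> lead_coeff p = 1"
  unfolding ymonic_def ypoly_ypol_of ydeg_ypol_of by (simp add: ypol_of_def ser_one_cf cf_inject)

lemma ser_pow_cf: "ser_pow (cf s) k = cf (s ^ k)"
  by (induction k) (simp_all add: ser_one_cf times_fser.rep_eq)

lemma yeval_ypol_of: "yeval (ypol_of p) (cf s) = cf (poly p s)"
  unfolding yeval_def ydeg_ypol_of by (simp add: fun_eq_iff ser_pow_cf poly_altdef ypol_of_def times_fser.rep_eq)

lemma Zer_ypol_of: "Zer (ypol_of p) = cf ` {s. poly p s = 0}"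
proof (intro equalityI subsetI)
  fix z assume z: "z \<in> Zer (ypol_of p)"
  then obtain s where s: "z = cf s" by (metis (mono_tags, lifting) Fser_inverse Zer_def mem_Collect_eq)
  then have "poly p s = 0" using z by (simp add: Zer_def yeval_ypol_of ser_zero_cf cf_inject)
  then show "z \<in> cf ` {s. poly p s = 0}" using s by blast
qed (auto simp: Zer_def yeval_ypol_of ser_zero_cf is_fser_cf)

lemma yunit_ypol_of: "yunit (ypol_of p) \<longleftrightarrow> (\<exists>q. ipoly q \<and> p * q = 1)"
proof
  assume "yunit (ypol_of p)"
  then obtain B where B: "ypoly B" "ymul (ypol_of p) B = yone" by (auto simp: yunit_def)
  then show "\<exists>q. ipoly q \<and> p * q = 1"
    by (metis ypoly_imp_ypol_of ymul_ypol_of ypol_of_1 ypol_of_inject)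
next
  assume "\<exists>q. ipoly q \<and> p * q = 1"
  then show "yunit (ypol_of p)"
    unfolding yunit_def by (metis ymul_ypol_of ypol_of_1 ypoly_ypol_of)
qed

lemma yirreducible_ypol_of:
  "yirreducible (ypol_of p) \<longleftrightarrow> ipoly p \<and> p \<noteq> 0 \<and> \<not> (\<exists>q. ipoly q \<and> p * q = 1) \<and>
     (\<forall>q r. ipoly q \<and> ipoly r \<and> p = q * r \<longrightarrow> (\<exists>u. ipoly u \<and> q * u = 1) \<or> (\<exists>u. ipoly u \<and> r * u = 1))"
proof -
  have "(\<forall>A B. ypoly A \<and> ypoly B \<and> ypol_of p = ymul A B \<longrightarrow> yunit A \<or> yunit B) \<longleftrightarrow>
      (\<forall>q r. ipoly q \<and> ipoly r \<and> p = q * r \<longrightarrow> yunit (ypol_of q) \<or> yunit (ypol_of r))"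
  proof (intro iffI allI impI)
    fix A B assume h: "\<forall>q r. ipoly q \<and> ipoly r \<and> p = q * r \<longrightarrow> yunit (ypol_of q) \<or> yunit (ypol_of r)"
      and AB: "ypoly A \<and> ypoly B \<and> ypol_of p = ymul A B"
    obtain q where q: "A = ypol_of q" "ipoly q" using AB ypoly_imp_ypol_of by blast
    obtain r where r: "B = ypol_of r" "ipoly r" using AB ypoly_imp_ypol_of by blast
    have "p = q * r" using AB by (simp add: q(1) r(1) ymul_ypol_of ypol_of_inject)
    then show "yunit A \<or> yunit B" using h q r by blast
  next
    fix q r assume h: "\<forall>A B. ypoly A \<and> ypoly B \<and> ypol_of p = ymul A B \<longrightarrow> yunit A \<or> yunit B"
      and "ipoly q \<and> ipoly r \<and> p = q * r"
    then have "ypoly (ypol_of q)" "ypoly (ypol_of r)" "ypol_of p = ymul (ypol_of q) (ypol_of r)"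
      by (simp_all add: ypoly_ypol_of ymul_ypol_of)
    then show "yunit (ypol_of q) \<or> yunit (ypol_of r)" using h by blast
  qed
  then show ?thesis
    unfolding yirreducible_def ypoly_ypol_of yunit_ypol_of ypol_of_0[symmetric] ypol_of_inject by simp
qed

lemma of_nat_fser: "(of_nat k :: ('n::finite, 'a::field) fser) = kconst (of_nat k)"
  by (induction k) (auto intro!: fser_eqI simp: cf_kconst cf_one)

lemma cf_of_nat_mult: "cf (of_nat k * s) a = of_nat k * cf (s :: ('n::finite, 'a::field) fser) a"
  by (simp add: of_nat_fser cf_kconst_mult)

lemma cf_of_int_mult: "cf (of_int k * s) a = of_int k * cf (s :: ('n::finite, 'a::field) fser) a"
  by (cases k rule: int_cases2) (simp_all add: cf_of_nat_mult)

lemma yderiv_ypol_of: "yderiv (ypol_of p) = ypol_of (pderiv p)"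
  by (simp add: yderiv_def ypol_of_def fun_eq_iff coeff_pderiv cf_of_nat_mult del: of_nat_Suc)

lemma sylvester_ypol_of:
  "i < degree p + degree q \<Longrightarrow> j < degree p + degree q \<Longrightarrow>
   sylvester (ypol_of p) (ypol_of q) i j = cf (sylv p q (degree p) (degree q) $$ (i, j))"
  by (simp add: sylvester_def sylv_def Let_def ydeg_ypol_of ser_zero_cf) (simp add: ypol_of_def)

lemma ser_listprod_cf: "ser_listprod (map (\<lambda>x. cf (s x)) xs) = cf (prod_list (map s xs))"
  by (induction xs) (simp_all add: ser_listprod_def ser_one_cf times_fser.rep_eq)

lemma yres_ypol_of: "yres (ypol_of p) (ypol_of q) = cf (det (sylv p q (degree p) (degree q)))"
proof
  fix a
  define N where "N = degree p + degree q"
  define S where "S = sylv p q (degree p) (degree q)"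
  have "ser_listprod (map (\<lambda>i. sylvester (ypol_of p) (ypol_of q) i (\<pi> i)) [0..<N]) =
      cf (\<Prod>i = 0..<N. S $$ (i, \<pi> i))" if "\<pi> permutes {..<N}" for \<pi>
  proof -
    have *: "map (\<lambda>i. sylvester (ypol_of p) (ypol_of q) i (\<pi> i)) [0..<N] = map (\<lambda>i. cf (S $$ (i, \<pi> i))) [0..<N]"
      using permutes_in_image[OF that] by (auto simp: N_def S_def sylvester_ypol_of)
    show ?thesis unfolding * by (simp add: ser_listprod_cf prod.list_conv_set_nth)
  qed
  then have "yres (ypol_of p) (ypol_of q) a =
      (\<Sum>\<pi>\<in>{\<pi>. \<pi> permutes {0..<N}}. of_int (sign \<pi>) * cf (\<Prod>i = 0..<N. S $$ (i, \<pi> i)) a)"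
    by (simp add: yres_def Let_def ydeg_ypol_of N_def[symmetric] lessThan_atLeast0)
  also have "\<dots> = cf (det S) a"
    by (subst det_def'[of _ N]) (simp_all add: S_def sylv_def N_def cf_of_int_mult)
  finally show "yres (ypol_of p) (ypol_of q) a = cf (det S) a" .
qed

lemma iser_of_nat: "iser (of_nat m)"
  by (simp add: of_nat_fser iser_def cf_kconst)

lemma iser_of_int: "iser (of_int k)"
  by (cases k rule: int_cases2) (simp_all add: iser_uminus iser_of_nat)

lemma iser_prod: "(\<And>x. x \<in> A \<Longrightarrow> iser (s x)) \<Longrightarrow> iser (\<Prod>x\<in>A. s x)"
  by (induction A rule: infinite_finite_induct) (auto intro: iser_mult)

lemma iser_det_sylv:
  assumes "ipoly p" "ipoly q"
  shows "iser (det (sylv p q n m))"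
proof -
  have entry: "iser (sylv p q n m $$ (i, j))" if "i < n + m" "j < n + m" for i j
    using that assms by (auto simp: sylv_def ipoly_def)
  have "iser (\<Sum>\<pi>\<in>{\<pi>. \<pi> permutes {0..<n + m}}. signof \<pi> * (\<Prod>i = 0..<n + m. sylv p q n m $$ (i, \<pi> i)))"
  proof (intro iser_sum iser_mult iser_of_int iser_prod entry)
    fix \<pi> i assume "\<pi> \<in> {\<pi>. \<pi> permutes {0..<n + m}}" "i \<in> {0..<n + m}"
    then show "i < n + m" "\<pi> i < n + m" using permutes_in_image[of \<pi> "{0..<n + m}" i] by auto
  qed
  then show ?thesis by (subst det_def'[of _ "n + m"]) (simp_all add: sylv_def)
qed

lemma ipoly_pderiv: "ipoly p \<Longrightarrow> ipoly (pderiv p)"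
  unfolding ipoly_def coeff_pderiv by (intro allI iser_mult iser_of_nat) blast

lemma yres_split:
  assumes "finite A" "p = (\<Prod>x\<in>A. [:- x, 1:])"
  shows "yres (ypol_of p) (ypol_of q) = cf (\<Prod>x\<in>A. poly q x)"
proof -
  have "degree p = card A" unfolding assms(2) by (subst degree_prod_eq_sum_degree) auto
  then show ?thesis unfolding yres_ypol_of using det_sylv_split[OF assms, of "card A" q "degree q"] by simp
qed

text \<open>An equation s - t = u X^l with u(0) nonzero amounts to \<open>lead l (s - t)\<close>,
  and \<open>lead\<close> determines its exponent, so the definite description in
  \<open>contact\<close> has exactly one solution.\<close>

lemma contact_cf:
  assumes "lead h (s - t)"
  shows "contact (cf s) (cf t) = (h :: 'n::finite \<Rightarrow> rat)"
proof -
  have sd: "ser_diff (cf s) (cf t) = cf (s - t)" by (simp add: ser_diff_def fun_eq_iff)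
  have iff: "(\<exists>u. is_fser u \<and> u (\<lambda>i. 0) \<noteq> 0 \<and> cf (s - t) = ser_mul u (ser_monom l)) \<longleftrightarrow> lead l (s - t)" for l
  proof
    assume "\<exists>u. is_fser u \<and> u (\<lambda>i. 0) \<noteq> 0 \<and> cf (s - t) = ser_mul u (ser_monom l)"
    then obtain u where u: "is_fser u" "u (\<lambda>i. 0) \<noteq> 0" "cf (s - t) = ser_mul u (ser_monom l)" by blast
    have c: "cf (s - t) a = u (a - l)" for a unfolding u(3) ser_mul_monom ..
    have nn: "0 \<le> b" if "u b \<noteq> 0" for b
      using cf_nonneg[of "Fser u" b] u(1) that by (simp add: Fser_inverse)
    have "l \<le> a" if "u (a - l) \<noteq> 0" for a using nn[OF that] by simp
    moreover have "u (l - l) \<noteq> 0" using u(2) by (simp add: zero_fun_def)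
    ultimately show "lead l (s - t)" unfolding lead_def mdvd_def c by blast
  next
    assume l: "lead l (s - t)"
    obtain m where m: "frac_supp m (cf (s - t))" by (rule frac_supp_cf)
    have fs: "frac_supp m (\<lambda>a. cf (s - t) (a + l))"
      unfolding frac_supp_def
    proof (intro conjI allI impI)
      show "0 < m" using m by (simp add: frac_supp_def)
      fix a i assume a: "cf (s - t) (a + l) \<noteq> 0"
      then have "l \<le> a + l" using l unfolding lead_def mdvd_def by blast
      then show "0 \<le> a i" by (auto simp: le_fun_def)
      have "of_nat m * (a + l) i \<in> \<int>" "of_nat m * l i \<in> \<int>"
        using frac_supp_grid(2)[OF m] a l unfolding lead_def by blast+
      then have "of_nat m * (a + l) i - of_nat m * l i \<in> \<int>" by (rule Ints_diff)
      then show "of_nat m * a i \<in> \<int>" by (simp add: distrib_left)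
    qed
    have "cf (s - t) = ser_mul (\<lambda>a. cf (s - t) (a + l)) (ser_monom l)"
      by (rule ext) (simp add: ser_mul_monom del: cf_diff)
    moreover have "cf (s - t) ((\<lambda>i. 0) + l) \<noteq> 0" using l by (simp add: lead_def zero_fun_def[symmetric] del: cf_diff)
    ultimately show "\<exists>u. is_fser u \<and> u (\<lambda>i. 0) \<noteq> 0 \<and> cf (s - t) = ser_mul u (ser_monom l)"
      using is_fserI[OF fs] by blast
  qed
  show ?thesis unfolding contact_def sd iff using assms lead_unique by blast
qed

text \<open>The discriminant is, up to sign, the product of the values of the derivative at the
  roots. In the converse direction the unit arises by lowering all exponents by q; they stay
  integral because the resultant, and with it q, is integral.\<close>

lemma quasi_ordinary_ypol_of:
  fixes p :: "('n::finite, 'a::field) fser poly"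
  assumes A: "finite A" and p: "p = (\<Prod>x\<in>A. [:- x, 1:])" and i: "ipoly p"
  shows "quasi_ordinary (ypol_of p) \<longleftrightarrow> (\<exists>q. lead q (\<Prod>x\<in>A. poly (pderiv p) x))"
proof -
  define D where "D = (-1) ^ (degree p * (degree p - 1) div 2) * (\<Prod>x\<in>A. poly (pderiv p) x)"
  have m1: "(-1 :: 'a) ^ k * c = (if even k then c else - c)" for k c by simp
  have m2: "(-1) ^ k * s = (if even k then s else - s)" for k and s :: "('n, 'a) fser" by simp
  have disc: "ydisc (ypol_of p) = cf D"
    unfolding ydisc_def ydeg_ypol_of yderiv_ypol_of yres_split[OF A p] D_def m1 m2 by auto
  have leadD: "lead q D \<longleftrightarrow> lead q (\<Prod>x\<in>A. poly (pderiv p) x)" for q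
    unfolding D_def m2 using lead_uminus[of q "\<Prod>x\<in>A. poly (pderiv p) x"]
      lead_uminus[of q "- (\<Prod>x\<in>A. poly (pderiv p) x)"] by auto
  have iD: "iser D"
  proof -
    have "iser (\<Prod>x\<in>A. poly (pderiv p) x)"
    proof -
      have "is_pser (yres (ypol_of p) (ypol_of (pderiv p)))"
        unfolding yres_ypol_of is_pser_cf by (rule iser_det_sylv[OF i ipoly_pderiv[OF i]])
      then show ?thesis unfolding yres_split[OF A p] is_pser_cf .
    qed
    then show ?thesis unfolding D_def m2 by (simp add: iser_uminus)
  qed
  have mon: "ymonic (ypol_of p)"
    unfolding ymonic_ypol_of using i lead_coeff_prod[of "\<lambda>x. [:- x, 1:]" A] by (simp add: p)
  show ?thesis
  proof
    assume "quasi_ordinary (ypol_of p)"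
    then obtain u q where u: "is_pser u" "u (\<lambda>i. 0) \<noteq> 0" "cf D = ser_mul u (ser_monom q)"
      unfolding quasi_ordinary_def disc by blast
    then have c: "cf D a = u (a - q)" for a by (simp add: ser_mul_monom)
    have "0 \<le> b" if "u b \<noteq> 0" for b
      using u(1) that by (auto simp: is_pser_def frac_supp_def le_fun_def)
    then have "q \<le> a" if "u (a - q) \<noteq> 0" for a using that by (metis diff_ge_0_iff_ge)
    moreover have "u (q - q) \<noteq> 0" using u(2) by (simp add: zero_fun_def)
    ultimately have "lead q D" unfolding lead_def mdvd_def c by blast
    then show "\<exists>q. lead q (\<Prod>x\<in>A. poly (pderiv p) x)" using leadD by blast
  next
    assume "\<exists>q. lead q (\<Prod>x\<in>A. poly (pderiv p) x)"
    then obtain q where q: "lead q D" using leadD by blast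
    define u where "u = (\<lambda>a. cf D (a + q))"
    have "is_pser u"
      unfolding is_pser_def frac_supp_def u_def
    proof (intro conjI allI impI)
      fix a j assume a: "cf D (a + q) \<noteq> 0"
      then have "q \<le> a + q" using q unfolding lead_def mdvd_def by blast
      then show "0 \<le> a j" by (auto simp: le_fun_def)
      have "a + q \<in> zlat" "q \<in> zlat" using iD a q unfolding iser_def lead_def by blast+
      then have "(a + q) j \<in> \<int>" "q j \<in> \<int>" by (simp_all add: zlat_def)
      then have "(a + q) j - q j \<in> \<int>" by (rule Ints_diff)
      then show "of_nat 1 * a j \<in> \<int>" by simp
    qed simp
    moreover have "u (\<lambda>i. 0) \<noteq> 0" using q by (simp add: u_def lead_def zero_fun_def[symmetric])
    moreover have "cf D = ser_mul u (ser_monom q)" by (rule ext) (simp add: ser_mul_monom u_def)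
    ultimately show "quasi_ordinary (ypol_of p)" unfolding quasi_ordinary_def disc using mon by blast
  qed
qed

section \<open>Conjugates and semiroots of a quasi-ordinary branch\<close>

lemma act_coeff_prod_linear:
  fixes A :: "('n::finite, 'a::field) fser set"
  assumes \<chi>: "\<chi> \<in> chars" and A: "finite A"
  shows "act \<chi> (coeff (\<Prod>x\<in>A. [:- x, 1:]) i) = coeff (\<Prod>x\<in>A. [:- act \<chi> x, 1:]) i"
  using A
proof (induction A arbitrary: i)
  case empty
  then show ?case using \<chi> by (simp add: coeff_1)
next
  case (insert x A)
  have "act \<chi> (coeff [:- x, 1:] j) = coeff [:- act \<chi> x, 1:] j" for j
    using \<chi> by (auto simp: coeff_pCons act_uminus split: nat.splits)
  then show ?case
    unfolding prod.insert[OF insert.hyps] coeff_mult act_sum act_mult[OF \<chi>] by (simp only: insert.IH)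
qed

text \<open>Injective self-maps of a finite set permute it, so the characters fix the coefficients,
  and \<open>iserI_act\<close> applies.\<close>

lemma ipoly_prod_linear:
  fixes A :: "('n::finite, 'a::field_char_0) fser set"
  assumes K: "alg_closed_field TYPE('a)" and A: "finite A"
    and inv: "\<And>\<chi>. \<chi> \<in> chars \<Longrightarrow> act \<chi> ` A \<subseteq> A"
  shows "ipoly (\<Prod>x\<in>A. [:- x, 1:])"
  unfolding ipoly_def
proof (intro allI iserI_act[OF K])
  fix i and \<chi> :: "('n \<Rightarrow> rat) \<Rightarrow> 'a" assume \<chi>: "\<chi> \<in> chars"
  have inj: "inj_on (act \<chi>) A" by (rule inj_onI) (simp add: act_inj[OF \<chi>])
  have "act \<chi> ` A = A" using A inv[OF \<chi>] inj by (simp add: endo_inj_surj)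
  moreover have "(\<Prod>x\<in>A. [:- act \<chi> x, 1:]) = (\<Prod>x\<in>act \<chi> ` A. [:- x, 1:])"
    by (simp add: prod.reindex[OF inj])
  ultimately show "act \<chi> (coeff (\<Prod>x\<in>A. [:- x, 1:]) i) = coeff (\<Prod>x\<in>A. [:- x, 1:]) i"
    by (simp add: act_coeff_prod_linear[OF \<chi> A])
qed

lemma degree_prod_linear: "degree (\<Prod>x\<in>A. [:- x, 1 :: 'a::idom:]) = card A"
  by (subst degree_prod_eq_sum_degree) auto

lemma lead_coeff_prod_linear: "lead_coeff (\<Prod>x\<in>A. [:- x, 1 :: 'a::idom:]) = 1"
  by (simp add: lead_coeff_prod)

lemma poly_prod_linear: "poly (\<Prod>x\<in>A. [:- x, 1 :: 'a::idom:]) y = (\<Prod>x\<in>A. y - x)"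
  by (simp add: poly_prod)

text \<open>What is kept of f: one root, together with the fact that its contacts with its
  conjugates are exactly the members of \<open>hs\<close>. The polynomial is recovered as the one
  whose roots are these conjugates (\<open>ex_branch\<close>).\<close>

locale branch =
  fixes \<alpha> :: "('n::finite, 'a::field_char_0) fser" and hs :: "('n \<Rightarrow> rat) list"
  assumes K: "alg_closed_field TYPE('a)"
    and sorted: "sorted_wrt (<) hs"
    and contacts: "\<chi> \<in> chars \<Longrightarrow> act \<chi> \<alpha> \<noteq> \<alpha> \<Longrightarrow> \<exists>h\<in>set hs. lead h (\<alpha> - act \<chi> \<alpha>)"
    and realized: "h \<in> set hs \<Longrightarrow> \<exists>\<chi>\<in>chars. lead h (\<alpha> - act \<chi> \<alpha>)"
begin

text \<open>Indices are shifted: \<open>H i\<close> and \<open>n i\<close> stand for \<open>h_(i+1)\<close> and \<open>n_(i+1)\<close>, while \<open>N i = n_1 ... n_i\<close>.\<close>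

abbreviation H :: "nat \<Rightarrow> 'n \<Rightarrow> rat" where "H i \<equiv> hs ! i"
abbreviation M :: "nat \<Rightarrow> ('n \<Rightarrow> rat) set" where "M i \<equiv> char_lat hs i"
abbreviation s :: nat where "s \<equiv> length hs"
abbreviation n :: "nat \<Rightarrow> nat" where "n i \<equiv> ord_mod (M i) (H i)"

definition N :: "nat \<Rightarrow> nat" where "N i = (\<Prod>l<i. n l)"

lemma N_0 [simp]: "N 0 = 1" and N_Suc: "N (Suc i) = N i * n i"
  by (simp_all add: N_def)

lemma n_pos: "0 < n i" by (simp add: ord_mod_pos)
lemma N_pos: "0 < N i" by (induction i) (simp_all add: N_Suc n_pos)

lemma H_mono: "i < j \<Longrightarrow> j < s \<Longrightarrow> H i < H j"
  using sorted by (simp add: sorted_wrt_nth_less)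

lemma H_le: "i \<le> j \<Longrightarrow> j < s \<Longrightarrow> H i \<le> H j"
  using H_mono[of i j] by (cases "i = j") (auto simp: less_imp_le)

text \<open>Triviality on \<open>M i\<close>, tested on generators only. For
  \<open>i \<le> s\<close> these characters form the stabilizer of the truncation
  \<open>\<beta> i\<close> introduced below.\<close>

definition triv :: "nat \<Rightarrow> (('n \<Rightarrow> rat) \<Rightarrow> 'a) \<Rightarrow> bool" where
  "triv i \<chi> \<longleftrightarrow> \<chi> \<in> chars \<and> (\<forall>l<i. \<chi> (H l) = 1)"

lemma triv_char_lat: "triv i \<chi> \<Longrightarrow> a \<in> M i \<Longrightarrow> \<chi> a = 1"
  using char_trivial_char_lat unfolding triv_def by blast

lemma char_lat_triv: "\<chi> \<in> chars \<Longrightarrow> (\<forall>a\<in>M i. \<chi> a = 1) \<Longrightarrow> triv i \<chi>"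
  unfolding triv_def using nth_mem_char_lat by blast

text \<open>The coefficient of \<open>\<alpha> - act \<chi> \<alpha>\<close> at h is 1 - \<chi>(h)
  times that of \<open>\<alpha>\<close>, so every realized contact lies in the support of
  \<open>\<alpha>\<close>.\<close>

lemma cf_H: "l < s \<Longrightarrow> cf \<alpha> (H l) \<noteq> 0"
  using realized[of "H l"] by (auto simp: lead_def)

text \<open>The contact with a conjugate is the first exponent of \<open>hs\<close> on which the
  character is nontrivial: an earlier one would occur in the difference below its leading
  exponent.\<close>

lemma contact_triv:
  assumes \<chi>: "\<chi> \<in> chars" and ne: "act \<chi> \<alpha> \<noteq> \<alpha>"
  shows "\<exists>j<s. triv j \<chi> \<and> \<chi> (H j) \<noteq> 1 \<and> lead (H j) (\<alpha> - act \<chi> \<alpha>)"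
proof -
  obtain j where j: "j < s" "lead (H j) (\<alpha> - act \<chi> \<alpha>)"
    using contacts[OF \<chi> ne] by (auto simp: in_set_conv_nth)
  have "\<chi> (H l) = 1" if l: "l < j" for l
  proof (rule ccontr)
    assume "\<chi> (H l) \<noteq> 1"
    then have "cf (\<alpha> - act \<chi> \<alpha>) (H l) \<noteq> 0" using cf_H[of l] l j by (simp add: field_simps)
    then have "H j \<le> H l" using j by (auto simp: lead_def mdvd_def)
    then show False using H_mono[OF l j(1)] by simp
  qed
  moreover have "\<chi> (H j) \<noteq> 1" using j(2) by (auto simp: lead_def)
  ultimately show ?thesis using j \<chi> by (auto simp: triv_def)
qed

lemma triv_s: "triv s \<chi> \<Longrightarrow> act \<chi> \<alpha> = \<alpha>"
  using contact_triv[of \<chi>] by (auto simp: triv_def)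

lemma lead_diff_act:
  assumes "triv j \<chi>" "j < s" "\<chi> (H j) \<noteq> 1"
  shows "lead (H j) (\<alpha> - act \<chi> \<alpha>)"
proof -
  have \<chi>: "\<chi> \<in> chars" using assms by (simp add: triv_def)
  have "cf (act \<chi> \<alpha>) (H j) \<noteq> cf \<alpha> (H j)" using cf_H[OF assms(2)] assms(3) by simp
  then have "act \<chi> \<alpha> \<noteq> \<alpha>" by metis
  from contact_triv[OF \<chi> this] obtain i where i: "i < s" "triv i \<chi>" "\<chi> (H i) \<noteq> 1" "lead (H i) (\<alpha> - act \<chi> \<alpha>)"
    by blast
  then have "i = j" using assms unfolding triv_def by (metis linorder_neqE_nat)
  then show ?thesis using i by simp
qed

text \<open>A character that realizes the contact \<open>H j\<close> is trivial on all earlier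
  exponents, hence on \<open>M j\<close>, but not at \<open>H j\<close>.\<close>

lemma H_notin: "j < s \<Longrightarrow> H j \<notin> M j"
proof
  assume j: "j < s" and "H j \<in> M j"
  obtain \<chi> where \<chi>: "\<chi> \<in> chars" "lead (H j) (\<alpha> - act \<chi> \<alpha>)" using realized[of "H j"] j by auto
  then have "act \<chi> \<alpha> \<noteq> \<alpha>" using lead_nz by fastforce
  from contact_triv[OF \<chi>(1) this] obtain i where i: "i < s" "triv i \<chi>" "\<chi> (H i) \<noteq> 1" "lead (H i) (\<alpha> - act \<chi> \<alpha>)"
    by blast
  have "H i = H j" using lead_unique[OF i(4) \<chi>(2)] .
  then have "i = j" using H_mono[of i j] H_mono[of j i] i(1) j by (metis less_irrefl linorder_neqE_nat)
  then show False using i triv_char_lat[of j \<chi>] \<open>H j \<in> M j\<close> by auto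
qed

section \<open>Truncations of the root and their conjugates\<close>

definition \<beta> :: "nat \<Rightarrow> ('n, 'a) fser" where "\<beta> i = trunc (M i) \<alpha>"

definition B :: "nat \<Rightarrow> ('n, 'a) fser set" where "B i = {act \<chi> (\<beta> i) | \<chi>. \<chi> \<in> chars}"

definition P :: "nat \<Rightarrow> ('n, 'a) fser poly" where "P i = (\<Prod>x\<in>B i. [:- x, 1:])"

lemma \<beta>_in_B [simp]: "\<beta> i \<in> B i"
  unfolding B_def using chars_one act_one_char by (metis (mono_tags, lifting) mem_Collect_eq)

lemma cf_\<beta>: "cf (\<beta> i) a = (if a \<in> M i then cf \<alpha> a else 0)"
  by (simp add: \<beta>_def cf_trunc)

text \<open>The exponents \<open>H l\<close> with \<open>l < i\<close> occur in
  \<open>\<beta> i\<close>, so their values can be read off; conversely they generate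
  \<open>M i\<close> modulo Z^d and so determine the action on everything in
  \<open>\<beta> i\<close>.\<close>

lemma act_\<beta>_eq:
  assumes \<chi>: "\<chi> \<in> chars" and \<psi>: "\<psi> \<in> chars" and i: "i \<le> s"
  shows "act \<chi> (\<beta> i) = act \<psi> (\<beta> i) \<longleftrightarrow> (\<forall>l<i. \<chi> (H l) = \<psi> (H l))"
proof
  assume eq: "act \<chi> (\<beta> i) = act \<psi> (\<beta> i)"
  show "\<forall>l<i. \<chi> (H l) = \<psi> (H l)"
  proof (intro allI impI)
    fix l assume l: "l < i"
    have "cf (act \<chi> (\<beta> i)) (H l) = cf (act \<psi> (\<beta> i)) (H l)" by (simp only: eq)
    then show "\<chi> (H l) = \<psi> (H l)" using cf_H[of l] l i nth_mem_char_lat[OF l, of hs] by (simp add: cf_\<beta>)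
  qed
next
  assume "\<forall>l<i. \<chi> (H l) = \<psi> (H l)"
  then have "triv i (\<lambda>a. \<chi> a * inverse (\<psi> a))"
    unfolding triv_def using chars_mult[OF \<chi> chars_inverse[OF \<psi>]] chars_nz[OF \<psi>] by simp
  then have "\<chi> a * inverse (\<psi> a) = 1" if "a \<in> M i" for a using triv_char_lat that by blast
  then have eq: "\<chi> a = \<psi> a" if "a \<in> M i" for a using that chars_nz[OF \<psi>, of a] by (metis divide_inverse eq_divide_eq_1 nonzero_eq_divide_eq mult_1)
  show "act \<chi> (\<beta> i) = act \<psi> (\<beta> i)" by (rule fser_eqI) (simp add: cf_\<beta> eq)
qed

lemma triv_\<beta>: "triv i \<chi> \<Longrightarrow> act \<chi> (\<beta> i) = \<beta> i"
  by (rule fser_eqI) (simp add: cf_\<beta> triv_char_lat)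

text \<open>Characters trivial on \<open>M s\<close> fix \<open>\<alpha>\<close>, so by separation
  the whole support lies in \<open>M s\<close>.\<close>

lemma \<beta>_s: "\<beta> s = \<alpha>"
proof (rule fser_eqI)
  fix a
  have "cf \<alpha> a = 0" if a: "a \<notin> M s"
  proof -
    obtain \<chi> :: "('n \<Rightarrow> rat) \<Rightarrow> 'a" where \<chi>: "\<chi> \<in> chars" "\<forall>a\<in>M s. \<chi> a = 1" "\<chi> a \<noteq> 1"
      using char_separate[OF K _ a] by auto
    then have "act \<chi> \<alpha> = \<alpha>" using triv_s char_lat_triv by blast
    then have "cf (act \<chi> \<alpha>) a = cf \<alpha> a" by (simp only:)
    then show ?thesis using \<chi>(3) by simp
  qed
  then show "cf (\<beta> s) a = cf \<alpha> a" by (simp add: cf_\<beta>)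
qed

text \<open>An exponent of \<open>\<alpha>\<close> outside \<open>M i\<close> is moved by a
  character that is trivial on \<open>M i\<close>. The contact with the resulting conjugate is some
  \<open>H j\<close> with \<open>j \<ge> i\<close>, and it lies below that exponent.\<close>

lemma lead_\<alpha>_\<beta>:
  assumes i: "i < s"
  shows "lead (H i) (\<alpha> - \<beta> i)"
  unfolding lead_def
proof
  show "cf (\<alpha> - \<beta> i) (H i) \<noteq> 0" using cf_H[OF i] H_notin[OF i] by (simp add: cf_\<beta>)
  show "mdvd (H i) (\<alpha> - \<beta> i)" unfolding mdvd_def
  proof (intro allI impI)
    fix a assume "cf (\<alpha> - \<beta> i) a \<noteq> 0"
    then have a: "a \<notin> M i" "cf \<alpha> a \<noteq> 0" by (auto simp: cf_\<beta> split: if_splits)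
    obtain \<chi> :: "('n \<Rightarrow> rat) \<Rightarrow> 'a" where \<chi>: "\<chi> \<in> chars" "\<forall>a\<in>M i. \<chi> a = 1" "\<chi> a \<noteq> 1"
      using char_separate[OF K _ a(1)] by auto
    have ne: "cf (\<alpha> - act \<chi> \<alpha>) a \<noteq> 0" using a(2) \<chi>(3) by (simp add: field_simps)
    then have "act \<chi> \<alpha> \<noteq> \<alpha>" by (metis cf_zero diff_self)
    from contact_triv[OF \<chi>(1) this] obtain j where j: "j < s" "\<chi> (H j) \<noteq> 1" "lead (H j) (\<alpha> - act \<chi> \<alpha>)" by blast
    have "\<not> j < i" using j(2) \<chi>(2) nth_mem_char_lat[of j i hs] by auto
    then have "H i \<le> H j" using H_le j(1) by simp
    also have "H j \<le> a" using j(3) ne by (auto simp: lead_def mdvd_def)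
    finally show "H i \<le> a" .
  qed
qed

lemma sdvd_\<alpha>_\<beta>: "j < i \<Longrightarrow> i \<le> s \<Longrightarrow> sdvd (H j) (\<alpha> - \<beta> i)"
proof (cases "i = s")
  case False
  assume "j < i" "i \<le> s"
  then show ?thesis
    using False lead_\<alpha>_\<beta>[of i] H_mono[of j i] by (intro mdvd_imp_sdvd[of "H i"]) (auto simp: lead_def)
qed (simp add: \<beta>_s)

lemma first_diff:
  assumes \<chi>: "\<chi> \<in> chars" and "\<not> triv i \<chi>"
  shows "\<exists>j<i. triv j \<chi> \<and> \<chi> (H j) \<noteq> 1"
proof -
  define j where "j = (LEAST l. \<chi> (H l) \<noteq> 1)"
  obtain l where l: "l < i" "\<chi> (H l) \<noteq> 1" using assms by (auto simp: triv_def)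
  then have "\<chi> (H j) \<noteq> 1" unfolding j_def by (metis (mono_tags) LeastI)
  moreover have "j \<le> l" unfolding j_def by (rule Least_le) (rule l(2))
  moreover have "\<forall>m<j. \<chi> (H m) = 1" unfolding j_def using not_less_Least by blast
  ultimately show ?thesis using l(1) \<chi> by (intro exI[of _ j]) (auto simp: triv_def)
qed

lemma lead_\<alpha>_act_\<beta>:
  assumes "triv j \<chi>" "\<chi> (H j) \<noteq> 1" "j < i" "i \<le> s"
  shows "lead (H j) (\<alpha> - act \<chi> (\<beta> i))"
proof -
  have \<chi>: "\<chi> \<in> chars" using assms by (simp add: triv_def)
  have "lead (H j) ((\<alpha> - act \<chi> \<alpha>) + act \<chi> (\<alpha> - \<beta> i))"
    using assms \<chi> lead_diff_act[of j \<chi>] sdvd_\<alpha>_\<beta>[of j i] by (intro lead_add_sdvd) auto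
  then show ?thesis by (simp add: act_diff)
qed

lemma trunc_act_\<beta>: "i \<le> j \<Longrightarrow> trunc (M i) (act \<chi> (\<beta> j)) = act \<chi> (\<beta> i)"
  using char_lat_mono[of i j hs] by (intro fser_eqI) (auto simp: cf_trunc cf_\<beta>)

section \<open>Counting conjugates through the fibres of truncation\<close>

definition F :: "nat \<Rightarrow> ('n, 'a) fser \<Rightarrow> ('n, 'a) fser set" where
  "F i x = {y \<in> B (Suc i). trunc (M i) y = x}"

text \<open>A point of the fibre is determined by its coefficient at \<open>H i\<close>, and the
  possible coefficients are c times the \<open>n i\<close>-th roots of unity. Only these occur since
  quotients of the characters involved are trivial on \<open>M i\<close>, which contains
  \<open>nsm (n i) (H i)\<close>; all of them occur by \<open>char_extend\<close>.\<close>

lemma card_F: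
  assumes i: "i < s" and x: "x \<in> B i"
  shows "card (F i x) = n i"
proof -
  obtain \<chi> where \<chi>: "\<chi> \<in> chars" "x = act \<chi> (\<beta> i)" using x by (auto simp: B_def)
  define c where "c = \<chi> (H i) * cf \<alpha> (H i)"
  have c0: "c \<noteq> 0" using cf_H[OF i] chars_nz[OF \<chi>(1)] by (simp add: c_def)
  have HM: "H i \<in> M (Suc i)" by (rule nth_mem_char_lat) simp
  have mem: "act \<psi> (\<beta> (Suc i)) \<in> F i x \<longleftrightarrow> (\<forall>l<i. \<psi> (H l) = \<chi> (H l))" if "\<psi> \<in> chars" for \<psi>
    using that act_\<beta>_eq[OF that \<chi>(1), of i] i by (auto simp: F_def trunc_act_\<beta> \<chi>(2) B_def)
  have F: "\<exists>\<psi>\<in>chars. y = act \<psi> (\<beta> (Suc i)) \<and> (\<forall>l<i. \<psi> (H l) = \<chi> (H l))" if y: "y \<in> F i x" for y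
  proof -
    obtain \<psi> where "\<psi> \<in> chars" "y = act \<psi> (\<beta> (Suc i))" using y by (auto simp: F_def B_def)
    then show ?thesis using mem y by blast
  qed
  have "inj_on (\<lambda>y. cf y (H i)) (F i x)"
  proof (rule inj_onI)
    fix y z assume "y \<in> F i x" "z \<in> F i x" and eq: "cf y (H i) = cf z (H i)"
    then obtain \<psi> \<phi> where \<psi>: "\<psi> \<in> chars" "y = act \<psi> (\<beta> (Suc i))" "\<forall>l<i. \<psi> (H l) = \<chi> (H l)"
      and \<phi>: "\<phi> \<in> chars" "z = act \<phi> (\<beta> (Suc i))" "\<forall>l<i. \<phi> (H l) = \<chi> (H l)"
      using F by meson
    have "\<psi> (H i) = \<phi> (H i)" using eq cf_H[OF i] HM by (simp add: \<psi> \<phi> cf_\<beta>)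
    then have "\<forall>l<Suc i. \<psi> (H l) = \<phi> (H l)" using \<psi>(3) \<phi>(3) by (simp add: less_Suc_eq)
    then show "y = z" using act_\<beta>_eq[OF \<psi>(1) \<phi>(1), of "Suc i"] i by (simp add: \<psi> \<phi>)
  qed
  then have "card (F i x) = card ((\<lambda>y. cf y (H i)) ` F i x)" by (simp add: card_image)
  also have "(\<lambda>y. cf y (H i)) ` F i x = (\<lambda>w. c * w) ` {w. w ^ n i = 1}"
  proof (intro equalityI subsetI)
    fix v assume "v \<in> (\<lambda>y. cf y (H i)) ` F i x"
    then obtain y where y: "y \<in> F i x" "v = cf y (H i)" by blast
    obtain \<psi> where \<psi>: "\<psi> \<in> chars" "\<forall>l<i. \<psi> (H l) = \<chi> (H l)" "v = cf (act \<psi> (\<beta> (Suc i))) (H i)"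
      using F[OF y(1)] y(2) by blast
    have t: "triv i (\<lambda>a. \<psi> a * inverse (\<chi> a))"
      unfolding triv_def using \<psi>(1,2) chars_mult[OF \<psi>(1) chars_inverse[OF \<chi>(1)]] chars_nz[OF \<chi>(1)] by simp
    then have "(\<psi> (H i) * inverse (\<chi> (H i))) ^ n i = 1"
      using chars_nsm[of "\<lambda>a. \<psi> a * inverse (\<chi> a)" "n i" "H i"]
        triv_char_lat[OF t nsm_ord_mod[of "M i" "H i"]] by (simp add: triv_def)
    moreover have "v = c * (\<psi> (H i) * inverse (\<chi> (H i)))"
      using chars_nz[OF \<chi>(1)] HM by (simp add: \<psi>(3) c_def cf_\<beta>)
    ultimately show "v \<in> (\<lambda>w. c * w) ` {w. w ^ n i = 1}" by blast
  next
    fix v assume "v \<in> (\<lambda>w. c * w) ` {w. w ^ n i = 1}"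
    then obtain w where w: "w ^ n i = 1" "v = c * w" by blast
    obtain \<psi> where \<psi>: "\<psi> \<in> chars" "\<forall>a\<in>M i. \<psi> a = 1" "\<psi> (H i) = w"
      using char_extend[OF K _ w(1)] by auto
    have t: "triv i \<psi>" using char_lat_triv \<psi> by blast
    have "(\<lambda>a. \<chi> a * \<psi> a) \<in> chars" using \<chi>(1) \<psi>(1) by (rule chars_mult)
    then have "act (\<lambda>a. \<chi> a * \<psi> a) (\<beta> (Suc i)) \<in> F i x" using t by (simp add: mem triv_def)
    moreover have "v = cf (act (\<lambda>a. \<chi> a * \<psi> a) (\<beta> (Suc i))) (H i)"
      using HM by (simp add: w(2) c_def cf_\<beta> \<psi>(3))
    ultimately show "v \<in> (\<lambda>y. cf y (H i)) ` F i x" by blast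
  qed
  also have "card \<dots> = card {w::'a. w ^ n i = 1}"
    using c0 by (intro card_image) (auto simp: inj_on_def)
  also have "\<dots> = n i" using card_roots_of_unity[OF K n_pos] .
  finally show ?thesis .
qed

lemma finite_F: "i < s \<Longrightarrow> x \<in> B i \<Longrightarrow> finite (F i x)"
  using card_F n_pos by (metis card_gt_0_iff)

lemma trunc_B: "y \<in> B (Suc i) \<Longrightarrow> trunc (M i) y \<in> B i"
  by (auto simp: B_def trunc_act_\<beta>)

lemma B_Suc: "B (Suc i) = (\<Union>x\<in>B i. F i x)"
  using trunc_B by (auto simp: F_def)

lemma B_0: "B 0 = {\<beta> 0}"
  using triv_\<beta>[of 0] \<beta>_in_B[of 0] by (auto simp: B_def triv_def)

lemma F_disjoint: "x \<noteq> y \<Longrightarrow> F i x \<inter> F i y = {}" by (auto simp: F_def)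

lemma
  assumes "i \<le> s"
  shows finite_B: "finite (B i)" and card_B: "card (B i) = N i"
proof -
  have "finite (B i) \<and> card (B i) = N i" using assms
  proof (induction i)
    case 0
    then show ?case by (simp add: B_0)
  next
    case (Suc i)
    have "card (B (Suc i)) = (\<Sum>x\<in>B i. card (F i x))"
      unfolding B_Suc using Suc finite_F F_disjoint by (intro card_UN_disjoint) auto
    also have "\<dots> = (\<Sum>x\<in>B i. n i)" by (rule sum.cong) (use Suc.prems card_F in auto)
    finally show ?case using Suc finite_F by (auto simp: N_Suc B_Suc)
  qed
  then show "finite (B i)" "card (B i) = N i" by auto
qed

text \<open>In the notation of the paper, \<open>bb i\<close> is \<open>q_(i+1) / e_i\<close>, the exponent of \<open>p_i(\<alpha>)\<close>.\<close>

primrec ss :: "nat \<Rightarrow> 'n \<Rightarrow> rat" where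
  "ss 0 = 0"
| "ss (Suc i) = nsm (n i) (ss i) + nsm (n i - 1) (H i)"

definition bb :: "nat \<Rightarrow> 'n \<Rightarrow> rat" where "bb i = ss i + H i"

text \<open>The contact is decided by the first \<open>H j\<close> with \<open>j < i\<close> at
  which the character is nontrivial. Passing to a finer truncation changes only exponents above
  \<open>H j\<close>, so the contact depends on x alone.\<close>

lemma lead_ex:
  assumes "x \<in> B i - {\<beta> i}" "i \<le> s"
  shows "\<exists>j<i. lead (H j) (\<alpha> - x) \<and> (\<forall>k y. i \<le> k \<longrightarrow> k \<le> s \<longrightarrow> y \<in> B k \<longrightarrow> trunc (M i) y = x \<longrightarrow> lead (H j) (\<alpha> - y))"
proof -
  obtain \<chi> where \<chi>: "\<chi> \<in> chars" "x = act \<chi> (\<beta> i)" using assms by (auto simp: B_def)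
  then have "\<not> triv i \<chi>" using triv_\<beta> assms by auto
  from first_diff[OF \<chi>(1) this] obtain j where j: "j < i" "triv j \<chi>" "\<chi> (H j) \<noteq> 1" by blast
  have "lead (H j) (\<alpha> - y)" if y: "i \<le> k" "k \<le> s" "y \<in> B k" "trunc (M i) y = x" for k y
  proof -
    obtain \<psi> where \<psi>: "\<psi> \<in> chars" "y = act \<psi> (\<beta> k)" using y by (auto simp: B_def)
    then have "act \<psi> (\<beta> i) = act \<chi> (\<beta> i)" using trunc_act_\<beta>[OF y(1), of \<psi>] y(4) \<chi>(2) by simp
    then have "\<forall>l<i. \<psi> (H l) = \<chi> (H l)" using act_\<beta>_eq[OF \<psi>(1) \<chi>(1) assms(2)] by simp
    then have "triv j \<psi>" "\<psi> (H j) \<noteq> 1" using j \<psi>(1) by (auto simp: triv_def)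
    then show ?thesis using lead_\<alpha>_act_\<beta>[of j \<psi> k] j(1) y(1,2) by (simp add: \<psi>(2))
  qed
  then show ?thesis using j lead_\<alpha>_act_\<beta>[of j \<chi> i] assms(2) \<chi>(2) by blast
qed

lemma nsm_add: "nsm k (a + b) = nsm k a + nsm k b"
  by (simp add: nsm_def fun_eq_iff algebra_simps)

lemma sum_apply: "(\<Sum>x\<in>A. f x :: 'n \<Rightarrow> rat) j = (\<Sum>x\<in>A. f x j)"
  by (induction A rule: infinite_finite_induct) simp_all

lemma nsm_sum: "nsm k (\<Sum>x\<in>A. f x :: 'n \<Rightarrow> rat) = (\<Sum>x\<in>A. nsm k (f x))"
  by (rule ext) (simp add: sum_apply sum_distrib_left)

lemma sum_const_nsm: "(\<Sum>x\<in>A. v :: 'n \<Rightarrow> rat) = nsm (card A) v"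
  by (rule ext) (simp add: sum_apply)

text \<open>Above each x other than \<open>\<beta> i\<close> lie \<open>n i\<close> points with the
  same contact as x, which multiplies the old exponent by \<open>n i\<close>. The fibre over
  \<open>\<beta> i\<close> adds \<open>n i - 1\<close> points of contact \<open>H i\<close>. This is
  the recursion of \<open>ss\<close>.\<close>

lemma lead_ss: "i \<le> s \<Longrightarrow> lead (ss i) (\<Prod>x\<in>B i - {\<beta> i}. \<alpha> - x)"
proof (induction i)
  case 0
  have "lead (ss 0) (\<Prod>x\<in>B 0 - {\<beta> 0}. \<alpha> - x)" by (simp add: B_0)
  then show ?case .
next
  case (Suc i)
  then have i: "i < s" "i \<le> s" by auto
  have "\<forall>x\<in>B i - {\<beta> i}. \<exists>e. lead e (\<alpha> - x) \<and> (\<forall>y\<in>F i x. lead e (\<alpha> - y))"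
  proof
    fix x assume "x \<in> B i - {\<beta> i}"
    from lead_ex[OF this i(2)] obtain j where j: "lead (H j) (\<alpha> - x)"
      "\<And>k y. i \<le> k \<Longrightarrow> k \<le> s \<Longrightarrow> y \<in> B k \<Longrightarrow> trunc (M i) y = x \<Longrightarrow> lead (H j) (\<alpha> - y)" by blast
    have "lead (H j) (\<alpha> - y)" if "y \<in> F i x" for y
      using j(2)[of "Suc i" y] that Suc.prems by (simp add: F_def)
    then show "\<exists>e. lead e (\<alpha> - x) \<and> (\<forall>y\<in>F i x. lead e (\<alpha> - y))" using j(1) by blast
  qed
  from bchoice[OF this] obtain e where e: "\<And>x. x \<in> B i - {\<beta> i} \<Longrightarrow> lead (e x) (\<alpha> - x)"
    "\<And>x y. x \<in> B i - {\<beta> i} \<Longrightarrow> y \<in> F i x \<Longrightarrow> lead (e x) (\<alpha> - y)" by blast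
  have se: "(\<Sum>x\<in>B i - {\<beta> i}. e x) = ss i"
    by (rule lead_unique[OF lead_prod Suc.IH[OF i(2)]]) (rule e(1))
  have "lead (nsm (n i) (e x)) (\<Prod>y\<in>F i x. \<alpha> - y)" if x: "x \<in> B i - {\<beta> i}" for x
  proof -
    have "lead (\<Sum>y\<in>F i x. e x) (\<Prod>y\<in>F i x. \<alpha> - y)" by (rule lead_prod) (rule e(2)[OF x])
    moreover have "card (F i x) = n i" using x i by (simp add: card_F)
    ultimately show ?thesis by (simp only: sum_const_nsm)
  qed
  then have "lead (\<Sum>x\<in>B i - {\<beta> i}. nsm (n i) (e x)) (\<Prod>x\<in>B i - {\<beta> i}. \<Prod>y\<in>F i x. \<alpha> - y)" by (rule lead_prod)
  then have 1: "lead (nsm (n i) (ss i)) (\<Prod>x\<in>B i - {\<beta> i}. \<Prod>y\<in>F i x. \<alpha> - y)"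
    by (simp add: nsm_sum[symmetric] se)
  have \<beta>F: "\<beta> (Suc i) \<in> F i (\<beta> i)"
    using trunc_act_\<beta>[of i "Suc i" "\<lambda>_. 1"] by (simp add: F_def)
  have "lead (H i) (\<alpha> - y)" if y: "y \<in> F i (\<beta> i) - {\<beta> (Suc i)}" for y
  proof -
    obtain \<chi> where \<chi>: "\<chi> \<in> chars" "y = act \<chi> (\<beta> (Suc i))" using y by (auto simp: F_def B_def)
    have "act \<chi> (\<beta> i) = act (\<lambda>_. 1) (\<beta> i)" using y trunc_act_\<beta>[of i "Suc i" \<chi>] \<chi>(2) by (simp add: F_def)
    then have t: "triv i \<chi>" using act_\<beta>_eq[OF \<chi>(1) chars_one i(2)] \<chi>(1) by (simp add: triv_def)
    then have "\<not> triv (Suc i) \<chi>" using triv_\<beta>[of "Suc i" \<chi>] y \<chi>(2) by auto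
    then have "\<chi> (H i) \<noteq> 1" using t by (auto simp: triv_def less_Suc_eq)
    then show ?thesis using lead_\<alpha>_act_\<beta>[OF t, of "Suc i"] Suc.prems \<chi>(2) by simp
  qed
  then have "lead (\<Sum>y\<in>F i (\<beta> i) - {\<beta> (Suc i)}. H i) (\<Prod>y\<in>F i (\<beta> i) - {\<beta> (Suc i)}. \<alpha> - y)" by (rule lead_prod)
  then have 2: "lead (nsm (n i - 1) (H i)) (\<Prod>y\<in>F i (\<beta> i) - {\<beta> (Suc i)}. \<alpha> - y)"
    unfolding sum_const_nsm using \<beta>F finite_F[OF i(1) \<beta>_in_B] by (simp add: card_F[OF i(1) \<beta>_in_B])
  have "B (Suc i) - {\<beta> (Suc i)} = (\<Union>x\<in>B i - {\<beta> i}. F i x) \<union> (F i (\<beta> i) - {\<beta> (Suc i)})"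
    unfolding B_Suc using \<beta>F F_disjoint[of _ "\<beta> i" i] by auto
  moreover have "finite (\<Union>x\<in>B i - {\<beta> i}. F i x)" "finite (F i (\<beta> i) - {\<beta> (Suc i)})"
    using finite_B[OF i(2)] finite_F[OF i(1)] by auto
  moreover have "(\<Union>x\<in>B i - {\<beta> i}. F i x) \<inter> (F i (\<beta> i) - {\<beta> (Suc i)}) = {}"
    using F_disjoint[of _ "\<beta> i" i] by blast
  ultimately have "(\<Prod>x\<in>B (Suc i) - {\<beta> (Suc i)}. \<alpha> - x) =
      (\<Prod>x\<in>(\<Union>x\<in>B i - {\<beta> i}. F i x). \<alpha> - x) * (\<Prod>y\<in>F i (\<beta> i) - {\<beta> (Suc i)}. \<alpha> - y)"
    by (simp only: prod.union_disjoint)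
  also have "(\<Prod>x\<in>(\<Union>x\<in>B i - {\<beta> i}. F i x). \<alpha> - x) = (\<Prod>x\<in>B i - {\<beta> i}. \<Prod>y\<in>F i x. \<alpha> - y)"
    using finite_B[OF i(2)] finite_F[OF i(1)] F_disjoint by (intro prod.UNION_disjoint) auto
  finally show ?case using lead_mult[OF 1 2] by (simp only: ss.simps)
qed

lemma poly_P: "poly (P i) x = (\<Prod>y\<in>B i. x - y)"
  by (simp add: P_def poly_prod_linear)

lemma lead_P: "i < s \<Longrightarrow> lead (bb i) (poly (P i) \<alpha>)"
  using lead_mult[OF lead_\<alpha>_\<beta> lead_ss, of i i] finite_B[of i]
  by (simp add: poly_P bb_def prod.remove[of "B i" "\<beta> i"] add.commute)

lemma act_B: "\<chi> \<in> chars \<Longrightarrow> act \<chi> ` B i \<subseteq> B i"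
  unfolding B_def using chars_mult by (fastforce simp: act_act)

lemma ipoly_P: "i \<le> s \<Longrightarrow> ipoly (P i)"
  unfolding P_def by (intro ipoly_prod_linear[OF K] finite_B act_B)

lemma degree_P: "i \<le> s \<Longrightarrow> degree (P i) = N i"
  by (simp add: P_def degree_prod_linear card_B)

lemma lead_coeff_P: "lead_coeff (P i) = 1"
  unfolding P_def by (rule lead_coeff_prod_linear)

lemma ss_mem: "ss i \<in> M i"
proof (induction i)
  case 0
  show ?case by (simp only: ss.simps latticeD(1)[OF lattice_char_lat])
next
  case (Suc i)
  have "ss i \<in> M (Suc i)" using Suc char_lat_mono[of i "Suc i" hs] by auto
  moreover have "H i \<in> M (Suc i)" by (rule nth_mem_char_lat) simp
  ultimately show ?case unfolding ss.simps by (intro latticeD(5,6)[OF lattice_char_lat])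
qed

lemma bb_mem: "bb i \<in> M (Suc i)"
  unfolding bb_def using ss_mem[of i] char_lat_mono[of i "Suc i" hs] nth_mem_char_lat[of i "Suc i" hs]
  by (intro latticeD(5)[OF lattice_char_lat]) auto

text \<open>Modulo \<open>M i\<close> the exponents \<open>bb i\<close> and \<open>H i\<close>
  agree, since \<open>ss i\<close> lies in \<open>M i\<close>. So \<open>bb i\<close> has order
  \<open>n i\<close>, which keeps the terms of a \<open>P i\<close>-adic expansion apart.\<close>

lemma nsm_bb_mem: "nsm k (bb i) \<in> M i \<longleftrightarrow> n i dvd k"
proof -
  have e: "nsm k (bb i) = nsm k (ss i) + nsm k (H i)" by (simp add: bb_def nsm_add)
  have m: "nsm k (ss i) \<in> M i" using ss_mem latticeD(6)[OF lattice_char_lat] by blast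
  have "nsm k (bb i) \<in> M i \<longleftrightarrow> nsm k (H i) \<in> M i"
    unfolding e using m latticeD(2,5)[OF lattice_char_lat] by (metis add_diff_cancel_left')
  then show ?thesis using nsm_mem_iff[OF lattice_char_lat] by simp
qed

text \<open>The classical recursion for semigroup generators of a branch, n_j times the old one plus
  the difference of consecutive characteristic exponents.\<close>

lemma bb_Suc: "bb (Suc i) + H i = nsm (n i) (bb i) + H (Suc i)"
proof
  fix j
  have "of_nat (n i - 1) = (of_nat (n i) - 1 :: rat)" using n_pos[of i] by (simp add: of_nat_diff)
  then show "(bb (Suc i) + H i) j = (nsm (n i) (bb i) + H (Suc i)) j"
    by (simp add: bb_def algebra_simps)
qed

lemma bb_nonneg: "i < s \<Longrightarrow> 0 \<le> bb i"
  using lead_P[of i] cf_nonneg unfolding lead_def by blast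

end

section \<open>Reduction of polynomials modulo a monomial\<close>

definition cdvd :: "('n::finite \<Rightarrow> rat) \<Rightarrow> ('n, 'a::field) fser poly \<Rightarrow> bool" where
  "cdvd e q \<longleftrightarrow> (\<forall>i. mdvd e (coeff q i))"

text \<open>Under \<open>cdvd e q\<close> this is the residue of q / X^e modulo the maximal ideal,
  and that condition is what makes it multiplicative.\<close>

definition redp :: "('n::finite \<Rightarrow> rat) \<Rightarrow> ('n, 'a::field) fser poly \<Rightarrow> 'a poly" where
  "redp e q = map_poly (\<lambda>s. cf s e) q"

lemma coeff_redp [simp]: "coeff (redp e q) i = cf (coeff q i) e"
  by (simp add: redp_def coeff_map_poly)

lemma cdvd_mult: "cdvd e p \<Longrightarrow> cdvd e' q \<Longrightarrow> cdvd (e + e') (p * q)"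
  by (auto simp: cdvd_def coeff_mult intro!: mdvd_sum mdvd_mult)

lemma redp_mult: "cdvd e p \<Longrightarrow> cdvd e' q \<Longrightarrow> redp (e + e') (p * q) = redp e p * redp e' q"
  by (rule poly_eqI) (simp add: coeff_mult cdvd_def cf_mult_mdvd)

lemma redp_add: "redp e (p + q) = redp e p + redp e q"
  by (rule poly_eqI) simp

lemma cdvd_add: "cdvd e p \<Longrightarrow> cdvd e q \<Longrightarrow> cdvd e (p + q)"
  by (simp add: cdvd_def mdvd_add)

lemma cdvd_sum: "(\<And>x. x \<in> A \<Longrightarrow> cdvd e (f x)) \<Longrightarrow> cdvd e (\<Sum>x\<in>A. f x)"
  by (auto simp: cdvd_def coeff_sum intro!: mdvd_sum)

lemma redp_sum: "redp e (\<Sum>x\<in>A. f x) = (\<Sum>x\<in>A. redp e (f x))"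
  by (rule poly_eqI) (simp add: coeff_sum)

lemma cdvd_one [simp]: "cdvd 0 1" by (simp add: cdvd_def)

lemma redp_one [simp]: "redp 0 1 = 1"
  by (rule poly_eqI) (simp add: cf_one coeff_1)

lemma cdvd_power: "cdvd e p \<Longrightarrow> cdvd (nsm k e) (p ^ k)"
  by (induction k) (simp_all only: power_0 power_Suc nsm_0 nsm_Suc cdvd_one cdvd_mult)

lemma redp_power: "cdvd e p \<Longrightarrow> redp (nsm k e) (p ^ k) = redp e p ^ k"
  by (induction k) (simp_all only: power_0 power_Suc nsm_0 nsm_Suc redp_one redp_mult cdvd_power)

lemma cdvd_redp_prod:
  assumes "finite A" "\<And>x. x \<in> A \<Longrightarrow> cdvd (e x) (f x)"
  shows "cdvd (\<Sum>x\<in>A. e x) (\<Prod>x\<in>A. f x) \<and> redp (\<Sum>x\<in>A. e x) (\<Prod>x\<in>A. f x) = (\<Prod>x\<in>A. redp (e x) (f x))"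
  using assms
proof (induction A)
  case empty
  show ?case by (simp only: sum.empty prod.empty cdvd_one redp_one)
next
  case (insert x A)
  have x: "cdvd (e x) (f x)" using insert.prems by simp
  have IH: "cdvd (sum e A) (prod f A)" "redp (sum e A) (prod f A) = (\<Prod>x\<in>A. redp (e x) (f x))"
    using insert.IH insert.prems by auto
  show ?case
    unfolding sum.insert[OF insert.hyps] prod.insert[OF insert.hyps] redp_mult[OF x IH(1)] IH(2)
    by (intro conjI refl cdvd_mult[OF x IH(1)])
qed

lemma cdvd_const: "mdvd e s \<Longrightarrow> cdvd e [:s:]"
  by (simp add: cdvd_def coeff_pCons split: nat.splits)

lemma redp_const: "redp e [:s:] = [:cf s e:]"
  by (rule poly_eqI) (simp add: coeff_pCons split: nat.splits)

lemma cf_xmonom_apply: "0 \<le> h \<Longrightarrow> cf (xmonom h) a = (if a = h then 1 else 0)"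
  by (simp add: cf_xmonom ser_monom_def)

lemma mdvd_xmonom: "0 \<le> h \<Longrightarrow> e \<le> h \<Longrightarrow> mdvd e (xmonom h)"
  by (auto simp: mdvd_def cf_xmonom_apply split: if_splits)

lemma cdvd_linear: "mdvd e s \<Longrightarrow> 0 \<le> h \<Longrightarrow> e \<le> h \<Longrightarrow> cdvd e [:s, xmonom h:]"
  by (auto simp: cdvd_def coeff_pCons mdvd_xmonom split: nat.splits)

lemma redp_linear: "0 \<le> h \<Longrightarrow> redp e [:s, xmonom h:] = [:cf s e, if e = h then 1 else 0:]"
  by (rule poly_eqI) (auto simp: coeff_pCons cf_xmonom_apply split: nat.splits)

lemma ex_monomial_quotient:
  assumes E: "0 \<le> E" and s: "mdvd E s"
  shows "\<exists>t. \<forall>a. cf t a = cf s (a + E)"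
proof -
  obtain m where m: "frac_supp m (cf s)" by (rule frac_supp_cf)
  obtain m' where m': "0 < m'" "\<forall>i. of_nat m' * E i \<in> \<int>" using ex_common_denominator by blast
  have "frac_supp (m * m') (\<lambda>a. cf s (a + E))"
    unfolding frac_supp_def
  proof (intro conjI allI impI)
    show "0 < m * m'" using m m' by (simp add: frac_supp_def)
    fix a i assume a: "cf s (a + E) \<noteq> 0"
    then have "E \<le> a + E" using s by (auto simp: mdvd_def)
    then show "0 \<le> a i" by (auto simp: le_fun_def)
    have "of_nat m * (a + E) i \<in> \<int>" using frac_supp_grid(2)[OF m a] .
    then have "of_nat m' * (of_nat m * (a + E) i) \<in> \<int>" by (rule Ints_mult[OF Ints_of_nat])
    moreover have "of_nat m * (of_nat m' * E i) \<in> \<int>" using m'(2) by (intro Ints_mult[of "of_nat m"] Ints_of_nat) blast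
    ultimately have "of_nat m' * (of_nat m * (a + E) i) - of_nat m * (of_nat m' * E i) \<in> \<int>" by (rule Ints_diff)
    then show "of_nat (m * m') * a i \<in> \<int>" by (simp add: algebra_simps)
  qed
  then have "is_fser (\<lambda>a. cf s (a + E))" by (rule is_fserI)
  then show ?thesis by (intro exI[of _ "Fser (\<lambda>a. cf s (a + E))"]) (simp add: Fser_inverse)
qed

lemma cdvd_factor:
  fixes q :: "('n::finite, 'a::field) fser poly"
  assumes E: "0 \<le> E" and q: "cdvd E q"
  shows "\<exists>G. q = Polynomial.smult (xmonom E) G \<and> (\<forall>i a. cf (coeff G i) a = cf (coeff q i) (a + E))"
proof -
  have "\<forall>i. \<exists>t. \<forall>a. cf t a = cf (coeff q i) (a + E)"
    using ex_monomial_quotient[OF E] q by (auto simp: cdvd_def)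
  then obtain c where c: "\<And>i a. cf (c i) a = cf (coeff q i) (a + E)" by metis
  have "c i = 0" if "degree q < i" for i by (rule fser_eqI) (simp add: c coeff_eq_0 that)
  then have co: "coeff (Abs_poly c) = c" by (rule coeff_Abs_poly)
  have "q = Polynomial.smult (xmonom E) (Abs_poly c)"
  proof (rule poly_eqI, rule fser_eqI)
    fix i a
    show "cf (coeff q i) a = cf (coeff (Polynomial.smult (xmonom E) (Abs_poly c)) i) a"
      using cf_mult_xmonom[OF E, of "c i" a] by (simp add: co c mult.commute)
  qed
  then show ?thesis using co c by (intro exI[of _ "Abs_poly c"]) simp
qed

lemma pcompose_power: "pcompose (p ^ k) q = pcompose p q ^ (k::nat)"
  for p q :: "'a::comm_ring_1 poly"
  by (induction k) (simp_all add: pcompose_mult pcompose_1)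

lemma monic_degree_0: "lead_coeff (g :: 'a::comm_ring_1 poly) = 1 \<Longrightarrow> degree g = 0 \<Longrightarrow> g = 1"
  by (metis degree_eq_zeroE lead_coeff_pCons(2) one_pCons)

section \<open>Polynomials of small degree at the branch\<close>

context branch
begin

lemma P_facts:
  assumes "i < s"
  shows "ipoly (P i)" "lead_coeff (P i) = 1" "0 < degree (P i)" "degree (P i) = N i"
  using assms ipoly_P[of i] lead_coeff_P[of i] degree_P[of i] N_pos[of i] by auto

text \<open>The induction hypothesis of lemma \<open>level\<close> as a predicate: the comparison of
  terms at stage i needs it for the digits before it is established at the next stage.\<close>

definition level :: "nat \<Rightarrow> bool" where
  "level i \<longleftrightarrow> (\<forall>g xs. ipoly g \<longrightarrow> g \<noteq> 0 \<longrightarrow> degree g < N i \<longrightarrow> set xs = UNIV \<longrightarrow>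
     poly g \<alpha> \<noteq> 0 \<and> lm xs (poly g \<alpha>) \<in> M i)"

abbreviation term_at :: "nat \<Rightarrow> ('n, 'a) fser poly \<Rightarrow> nat \<Rightarrow> ('n, 'a) fser" where
  "term_at i c a \<equiv> poly c \<alpha> * poly (P i) \<alpha> ^ a"

lemma term_lm:
  assumes l: "level i" and i: "i < s" and c: "ipoly c" "degree c < N i" "c \<noteq> 0" and xs: "set xs = UNIV"
  shows "term_at i c a \<noteq> 0" "lm xs (term_at i c a) = lm xs (poly c \<alpha>) + nsm a (bb i)" "lm xs (poly c \<alpha>) \<in> M i"
proof -
  have c: "poly c \<alpha> \<noteq> 0" "lm xs (poly c \<alpha>) \<in> M i" using l c xs by (auto simp: level_def)
  have P: "lead (nsm a (bb i)) (poly (P i) \<alpha> ^ a)" using lead_power[OF lead_P[OF i]] .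
  show "term_at i c a \<noteq> 0" using c lead_nz[OF P] by simp
  show "lm xs (term_at i c a) = lm xs (poly c \<alpha>) + nsm a (bb i)"
    using lm_mult[OF xs c(1) lead_nz[OF P]] lm_lead[OF xs P] by simp
  show "lm xs (poly c \<alpha>) \<in> M i" by (rule c)
qed

text \<open>The digits have their exponents in \<open>M i\<close>, so equality would put b - a times
  \<open>bb i\<close> into \<open>M i\<close>, although b - a is less than \<open>n i\<close> in
  absolute value.\<close>

lemma term_distinct:
  assumes l: "level i" and i: "i < s" and xs: "set xs = UNIV"
    and c: "\<And>a. a < m \<Longrightarrow> ipoly (c a) \<and> degree (c a) < N i" and m: "m \<le> n i"
    and ab: "a < m" "b < m" "term_at i (c a) a \<noteq> 0" "term_at i (c b) b \<noteq> 0"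
    and eq: "lm xs (term_at i (c a) a) = lm xs (term_at i (c b) b)"
  shows "a = b"
proof -
  have *: "a = b" if ab: "a < m" "b < m" "term_at i (c a) a \<noteq> 0" "term_at i (c b) b \<noteq> 0"
      "lm xs (term_at i (c a) a) = lm xs (term_at i (c b) b)" "a \<le> b" for a b
  proof -
    have nz: "c a \<noteq> 0" "c b \<noteq> 0" using ab by auto
    have e: "lm xs (poly (c a) \<alpha>) + nsm a (bb i) = lm xs (poly (c b) \<alpha>) + nsm b (bb i)"
      and mem: "lm xs (poly (c a) \<alpha>) \<in> M i" "lm xs (poly (c b) \<alpha>) \<in> M i"
      using term_lm(2)[OF l i _ _ nz(1) xs, of a] term_lm(2)[OF l i _ _ nz(2) xs, of b]
        term_lm(3)[OF l i _ _ nz(1) xs] term_lm(3)[OF l i _ _ nz(2) xs] ab(5) c[OF ab(1)] c[OF ab(2)] by auto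
    have "nsm b (bb i) = nsm a (bb i) + nsm (b - a) (bb i)"
      using ab(6) by (simp add: fun_eq_iff of_nat_diff algebra_simps)
    then have "nsm (b - a) (bb i) = lm xs (poly (c a) \<alpha>) - lm xs (poly (c b) \<alpha>)"
      using e by (simp add: algebra_simps)
    then have "nsm (b - a) (bb i) \<in> M i" using latticeD(2)[OF lattice_char_lat mem] by simp
    then have "n i dvd b - a" by (simp add: nsm_bb_mem)
    moreover have "b - a < n i" using ab(2) m by simp
    ultimately have "b - a = 0" using dvd_imp_le[of "n i" "b - a"] by linarith
    then show "a = b" using ab(6) by simp
  qed
  show ?thesis using *[OF ab eq] *[OF ab(2,1,4,3) eq[symmetric]] by linarith
qed

lemma poly_expansion:
  "poly (\<Sum>a<m. c a * P i ^ a) \<alpha> = (\<Sum>a<m. term_at i (c a) a)"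
  by (simp add: poly_sum)

lemma
  assumes l: "level i" and i: "i < s"
    and c: "\<And>a. a < m \<Longrightarrow> ipoly (c a) \<and> degree (c a) < N i" and m: "m \<le> n i" and a: "a < m"
  shows mdvd_term: "mdvd e (\<Sum>a<m. term_at i (c a) a) \<Longrightarrow> mdvd e (term_at i (c a) a)"
    and sdvd_term: "sdvd e (\<Sum>a<m. term_at i (c a) a) \<Longrightarrow> sdvd e (term_at i (c a) a)"
proof -
  have dist: "x = y" if "set xs = UNIV" "x \<in> {..<m}" "y \<in> {..<m}" "term_at i (c x) x \<noteq> 0" "term_at i (c y) y \<noteq> 0"
    "lm xs (term_at i (c x) x) = lm xs (term_at i (c y) y)" for xs x y
    using term_distinct[OF l i that(1) c m _ _ that(4,5,6)] that(2,3) by blast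
  show "mdvd e (\<Sum>a<m. term_at i (c a) a) \<Longrightarrow> mdvd e (term_at i (c a) a)"
    by (rule mdvd_sum_distinct[of "{..<m}" a "\<lambda>a. term_at i (c a) a"]) (use a dist in blast)+
  show "sdvd e (\<Sum>a<m. term_at i (c a) a) \<Longrightarrow> sdvd e (term_at i (c a) a)"
    by (rule sdvd_sum_distinct[of "{..<m}" a "\<lambda>a. term_at i (c a) a"]) (use a dist in blast)+
qed

text \<open>Without cancellation the least exponent of g(\<alpha>) is that of one term: an element
  of \<open>M i\<close> plus a multiple of \<open>bb i\<close>, hence a member of
  \<open>M (Suc i)\<close>.\<close>

lemma level: "i \<le> s \<Longrightarrow> level i"
proof (induction i)
  case 0
  show ?case unfolding level_def
  proof (intro allI impI)
    fix g :: "('n, 'a) fser poly" and xs :: "'n list" assume g: "ipoly g" "g \<noteq> 0" "degree g < N 0" and xs: "set xs = UNIV"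
    obtain c where c: "g = [:c:]" using g(3) by (auto elim: degree_eq_zeroE)
    have "c \<noteq> 0" "iser c" using g c by (auto simp: ipoly_def coeff_pCons split: nat.splits)
    then show "poly g \<alpha> \<noteq> 0 \<and> lm xs (poly g \<alpha>) \<in> M 0"
      using cf_lm[OF xs, of c] by (simp add: c iser_def char_lat_0)
  qed
next
  case (Suc i)
  then have l: "level i" and i: "i < s" by auto
  show ?case unfolding level_def
  proof (intro allI impI)
    fix g :: "('n, 'a) fser poly" and xs :: "'n list" assume g: "ipoly g" "g \<noteq> 0" "degree g < N (Suc i)" and xs: "set xs = UNIV"
    note P = P_facts[OF i]
    have "degree g < degree (P i) * n i" using g(3) P(4) by (simp add: N_Suc)
    then obtain c where c: "\<And>a. ipoly (c a) \<and> degree (c a) < N i" "g = (\<Sum>a<n i. c a * P i ^ a)"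
      using adic_expansion[OF P(1,2,3) g(1)] P(4) by metis
    obtain z where z: "z < n i" "c z \<noteq> 0"
    proof (rule ccontr)
      assume "\<not> thesis"
      then have "\<forall>z<n i. c z = 0" using that by blast
      then have "g = 0" unfolding c(2) by (intro sum.neutral) auto
      then show False using g(2) by simp
    qed
    have nz: "term_at i (c z) z \<noteq> 0" using term_lm(1)[OF l i _ _ z(2) xs] c(1) by blast
    have dist: "x = y" if "x \<in> {..<n i}" "y \<in> {..<n i}" "term_at i (c x) x \<noteq> 0" "term_at i (c y) y \<noteq> 0"
      "lm xs (term_at i (c x) x) = lm xs (term_at i (c y) y)" for x y
      using term_distinct[OF l i xs c(1) order_refl _ _ that(3,4,5)] that(1,2) by blast
    have "z \<in> {..<n i}" using z by simp
    note S = lm_sum_distinct(1,2)[of xs "{..<n i}" z "\<lambda>a. term_at i (c a) a", OF xs finite_lessThan this nz]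
    have S: "(\<Sum>a<n i. term_at i (c a) a) \<noteq> 0"
      "\<exists>x\<in>{..<n i}. term_at i (c x) x \<noteq> 0 \<and> lm xs (\<Sum>a<n i. term_at i (c a) a) = lm xs (term_at i (c x) x)"
      by (rule S, use dist in blast)+
    then obtain x where x: "term_at i (c x) x \<noteq> 0" "lm xs (\<Sum>a<n i. term_at i (c a) a) = lm xs (term_at i (c x) x)"
      by blast
    then have "c x \<noteq> 0" by auto
    then have "lm xs (term_at i (c x) x) = lm xs (poly (c x) \<alpha>) + nsm x (bb i)" "lm xs (poly (c x) \<alpha>) \<in> M i"
      using term_lm(2)[OF l i _ _ _ xs, of "c x" x] term_lm(3)[OF l i _ _ _ xs, of "c x"] c(1) by blast+
    moreover have "M i \<subseteq> M (Suc i)" by (rule char_lat_mono) simp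
    ultimately have "lm xs (term_at i (c x) x) \<in> M (Suc i)"
      using latticeD(5,6)[OF lattice_char_lat] bb_mem by (metis subsetD)
    then show "poly g \<alpha> \<noteq> 0 \<and> lm xs (poly g \<alpha>) \<in> M (Suc i)"
      using S(1) x(2) unfolding c(2) poly_expansion by simp
  qed
qed

text \<open>The monic top digit is stored among the other digits so that the whole sum has the form
  required by \<open>mdvd_term\<close>.\<close>

lemma monic_expansion:
  assumes i: "i < s" and g: "ipoly g" "lead_coeff g = 1"
  obtains u c where "ipoly u" "lead_coeff u = 1" "degree u = degree g mod N i"
    "\<And>a. ipoly (c a) \<and> degree (c a) < N i" "c (degree g div N i) = u"
    "g = (\<Sum>a<Suc (degree g div N i). c a * P i ^ a)"
proof -
  note P = P_facts[OF i]
  let ?b = "degree g div N i"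
  obtain u c where u: "ipoly u" "lead_coeff u = 1" "degree u = degree g mod N i"
    and c: "\<And>a. ipoly (c a) \<and> degree (c a) < N i" and geq: "g = (\<Sum>a<?b. c a * P i ^ a) + u * P i ^ ?b"
    using monic_adic_expansion[OF P(1,2,3) g] unfolding P(4) by blast
  have "degree u < N i" using u(3) N_pos by simp
  then have "ipoly ((c(?b := u)) a) \<and> degree ((c(?b := u)) a) < N i" for a using u c by simp
  moreover have "g = (\<Sum>a<Suc ?b. (c(?b := u)) a * P i ^ a)" using geq by simp
  ultimately show ?thesis using that[of u "c(?b := u)"] u by simp
qed

text \<open>Q is an exponent per unit of degree. Only the top term is used: its factor
  \<open>P i ^ b\<close> costs b N_i degrees and contributes b times \<open>bb i\<close>, at most b
  N_i Q, and its digit u is monic and is handled one level lower.\<close>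

lemma monic_bound:
  assumes "i \<le> s" "ipoly g" "lead_coeff g = 1" "degree g < N i" "mdvd e (poly g \<alpha>)"
    and Q: "\<And>l. l < i \<Longrightarrow> bb l \<le> nsm (N l) Q"
  shows "e \<le> nsm (degree g) Q"
  using assms
proof (induction i arbitrary: g e)
  case 0
  then have "g = 1" by (intro monic_degree_0) auto
  then have "mdvd e (1 :: ('n, 'a) fser)" using 0 by simp
  then have "e \<le> 0" by (auto simp: mdvd_def cf_one split: if_splits)
  then have "e \<le> nsm (degree g) Q" using \<open>g = 1\<close> by simp
  then show ?case .
next
  case (Suc i)
  then have i: "i < s" by simp
  define b where "b = degree g div N i"
  obtain u c where u: "ipoly u" "lead_coeff u = 1" "degree u = degree g mod N i"
    and c: "\<And>a. ipoly (c a) \<and> degree (c a) < N i" "c (degree g div N i) = u"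
      "g = (\<Sum>a<Suc (degree g div N i). c a * P i ^ a)"
    by (rule monic_expansion[OF i Suc.prems(2,3)]) (rule that)
  note c = c(1) c(2,3)[folded b_def]
  have b: "b < n i" using Suc.prems(4) N_pos[of i] by (simp add: b_def N_Suc less_mult_imp_div_less mult.commute)
  have "poly g \<alpha> = (\<Sum>a<Suc b. term_at i (c a) a)"
    by (rule trans[OF arg_cong[OF c(3), of "\<lambda>q. poly q \<alpha>"]]) (rule poly_expansion)
  then have "mdvd e (\<Sum>a<Suc b. term_at i (c a) a)" using Suc.prems(5) by (simp only:)
  then have "mdvd e (term_at i (c b) b)"
    using mdvd_term[OF level i c(1), of "Suc b" b] i b by simp
  then have "mdvd ((e - nsm b (bb i)) + nsm b (bb i)) (poly u \<alpha> * poly (P i) \<alpha> ^ b)" using c(2) by simp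
  then have md: "mdvd (e - nsm b (bb i)) (poly u \<alpha>)" by (rule mdvd_cancel[OF lead_power[OF lead_P[OF i]]])
  have du: "degree u < N i" using u(3) N_pos by simp
  have "e - nsm b (bb i) \<le> nsm (degree u) Q"
    by (rule Suc.IH[OF less_imp_le[OF i] u(1,2) du md]) (use Suc.prems(6) in simp)
  moreover have "bb i \<le> nsm (N i) Q" by (rule Suc.prems(6)) simp
  moreover have "degree g = b * N i + degree u" unfolding u(3) b_def by (rule div_mult_mod_eq[symmetric])
  ultimately have "e j \<le> nsm (degree g) Q j" for j
  proof -
    assume a: "e - nsm b (bb i) \<le> nsm (degree u) Q" "bb i \<le> nsm (N i) Q" "degree g = b * N i + degree u"
    have "e j \<le> of_nat b * bb i j + of_nat (degree u) * Q j"
      using le_funD[OF a(1), of j] by (simp add: algebra_simps)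
    also have "\<dots> \<le> of_nat b * (of_nat (N i) * Q j) + of_nat (degree u) * Q j"
      using le_funD[OF a(2), of j] by (intro add_right_mono mult_left_mono) auto
    also have "\<dots> = nsm (degree g) Q j" by (simp add: a(3) algebra_simps)
    finally show ?thesis .
  qed
  then show ?case by (rule le_funI)
qed

text \<open>This is \<open>q_(i+1) / deg f\<close>.\<close>

definition QQ :: "nat \<Rightarrow> 'n \<Rightarrow> rat" where "QQ i = (\<lambda>j. bb i j / of_nat (N i))"

lemma nsm_N_QQ: "nsm (N i) (QQ i) = bb i"
  using N_pos[of i] by (simp add: QQ_def fun_eq_iff)

text \<open>Dividing \<open>bb_Suc\<close> by \<open>N (Suc i)\<close> shows that \<open>QQ\<close>
  grows by the positive multiple (h_(i+2) - h_(i+1)) / (n_1 ... n_(i+1)). Strictness is needed in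
  \<open>degree_approx_root\<close>.\<close>

lemma QQ_Suc:
  assumes "Suc i < s" shows "QQ i < QQ (Suc i)"
proof -
  have e: "QQ (Suc i) j = QQ i j + (H (Suc i) j - H i j) / of_nat (N (Suc i))" for j
  proof -
    have "bb (Suc i) j = of_nat (n i) * bb i j + (H (Suc i) j - H i j)"
      using fun_cong[OF bb_Suc[of i], of j] by simp
    then show ?thesis using N_pos[of i] n_pos[of i] by (simp add: QQ_def N_Suc add_divide_distrib)
  qed
  have h: "H i < H (Suc i)" using H_mono assms by simp
  then have "H i j \<le> H (Suc i) j" for j by (auto simp: less_fun_def le_fun_def)
  then have "QQ i \<le> QQ (Suc i)" unfolding le_fun_def e using N_pos[of "Suc i"] by simp
  moreover have "QQ i \<noteq> QQ (Suc i)"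
  proof
    assume "QQ i = QQ (Suc i)"
    then have "QQ i j = QQ i j + (H (Suc i) j - H i j) / of_nat (N (Suc i))" for j using e by metis
    then have "H i = H (Suc i)" using N_pos[of "Suc i"] by (simp add: fun_eq_iff)
    then show False using h by simp
  qed
  ultimately show ?thesis by simp
qed

lemma QQ_mono: "l \<le> i \<Longrightarrow> i < s \<Longrightarrow> QQ l \<le> QQ i"
proof (induction rule: dec_induct)
  case (step m)
  then show ?case using QQ_Suc[of m] by (meson Suc_lessD less_imp_le order_trans)
qed simp

lemma bb_le_QQ: "l \<le> i \<Longrightarrow> i < s \<Longrightarrow> bb l \<le> nsm (N l) (QQ i)"
  using QQ_mono[of l i] unfolding nsm_N_QQ[of l, symmetric] by (auto simp: le_fun_def intro!: mult_left_mono)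

lemma H_nonneg: "i < s \<Longrightarrow> 0 \<le> H i"
  using cf_H cf_nonneg by blast

abbreviation shift :: "('n \<Rightarrow> rat) \<Rightarrow> ('n, 'a) fser poly \<Rightarrow> ('n, 'a) fser poly" where
  "shift h g \<equiv> pcompose g [:\<alpha>, xmonom h:]"

lemma shift_linear: "shift h [:- x, 1:] = [:\<alpha> - x, xmonom h:]"
  by (simp add: pcompose_pCons)

text \<open>The contact of \<open>\<alpha>\<close> with each x other than \<open>\<beta> i\<close>
  lies strictly below h, so the term X^h Z disappears on reduction and a nonzero constant
  remains.\<close>

lemma shift_others:
  assumes i: "i \<le> s" and h: "0 \<le> h" "\<And>l. l < i \<Longrightarrow> H l < h"
  shows "cdvd (ss i) (\<Prod>x\<in>B i - {\<beta> i}. [:\<alpha> - x, xmonom h:])"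
    "\<exists>w. w \<noteq> 0 \<and> redp (ss i) (\<Prod>x\<in>B i - {\<beta> i}. [:\<alpha> - x, xmonom h:]) = [:w:]"
proof -
  have "\<forall>x\<in>B i - {\<beta> i}. \<exists>e. lead e (\<alpha> - x) \<and> e < h" using lead_ex[OF _ i] h(2) by meson
  from bchoice[OF this] obtain e where e: "\<And>x. x \<in> B i - {\<beta> i} \<Longrightarrow> lead (e x) (\<alpha> - x) \<and> e x < h" by blast
  have se: "(\<Sum>x\<in>B i - {\<beta> i}. e x) = ss i"
    by (rule lead_unique[OF lead_prod lead_ss[OF i]]) (use e in blast)
  have "cdvd (e x) [:\<alpha> - x, xmonom h:]" if "x \<in> B i - {\<beta> i}" for x
    using e[OF that] h by (intro cdvd_linear) (auto simp: lead_def less_imp_le)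
  note pr = cdvd_redp_prod[of "B i - {\<beta> i}" e "\<lambda>x. [:\<alpha> - x, xmonom h:]", OF _ this, unfolded se]
  have fin: "finite (B i - {\<beta> i})" using finite_B[OF i] by simp
  show "cdvd (ss i) (\<Prod>x\<in>B i - {\<beta> i}. [:\<alpha> - x, xmonom h:])" using pr[OF fin] by blast
  have "redp (e x) [:\<alpha> - x, xmonom h:] = [:cf (\<alpha> - x) (e x):]" if "x \<in> B i - {\<beta> i}" for x
    using e[OF that] h(1) by (auto simp: redp_linear simp del: cf_diff)
  then have "redp (ss i) (\<Prod>x\<in>B i - {\<beta> i}. [:\<alpha> - x, xmonom h:]) = (\<Prod>x\<in>B i - {\<beta> i}. [:cf (\<alpha> - x) (e x):])"
    using pr[OF fin] by simp
  also have "\<dots> = [:\<Prod>x\<in>B i - {\<beta> i}. cf (\<alpha> - x) (e x):]"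
    using fin by (induction rule: finite_induct) (simp_all add: one_pCons)
  moreover have "(\<Prod>x\<in>B i - {\<beta> i}. cf (\<alpha> - x) (e x)) \<noteq> 0"
    using e by (subst prod_zero_iff[OF fin]) (auto simp: lead_def simp del: cf_diff)
  ultimately show "\<exists>w. w \<noteq> 0 \<and> redp (ss i) (\<Prod>x\<in>B i - {\<beta> i}. [:\<alpha> - x, xmonom h:]) = [:w:]" by metis
qed

text \<open>Only the factor that belongs to \<open>\<beta> i\<close> can keep Z on reduction, and it
  does so exactly when h equals its contact \<open>H i\<close>.\<close>

lemma shift_P:
  assumes i: "i < s" and h: "H i \<le> h"
  shows "cdvd (bb i) (shift h (P i))"
    "\<exists>w c. w \<noteq> 0 \<and> c \<noteq> 0 \<and> redp (bb i) (shift h (P i)) = [:c, if H i = h then 1 else 0:] * [:w:]"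
proof -
  have h0: "0 \<le> h" using H_nonneg[OF i] h by (rule order_trans)
  have hl: "H l < h" if "l < i" for l using H_mono[OF that i] h by (rule order.strict_trans2)
  note O = shift_others[OF less_imp_le[OF i] h0 hl]
  have eq: "shift h (P i) = (\<Prod>x\<in>B i - {\<beta> i}. [:\<alpha> - x, xmonom h:]) * [:\<alpha> - \<beta> i, xmonom h:]"
    using prod.remove[OF finite_B[OF less_imp_le[OF i]] \<beta>_in_B, of "\<lambda>x. [:\<alpha> - x, xmonom h:]"]
    by (simp add: P_def pcompose_prod shift_linear mult.commute)
  have L: "cdvd (H i) [:\<alpha> - \<beta> i, xmonom h:]" using lead_\<alpha>_\<beta>[OF i] h0 h by (intro cdvd_linear) (auto simp: lead_def)
  show "cdvd (bb i) (shift h (P i))" unfolding eq bb_def by (rule cdvd_mult[OF O(1) L])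
  obtain w where w: "w \<noteq> 0" "redp (ss i) (\<Prod>x\<in>B i - {\<beta> i}. [:\<alpha> - x, xmonom h:]) = [:w:]" using O(2) by blast
  have "redp (bb i) (shift h (P i)) = [:cf (\<alpha> - \<beta> i) (H i), if H i = h then 1 else 0:] * [:w:]"
  proof -
    have "redp (ss i + H i) ((\<Prod>x\<in>B i - {\<beta> i}. [:\<alpha> - x, xmonom h:]) * [:\<alpha> - \<beta> i, xmonom h:])
        = [:w:] * redp (H i) [:\<alpha> - \<beta> i, xmonom h:]"
      using redp_mult[OF O(1) L] w(2) by (rule trans[OF _ arg_cong[of _ _ "\<lambda>r. r * _"]])
    then show ?thesis unfolding eq bb_def redp_linear[OF h0] by (simp only: mult.commute)
  qed
  moreover have "cf (\<alpha> - \<beta> i) (H i) \<noteq> 0" using lead_\<alpha>_\<beta>[OF i] by (simp add: lead_def)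
  ultimately show "\<exists>w c. w \<noteq> 0 \<and> c \<noteq> 0 \<and> redp (bb i) (shift h (P i)) = [:c, if H i = h then 1 else 0:] * [:w:]"
    using w(1) by blast
qed

text \<open>Digits and powers of \<open>P l\<close> at levels below i reduce to constants, because h
  exceeds all \<open>H l\<close> with \<open>l < i\<close>. Divisibility of each single term
  (\<open>mdvd_term\<close>) allows every digit to be reduced at its own exponent.\<close>

lemma shift_const:
  assumes "i \<le> s" "ipoly g" "degree g < N i" "\<And>l. l < i \<Longrightarrow> H l < h" "mdvd e (poly g \<alpha>)"
  shows "cdvd e (shift h g) \<and> redp e (shift h g) = [:cf (poly g \<alpha>) e:]"
  using assms
proof (induction i arbitrary: g e)
  case 0
  then obtain c where c: "g = [:c:]" by (auto elim: degree_eq_zeroE)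
  then have "cdvd e (shift h g) \<and> redp e (shift h g) = [:cf (poly g \<alpha>) e:]"
    using 0 by (simp add: cdvd_const redp_const)
  then show ?case .
next
  case (Suc i)
  then have i: "i < s" by simp
  note P = P_facts[OF i]
  have "degree g < degree (P i) * n i" using Suc.prems(3) P(4) by (simp add: N_Suc)
  then obtain c where c: "\<And>a. ipoly (c a) \<and> degree (c a) < N i" "g = (\<Sum>a<n i. c a * P i ^ a)"
    using adic_expansion[OF P(1,2,3) Suc.prems(2)] P(4) by metis
  have Hh: "H i < h" using Suc.prems(4) by simp
  obtain v where v: "redp (bb i) (shift h (P i)) = [:v:]"
    using shift_P(2)[OF i less_imp_le[OF Hh]] Hh by auto
  have cP: "cdvd (nsm a (bb i)) (shift h (P i) ^ a)" for a
    by (rule cdvd_power[OF shift_P(1)[OF i less_imp_le[OF Hh]]])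
  have t: "cdvd e (shift h (c a * P i ^ a)) \<and> (\<exists>r. redp e (shift h (c a * P i ^ a)) = [:r:])" if a: "a < n i" for a
  proof -
    have "mdvd e (\<Sum>a<n i. term_at i (c a) a)" using Suc.prems(5) c(2) poly_expansion by metis
    then have "mdvd e (term_at i (c a) a)" using mdvd_term[OF level i c(1) order_refl a] i by simp
    then have "mdvd ((e - nsm a (bb i)) + nsm a (bb i)) (term_at i (c a) a)" by simp
    then have "mdvd (e - nsm a (bb i)) (poly (c a) \<alpha>)" using mdvd_cancel[OF lead_power[OF lead_P[OF i]]] by blast
    then have "cdvd (e - nsm a (bb i)) (shift h (c a)) \<and>
        redp (e - nsm a (bb i)) (shift h (c a)) = [:cf (poly (c a) \<alpha>) (e - nsm a (bb i)):]"
      by (rule Suc.IH[OF less_imp_le[OF i] conjunct1[OF c(1)] conjunct2[OF c(1)], rotated])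
        (use Suc.prems(4) in simp)
    then have IH: "cdvd (e - nsm a (bb i)) (shift h (c a))"
      "redp (e - nsm a (bb i)) (shift h (c a)) = [:cf (poly (c a) \<alpha>) (e - nsm a (bb i)):]"
      by blast+
    have "cdvd ((e - nsm a (bb i)) + nsm a (bb i)) (shift h (c a * P i ^ a))"
      unfolding pcompose_mult pcompose_power by (rule cdvd_mult[OF IH(1) cP])
    moreover have "redp ((e - nsm a (bb i)) + nsm a (bb i)) (shift h (c a * P i ^ a)) =
        [:cf (poly (c a) \<alpha>) (e - nsm a (bb i)):] * [:v:] ^ a"
      unfolding pcompose_mult pcompose_power redp_mult[OF IH(1) cP] IH(2)
        redp_power[OF shift_P(1)[OF i less_imp_le[OF Hh]]] v ..
    moreover have "[:v:] ^ a = [:v ^ a:]" by (rule poly_const_pow)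
    ultimately show ?thesis by simp
  qed
  have sg: "shift h g = (\<Sum>a<n i. shift h (c a * P i ^ a))" unfolding c(2) by (rule pcompose_sum)
  have 1: "cdvd e (shift h g)" unfolding sg using t by (intro cdvd_sum) auto
  have "coeff (redp e (shift h g)) l = 0" if "0 < l" for l
  proof -
    have "coeff (redp e (shift h (c a * P i ^ a))) l = 0" if "a < n i" for a
      using t[OF that] \<open>0 < l\<close> by (auto simp: coeff_pCons split: nat.splits simp del: coeff_redp)
    then show ?thesis unfolding sg redp_sum coeff_sum by (intro sum.neutral) (auto simp del: coeff_redp)
  qed
  then have "redp e (shift h g) = [:coeff (redp e (shift h g)) 0:]"
    by (intro poly_eqI) (auto simp: coeff_pCons split: nat.splits simp del: coeff_redp)
  \<comment> \<open>A constant reduction is identified by its value at Z = 0, where the shifted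
    polynomial takes the value g(\<alpha>).\<close>
  moreover have "coeff (shift h g) 0 = poly g \<alpha>" by (simp add: poly_0_coeff_0[symmetric] poly_pcompose)
  ultimately have "redp e (shift h g) = [:cf (poly g \<alpha>) e:]" by simp
  then show ?case using 1 by blast
qed

end

section \<open>Approximate roots\<close>

lemma coeff_1_linear_power:
  fixes a b :: "'a::idom"
  assumes "0 < m"
  shows "coeff ([:a, b:] ^ m) 1 = of_nat m * a ^ (m - 1) * b"
proof -
  obtain k where k: "m = Suc k" using assms gr0_conv_Suc by blast
  have "coeff ([:a, b:] ^ m) 1 = coeff (pderiv ([:a, b:] ^ m)) 0" by (simp add: coeff_pderiv)
  also have "\<dots> = of_nat m * a ^ (m - 1) * b"
    unfolding k pderiv_power_Suc by (simp add: coeff_mult_0 coeff_0_power pderiv_pCons)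
  finally show ?thesis .
qed

lemma prod_linear_dvd:
  fixes p :: "'a::idom poly"
  assumes "finite A" "\<And>x. x \<in> A \<Longrightarrow> poly p x = 0"
  shows "(\<Prod>x\<in>A. [:- x, 1:]) dvd p"
  using assms
proof (induction A)
  case (insert x A)
  then obtain q where q: "p = (\<Prod>x\<in>A. [:- x, 1:]) * q" by auto
  have "(\<Prod>y\<in>A. x - y) * poly q x = 0"
    using insert.prems[of x] by (simp add: q poly_prod_linear)
  moreover have "(\<Prod>y\<in>A. x - y) \<noteq> 0" using insert.hyps by (auto simp: prod_zero_iff)
  ultimately have "[:- x, 1:] dvd q" by (simp add: poly_eq_0_iff_dvd)
  then have "[:- x, 1:] * (\<Prod>x\<in>A. [:- x, 1:]) dvd q * (\<Prod>x\<in>A. [:- x, 1:])" by (rule mult_dvd_mono) simp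
  then show ?case using insert.hyps by (simp add: q mult.commute)
qed simp

lemma monic_eq_prod_linear:
  fixes p :: "'a::idom poly"
  assumes A: "finite A" "\<And>x. x \<in> A \<Longrightarrow> poly p x = 0" and p: "lead_coeff p = 1" "degree p = card A"
  shows "p = (\<Prod>x\<in>A. [:- x, 1:])"
proof -
  define P where "P = (\<Prod>x\<in>A. [:- x, 1:])"
  have P: "lead_coeff P = 1" "degree P = card A"
    unfolding P_def by (rule lead_coeff_prod_linear degree_prod_linear)+
  obtain q where q: "p = P * q" using prod_linear_dvd[OF A] by (auto simp: P_def)
  have lq: "lead_coeff q = 1" using p(1) P(1) unfolding q by (simp add: lead_coeff_mult)
  then have "q \<noteq> 0" by auto
  moreover have "P \<noteq> 0" using P(1) by auto
  ultimately have "degree q = 0" using p(2) P(2) unfolding q by (simp add: degree_mult_eq)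
  then have "q = 1" using lq by (intro monic_degree_0)
  then show ?thesis by (simp add: q P_def)
qed

lemma poly_pderiv_prod_linear:
  assumes "finite A" "x \<in> A"
  shows "poly (pderiv (\<Prod>y\<in>A. [:- y, 1 :: 'a::idom:])) x = (\<Prod>y\<in>A - {x}. x - y)"
proof -
  have eq: "(\<Prod>y\<in>A. [:- y, 1:]) = [:- x, 1:] * (\<Prod>y\<in>A - {x}. [:- y, 1:])"
    by (rule prod.remove[OF assms])
  show ?thesis unfolding eq pderiv_mult by (simp add: pderiv_pCons poly_prod_linear)
qed

text \<open>Moves the difference of two arbitrary conjugates to a difference that involves x
  itself.\<close>

lemma act_quot: "\<chi> \<in> chars \<Longrightarrow> \<psi> \<in> chars \<Longrightarrow>
  act \<chi> x - act \<psi> x = act \<chi> (x - act (\<lambda>a. inverse (\<chi> a) * \<psi> a) x)"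
  by (rule fser_eqI) (simp add: right_diff_distrib mult.assoc[symmetric])

lemma quot_chars: "\<chi> \<in> chars \<Longrightarrow> \<psi> \<in> chars \<Longrightarrow> (\<lambda>a. inverse (\<chi> a) * \<psi> a) \<in> chars"
  by (rule chars_mult[OF chars_inverse])

context branch
begin

text \<open>If the degree were too small, the top term u P_i^b would satisfy the divisibility alone.
  For constant u this contradicts strictness, otherwise it contradicts the growth of
  \<open>QQ\<close>. With the right degree, strictness makes Z = 0 a root of the reduction, and
  Hensel's lemma applies.\<close>

lemma
  assumes i: "i < s" and g: "ipoly g" "lead_coeff g = 1" "degree g \<le> N (Suc i)"
    and sd: "sdvd (nsm (degree g) (QQ i)) (poly g \<alpha>)"
  shows degree_approx_root: "degree g = N (Suc i)"
    and ex_approx_root: "\<exists>\<gamma>. poly g \<gamma> = 0 \<and> sdvd (H i) (\<gamma> - \<alpha>)"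
proof -
  define b where "b = degree g div N i"
  define E where "E = nsm (degree g) (QQ i)"
  obtain u c where u: "ipoly u" "lead_coeff u = 1" "degree u = degree g mod N i"
    and c: "\<And>a. ipoly (c a) \<and> degree (c a) < N i" "c (degree g div N i) = u"
      "g = (\<Sum>a<Suc (degree g div N i). c a * P i ^ a)"
    by (rule monic_expansion[OF i g(1,2)]) (rule that)
  note c = c(1) c(2,3)[folded b_def]
  have deg: "degree g = b * N i + degree u" unfolding u(3) b_def by (rule div_mult_mod_eq[symmetric])
  \<comment> \<open>Since N_i times \<open>QQ i\<close> is \<open>bb i\<close>, the exponent splits
    along \<open>degree g = b * N i + degree u\<close> into a share of the digit u and the exact
    exponent of \<open>P i ^ b\<close>.\<close>
  have E: "E = nsm (degree u) (QQ i) + nsm b (bb i)"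
    unfolding E_def nsm_N_QQ[symmetric] deg by (simp add: fun_eq_iff algebra_simps)
  have ga: "poly g \<alpha> = (\<Sum>a<Suc b. term_at i (c a) a)"
    by (rule trans[OF arg_cong[OF c(3), of "\<lambda>q. poly q \<alpha>"]]) (rule poly_expansion)
  show D: "degree g = N (Suc i)"
  proof (rule ccontr)
    assume "degree g \<noteq> N (Suc i)"
    then have "degree g < N i * n i" using g(3) by (simp add: N_Suc)
    then have b: "b < n i" by (simp add: b_def less_mult_imp_div_less mult.commute)
    have "sdvd E (\<Sum>a<Suc b. term_at i (c a) a)" using sd unfolding ga[symmetric] E_def .
    then have "sdvd E (term_at i (c b) b)"
      by (rule sdvd_term[where c = c and m = "Suc b", OF level[OF less_imp_le[OF i]] i c(1) Suc_leI[OF b] lessI])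
    then have t: "sdvd E (poly u \<alpha> * poly (P i) \<alpha> ^ b)" by (simp only: c(2))
    have lP: "lead (nsm b (bb i)) (poly (P i) \<alpha> ^ b)" by (rule lead_power[OF lead_P[OF i]])
    show False
    proof (cases "degree u = 0")
      case True
      then have "u = 1" using u(2) by (intro monic_degree_0)
      then have "sdvd (nsm b (bb i)) (poly (P i) \<alpha> ^ b)" using t True E by simp
      then show False using lP by (simp add: lead_def sdvd_iff)
    next
      case False
      have du: "degree u < N i" using u(3) N_pos by simp
      then obtain j where j: "i = Suc j" using False by (cases i) auto
      have "mdvd (nsm (degree u) (QQ i) + nsm b (bb i)) (poly u \<alpha> * poly (P i) \<alpha> ^ b)"
        using t unfolding E by (simp only: sdvd_iff)
      then have "mdvd (nsm (degree u) (QQ i)) (poly u \<alpha>)" by (rule mdvd_cancel[OF lP])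
      \<comment> \<open>As deg u < N_i, only levels below i occur in the expansion of u, and there
        the rate \<open>QQ j\<close> with j = i - 1 already suffices.\<close>
      then have "nsm (degree u) (QQ i) \<le> nsm (degree u) (QQ j)"
        using i by (intro monic_bound[OF less_imp_le[OF i] u(1,2) du]) (auto intro: bb_le_QQ simp: j)
      then have "of_nat (degree u) * QQ i t \<le> of_nat (degree u) * QQ j t" for t
        by (auto simp: le_fun_def)
      then have "QQ i \<le> QQ j" using False by (auto simp: le_fun_def)
      then show False using QQ_Suc[of j] i unfolding j by (auto simp: less_le)
    qed
  qed
  have bn: "b = n i" and du: "degree u = 0" using u(3) D N_pos[of i] by (simp_all add: b_def N_Suc)
  have u1: "u = 1" using u(2) du by (intro monic_degree_0)
  have E: "E = nsm (n i) (bb i)" using E du bn by simp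
  have g_eq: "g = (\<Sum>a<n i. c a * P i ^ a) + P i ^ n i" using c(3) c(2) u1 by (simp add: bn)
  have lP: "lead (nsm a (bb i)) (poly (P i) \<alpha> ^ a)" for a by (rule lead_power[OF lead_P[OF i]])
  have "(\<Sum>a<n i. term_at i (c a) a) = poly g \<alpha> - poly (P i) \<alpha> ^ n i"
    using ga c(2) u1 by (simp add: bn)
  then have "mdvd E (\<Sum>a<n i. term_at i (c a) a)"
    using sd[folded E_def] lP[of "n i"] by (simp only: E lead_def sdvd_iff mdvd_diff)
  then have "mdvd E (term_at i (c a) a)" if "a < n i" for a
    using mdvd_term[OF level i c(1) order_refl that] i by simp
  then have "mdvd ((E - nsm a (bb i)) + nsm a (bb i)) (term_at i (c a) a)" if "a < n i" for a
    using that by simp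
  then have md: "mdvd (E - nsm a (bb i)) (poly (c a) \<alpha>)" if "a < n i" for a
    using mdvd_cancel[OF lP] that by blast
  \<comment> \<open>A nonzero value would make the exponent E - a \<open>bb i\<close> that of the
    digit, hence an element of \<open>M i\<close>; but it equals n_i - a times \<open>bb i\<close>,
    and n_i does not divide n_i - a.\<close>
  have \<kappa>: "cf (poly (c a) \<alpha>) (E - nsm a (bb i)) = 0" if a: "0 < a" "a < n i" for a
  proof (rule ccontr)
    assume nz: "cf (poly (c a) \<alpha>) (E - nsm a (bb i)) \<noteq> 0"
    then have l: "lead (E - nsm a (bb i)) (poly (c a) \<alpha>)" using md[OF a(2)] by (simp only: lead_def simp_thms)
    obtain xs :: "'n list" where xs: "set xs = UNIV" using finite_list[OF finite] by blast
    have "c a \<noteq> 0" using lead_nz[OF l] by auto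
    then have "lm xs (poly (c a) \<alpha>) \<in> M i" using level[of i] i c(1)[of a] xs by (auto simp: level_def)
    then have "E - nsm a (bb i) \<in> M i" using lm_lead[OF xs l] by (simp only:)
    moreover have "E - nsm a (bb i) = nsm (n i - a) (bb i)"
      using a by (simp add: E fun_eq_iff of_nat_diff algebra_simps)
    ultimately have "n i dvd n i - a" using nsm_bb_mem by (simp only:)
    then show False using a by (auto dest: dvd_imp_le)
  qed
  define h where "h = H i"
  have hl: "\<And>l. l < i \<Longrightarrow> H l < h" using H_mono i by (simp add: h_def)
  have h0: "0 \<le> h" using H_nonneg[OF i] by (simp add: h_def)
  have cP: "cdvd (bb i) (shift h (P i))" using shift_P(1)[OF i] by (simp add: h_def)
  obtain w v where wv: "w \<noteq> 0" "v \<noteq> 0" "redp (bb i) (shift h (P i)) = [:v, 1:] * [:w:]"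
    using shift_P(2)[OF i, of h] by (auto simp: h_def)
  define r where "r = [:v * w, w:]"
  have r: "redp (bb i) (shift h (P i)) = r" using wv(3) by (simp add: r_def mult.commute)
  have t: "cdvd E (shift h (c a * P i ^ a))"
    "redp E (shift h (c a * P i ^ a)) = [:cf (poly (c a) \<alpha>) (E - nsm a (bb i)):] * r ^ a" if a: "a < n i" for a
  proof -
    have C: "cdvd (E - nsm a (bb i)) (shift h (c a))"
      "redp (E - nsm a (bb i)) (shift h (c a)) = [:cf (poly (c a) \<alpha>) (E - nsm a (bb i)):]"
      using shift_const[OF less_imp_le[OF i] _ _ hl md[OF a]] c(1) by blast+
    have e: "(E - nsm a (bb i)) + nsm a (bb i) = E" by simp
    show "cdvd E (shift h (c a * P i ^ a))"
      using cdvd_mult[OF C(1) cdvd_power[OF cP, of a]] unfolding pcompose_mult pcompose_power e .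
    show "redp E (shift h (c a * P i ^ a)) = [:cf (poly (c a) \<alpha>) (E - nsm a (bb i)):] * r ^ a"
      using redp_mult[OF C(1) cdvd_power[OF cP, of a]] unfolding pcompose_mult pcompose_power e C(2) redp_power[OF cP] r .
  qed
  have sg: "shift h g = (\<Sum>a<n i. shift h (c a * P i ^ a)) + shift h (P i) ^ n i"
    unfolding g_eq pcompose_add pcompose_sum pcompose_power ..
  have cE: "cdvd E (shift h (P i) ^ n i)" unfolding E by (rule cdvd_power[OF cP])
  have cg: "cdvd E (shift h g)" unfolding sg using t(1) by (intro cdvd_add cdvd_sum cE) simp
  have "redp E (shift h g) = (\<Sum>a<n i. [:cf (poly (c a) \<alpha>) (E - nsm a (bb i)):] * r ^ a) + r ^ n i"
    unfolding sg redp_add redp_sum using t(2) redp_power[OF cP, of "n i"] by (simp add: E r)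
  also have "(\<Sum>a<n i. [:cf (poly (c a) \<alpha>) (E - nsm a (bb i)):] * r ^ a)
      = (\<Sum>a\<in>{0}. [:cf (poly (c a) \<alpha>) (E - nsm a (bb i)):] * r ^ a)"
    by (rule sum.mono_neutral_right) (use n_pos[of i] \<kappa> in auto)
  \<comment> \<open>Only the digit of index 0 and the top power remain, so the reduction is a
    constant plus (w (v + Z))^n_i. Its linear coefficient is nonzero in characteristic zero.\<close>
  finally have rg: "redp E (shift h g) = [:cf (poly (c 0) \<alpha>) E:] + r ^ n i" by simp
  have "coeff (redp E (shift h g)) 1 = of_nat (n i) * (v * w) ^ (n i - 1) * w"
    unfolding rg r_def using coeff_1_linear_power[OF n_pos[of i], of "v * w" w] by (simp add: coeff_pCons)
  then have c1: "cf (coeff (shift h g) 1) E \<noteq> 0" using wv(1,2) n_pos[of i] by simp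
  have E0: "0 \<le> E" using bb_nonneg[OF i] unfolding E by (auto simp: le_fun_def)
  obtain G where G: "shift h g = Polynomial.smult (xmonom E) G"
    "\<And>j a. cf (coeff G j) a = cf (coeff (shift h g) j) (a + E)"
    using cdvd_factor[OF E0 cg] by blast
  have "coeff (shift h g) 0 = poly g \<alpha>" by (simp add: poly_0_coeff_0[symmetric] poly_pcompose)
  \<comment> \<open>Strictness of the hypothesis: the constant coefficient vanishes after division
    by X^E and reduction.\<close>
  then have "cf (coeff (shift h g) 0) E = 0" using sd by (simp add: E_def sdvd_iff)
  then have "sdvd 0 (coeff G 0)" by (simp add: sdvd_iff G(2))
  moreover have "cf (coeff G 1) 0 \<noteq> 0" using c1 by (simp add: G(2))
  ultimately obtain z where z: "sdvd 0 z" "poly G z = 0" using hensel by blast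
  have "poly (shift h g) z = 0" by (simp add: G(1) z(2))
  then have "poly g (\<alpha> + z * xmonom h) = 0" by (simp add: poly_pcompose)
  moreover have "sdvd (0 + h) (z * xmonom h)" by (rule sdvd_mult[OF z(1) mdvd_xmonom[OF h0 order_refl]])
  then have "sdvd (H i) ((\<alpha> + z * xmonom h) - \<alpha>)" by (simp add: h_def)
  ultimately show "\<exists>\<gamma>. poly g \<gamma> = 0 \<and> sdvd (H i) (\<gamma> - \<alpha>)" by blast
qed

end

text \<open>The outcome of the Hensel step. From here on \<open>\<gamma>\<close> plays for g the
  role of \<open>\<alpha>\<close> for f.\<close>

locale approx_root = branch +
  fixes i :: nat and g :: "('a, 'b) fser poly" and \<gamma> :: "('a, 'b) fser"
  assumes i: "i < length hs" and g: "ipoly g" "lead_coeff g = 1" "degree g = N (Suc i)"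
    and root: "poly g \<gamma> = 0" and close: "sdvd (hs ! i) (\<gamma> - \<alpha>)"
begin

lemma sdvd_close: "j \<le> i \<Longrightarrow> sdvd (H j) (\<gamma> - \<alpha>)"
  using H_le[OF _ i, of j] close by (auto simp: sdvd_def intro: order.strict_trans1)

text \<open>Replacing \<open>\<alpha>\<close> by \<open>\<gamma>\<close> alters these differences
  only by terms above \<open>H j\<close>, which leave the leading exponent unchanged.\<close>

lemma lead_\<gamma>:
  assumes "triv j \<chi>" "j \<le> i" "\<chi> (H j) \<noteq> 1"
  shows "lead (H j) (\<gamma> - act \<chi> \<gamma>)" "lead (H j) (\<alpha> - act \<chi> \<gamma>)"
proof -
  have \<chi>: "\<chi> \<in> chars" using assms by (simp add: triv_def)
  have l: "lead (H j) (\<alpha> - act \<chi> \<alpha>)" using assms i by (intro lead_diff_act) auto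
  have s: "sdvd (H j) (\<gamma> - \<alpha>)" "sdvd (H j) (act \<chi> (\<gamma> - \<alpha>))"
    using sdvd_close[OF assms(2)] \<chi> by auto
  have "lead (H j) ((\<alpha> - act \<chi> \<alpha>) + ((\<gamma> - \<alpha>) - act \<chi> (\<gamma> - \<alpha>)))"
    by (rule lead_add_sdvd[OF l sdvd_diff[OF s]])
  then show "lead (H j) (\<gamma> - act \<chi> \<gamma>)" by (simp add: act_diff)
  have "lead (H j) ((\<alpha> - act \<chi> \<alpha>) + (0 - act \<chi> (\<gamma> - \<alpha>)))"
    by (rule lead_add_sdvd[OF l sdvd_diff[OF sdvd_0 s(2)]])
  then show "lead (H j) (\<alpha> - act \<chi> \<gamma>)" by (simp add: act_diff)
qed

definition \<Gamma> where "\<Gamma> = {act \<chi> \<gamma> | \<chi>. \<chi> \<in> chars}"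

lemma lead_act_\<gamma>_diff:
  assumes "\<chi> \<in> chars" "\<psi> \<in> chars" "\<not> (\<forall>l<Suc i. \<chi> (H l) = \<psi> (H l))"
  shows "\<exists>j\<le>i. lead (H j) (act \<chi> \<gamma> - act \<psi> \<gamma>)"
proof -
  let ?\<theta> = "\<lambda>a. inverse (\<chi> a) * \<psi> a"
  have "\<not> triv (Suc i) ?\<theta>"
    using assms(3) chars_nz[OF assms(1)] by (auto simp: triv_def field_simps)
  then obtain j where j: "j < Suc i" "triv j ?\<theta>" "?\<theta> (H j) \<noteq> 1"
    using first_diff[OF quot_chars[OF assms(1,2)]] by blast
  then have "lead (H j) (\<gamma> - act ?\<theta> \<gamma>)" by (intro lead_\<gamma>(1)) auto
  then have "lead (H j) (act \<chi> \<gamma> - act \<psi> \<gamma>)"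
    unfolding act_quot[OF assms(1,2)] using assms(1) by (simp only: lead_act)
  then show ?thesis using j(1) by (auto simp: less_Suc_eq_le)
qed

text \<open>Chooses a character for each conjugate of \<open>\<beta> (Suc i)\<close> in order to
  transport it to a conjugate of \<open>\<gamma>\<close>. That the result does not depend on the
  choice is known only after the roots of g have been counted
  (\<open>act_\<gamma>_eq\<close>).\<close>

definition pick :: "('a, 'b) fser \<Rightarrow> ('a \<Rightarrow> rat) \<Rightarrow> 'b" where
  "pick x = (SOME \<chi>. \<chi> \<in> chars \<and> x = act \<chi> (\<beta> (Suc i)))"

lemma pick: "x \<in> B (Suc i) \<Longrightarrow> pick x \<in> chars \<and> x = act (pick x) (\<beta> (Suc i))"
proof -
  assume "x \<in> B (Suc i)"
  then have "\<exists>\<chi>. \<chi> \<in> chars \<and> x = act \<chi> (\<beta> (Suc i))" by (auto simp: B_def)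
  then show ?thesis unfolding pick_def by (rule someI_ex)
qed

abbreviation \<phi> :: "('a, 'b) fser \<Rightarrow> ('a, 'b) fser" where "\<phi> x \<equiv> act (pick x) \<gamma>"

lemma inj_\<phi>: "inj_on \<phi> (B (Suc i))"
proof (rule inj_onI)
  fix x y assume x: "x \<in> B (Suc i)" and y: "y \<in> B (Suc i)" and eq: "\<phi> x = \<phi> y"
  have "\<forall>l<Suc i. pick x (H l) = pick y (H l)"
  proof (rule ccontr)
    assume "\<not> ?thesis"
    then obtain j where "lead (H j) (\<phi> x - \<phi> y)" using lead_act_\<gamma>_diff pick x y by blast
    then show False using eq lead_nz by auto
  qed
  then have "act (pick x) (\<beta> (Suc i)) = act (pick y) (\<beta> (Suc i))"
    using act_\<beta>_eq pick x y i by (metis Suc_leI)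
  then show "x = y" using pick x y by metis
qed

lemma act_root: "\<chi> \<in> chars \<Longrightarrow> poly g (act \<chi> \<gamma>) = 0"
  using poly_act[OF g(1)] root by simp

lemma Suc_i: "Suc i \<le> length hs" using i by simp

lemma g_eq_\<phi>: "g = (\<Prod>x\<in>\<phi> ` B (Suc i). [:- x, 1:])"
  using finite_B[OF Suc_i] card_B[OF Suc_i] g act_root pick
  by (intro monic_eq_prod_linear) (auto simp: card_image[OF inj_\<phi>])

lemma \<Gamma>_eq: "\<Gamma> = \<phi> ` B (Suc i)"
proof
  show "\<phi> ` B (Suc i) \<subseteq> \<Gamma>" using pick by (auto simp: \<Gamma>_def)
  show "\<Gamma> \<subseteq> \<phi> ` B (Suc i)"
  proof
    fix x assume "x \<in> \<Gamma>"
    then have "poly g x = 0" using act_root by (auto simp: \<Gamma>_def)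
    then have "(\<Prod>y\<in>\<phi> ` B (Suc i). x - y) = 0" unfolding g_eq_\<phi> poly_prod_linear .
    then show "x \<in> \<phi> ` B (Suc i)" using finite_B[OF Suc_i] by (auto simp: prod_zero_iff)
  qed
qed

lemma finite_\<Gamma>: "finite \<Gamma>" using finite_B[OF Suc_i] by (simp add: \<Gamma>_eq)

lemma g_eq: "g = (\<Prod>x\<in>\<Gamma>. [:- x, 1:])" unfolding \<Gamma>_eq by (rule g_eq_\<phi>)

lemma roots_g: "poly g x = 0 \<longleftrightarrow> x \<in> \<Gamma>"
  unfolding g_eq poly_prod_linear using finite_\<Gamma> by (auto simp: prod_zero_iff)

lemma \<gamma>_in_\<Gamma>: "\<gamma> \<in> \<Gamma>" using root by (simp add: roots_g)

text \<open>By counting, every conjugate of \<open>\<gamma>\<close> is some \<open>\<phi> x\<close>,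
  and the contacts identify x as the conjugate of \<open>\<beta> (Suc i)\<close> under the same
  character. So a character that fixes \<open>\<beta> (Suc i)\<close> fixes
  \<open>\<gamma>\<close>.\<close>

lemma act_\<gamma>_eq:
  assumes \<chi>: "\<chi> \<in> chars" and eq: "\<forall>l<Suc i. \<chi> (H l) = 1"
  shows "act \<chi> \<gamma> = \<gamma>"
proof -
  have *: "\<phi> (act \<psi> (\<beta> (Suc i))) = act \<psi> \<gamma>" if \<psi>: "\<psi> \<in> chars" for \<psi>
  proof -
    have "act \<psi> \<gamma> \<in> \<Gamma>" using \<psi> by (auto simp: \<Gamma>_def)
    then obtain x where x: "x \<in> B (Suc i)" "act \<psi> \<gamma> = \<phi> x" by (auto simp: \<Gamma>_eq)
    have "\<forall>l<Suc i. \<psi> (H l) = pick x (H l)"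
    proof (rule ccontr)
      assume "\<not> ?thesis"
      then obtain j where "lead (H j) (act \<psi> \<gamma> - \<phi> x)" using lead_act_\<gamma>_diff pick x \<psi> by blast
      then show False using x(2) lead_nz by auto
    qed
    then have "act \<psi> (\<beta> (Suc i)) = act (pick x) (\<beta> (Suc i))"
      using act_\<beta>_eq[OF \<psi> _ Suc_i] pick[OF x(1)] by blast
    then have "act \<psi> (\<beta> (Suc i)) = x" using pick[OF x(1)] by simp
    then show ?thesis using x(2) by simp
  qed
  have "triv (Suc i) \<chi>" using \<chi> eq by (simp add: triv_def)
  then have "act \<chi> (\<beta> (Suc i)) = act (\<lambda>_. 1) (\<beta> (Suc i))" by (simp add: triv_\<beta>)
  then have "act \<chi> \<gamma> = act (\<lambda>_. 1) \<gamma>" using *[OF \<chi>] *[OF chars_one] by metis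
  then show ?thesis by simp
qed

text \<open>Separation by characters turns the invariance of \<open>\<gamma>\<close> into a bound
  for its support. In particular the next exponent \<open>H (Suc i)\<close> is absent from
  \<open>\<gamma>\<close>.\<close>

lemma cf_\<gamma>: "a \<notin> M (Suc i) \<Longrightarrow> cf \<gamma> a = 0"
proof -
  assume a: "a \<notin> M (Suc i)"
  obtain \<chi> :: "('a \<Rightarrow> rat) \<Rightarrow> 'b" where \<chi>: "\<chi> \<in> chars" "\<forall>a\<in>M (Suc i). \<chi> a = 1" "\<chi> a \<noteq> 1"
    using char_separate[OF K _ a] by auto
  have "act \<chi> \<gamma> = \<gamma>" using \<chi> nth_mem_char_lat by (intro act_\<gamma>_eq) blast+
  then have "cf (act \<chi> \<gamma>) a = cf \<gamma> a" by (simp only:)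
  then show ?thesis using \<chi>(3) by simp
qed

lemma \<Gamma>_diff:
  assumes "x \<in> \<Gamma>" "y \<in> \<Gamma>" "x \<noteq> y"
  shows "\<exists>j\<le>i. lead (H j) (x - y)"
proof -
  obtain \<chi> \<psi> where \<chi>: "\<chi> \<in> chars" "x = act \<chi> \<gamma>" and \<psi>: "\<psi> \<in> chars" "y = act \<psi> \<gamma>"
    using assms by (auto simp: \<Gamma>_def)
  have "\<not> (\<forall>l<Suc i. \<chi> (H l) = \<psi> (H l))"
  proof
    assume eq: "\<forall>l<Suc i. \<chi> (H l) = \<psi> (H l)"
    have "act (\<lambda>a. inverse (\<chi> a) * \<psi> a) \<gamma> = \<gamma>"
      using eq chars_nz[OF \<psi>(1)] by (intro act_\<gamma>_eq quot_chars \<chi> \<psi>) simp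
    then have "x - y = 0" unfolding \<chi>(2) \<psi>(2) act_quot[OF \<chi>(1) \<psi>(1)] using \<chi>(1) by simp
    then show False using assms(3) by simp
  qed
  then show ?thesis using lead_act_\<gamma>_diff[OF \<chi>(1) \<psi>(1)] \<chi>(2) \<psi>(2) by blast
qed

text \<open>\<open>H_notin\<close> provides a character that is trivial on \<open>M j\<close> and
  moves \<open>H j\<close>.\<close>

lemma \<Gamma>_realized:
  assumes j: "j \<le> i"
  shows "\<exists>x\<in>\<Gamma>. lead (H j) (\<gamma> - x)"
proof -
  have js: "j < length hs" using j i by simp
  obtain \<chi> :: "('a \<Rightarrow> rat) \<Rightarrow> 'b" where \<chi>: "\<chi> \<in> chars" "\<forall>a\<in>M j. \<chi> a = 1" "\<chi> (H j) \<noteq> 1"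
    using char_separate[OF K _ H_notin[OF js]] by auto
  have "triv j \<chi>" using \<chi> char_lat_triv by blast
  then have "lead (H j) (\<gamma> - act \<chi> \<gamma>)" using \<chi>(3) j by (intro lead_\<gamma>(1))
  then show ?thesis using \<chi>(1) by (auto simp: \<Gamma>_def)
qed

text \<open>The factors of g(\<alpha>) other than \<open>\<alpha> - \<gamma>\<close> contribute
  exactly \<open>ss (Suc i)\<close>, so divisibility by \<open>bb (Suc i)\<close> leaves at least
  \<open>H (Suc i)\<close> for that difference. The coefficient there is that of
  \<open>\<alpha>\<close>, because this exponent is absent from \<open>\<gamma>\<close>.\<close>

lemma
  assumes Si: "Suc i < length hs" and md: "mdvd (bb (Suc i)) (poly g \<alpha>)"
  shows lead_\<gamma>_next: "lead (H (Suc i)) (\<gamma> - \<alpha>)" and lead_g_next: "lead (bb (Suc i)) (poly g \<alpha>)"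
proof -
  let ?B = "B (Suc i)" let ?b = "\<beta> (Suc i)"
  have "\<forall>x\<in>?B - {?b}. \<exists>e. lead e (\<alpha> - x) \<and> lead e (\<alpha> - \<phi> x)"
  proof
    fix x assume x: "x \<in> ?B - {?b}"
    then have p: "pick x \<in> chars" "x = act (pick x) ?b" using pick by auto
    then have "\<not> triv (Suc i) (pick x)" using triv_\<beta> x by auto
    then obtain j where j: "j < Suc i" "triv j (pick x)" "pick x (H j) \<noteq> 1" using first_diff[OF p(1)] by blast
    have "lead (H j) (\<alpha> - act (pick x) ?b)" using j Suc_i by (intro lead_\<alpha>_act_\<beta>) auto
    then have "lead (H j) (\<alpha> - x)" using p(2) by simp
    moreover have "lead (H j) (\<alpha> - \<phi> x)" using j by (intro lead_\<gamma>(2)) auto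
    ultimately show "\<exists>e. lead e (\<alpha> - x) \<and> lead e (\<alpha> - \<phi> x)" by blast
  qed
  from bchoice[OF this] obtain e where e: "\<And>x. x \<in> ?B - {?b} \<Longrightarrow> lead (e x) (\<alpha> - x) \<and> lead (e x) (\<alpha> - \<phi> x)"
    by blast
  have se: "(\<Sum>x\<in>?B - {?b}. e x) = ss (Suc i)"
    by (rule lead_unique[OF lead_prod lead_ss[OF Suc_i]]) (use e in blast)
  have lo: "lead (ss (Suc i)) (\<Prod>x\<in>?B - {?b}. \<alpha> - \<phi> x)"
    unfolding se[symmetric] by (rule lead_prod) (use e in blast)
  \<comment> \<open>\<open>pick\<close> need not choose the trivial character at
    \<open>\<beta> (Suc i)\<close>, but whatever it chooses fixes \<open>\<gamma>\<close>.\<close>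
  have "\<phi> ?b = \<gamma>"
  proof (rule act_\<gamma>_eq)
    show p: "pick ?b \<in> chars" using pick[OF \<beta>_in_B] by blast
    have "act (pick ?b) ?b = act (\<lambda>_. 1) ?b" using pick[OF \<beta>_in_B[of "Suc i"]] by simp
    then show "\<forall>l<Suc i. pick ?b (H l) = 1" using act_\<beta>_eq[OF p chars_one Suc_i] by blast
  qed
  then have ga: "poly g \<alpha> = (\<alpha> - \<gamma>) * (\<Prod>x\<in>?B - {?b}. \<alpha> - \<phi> x)"
    unfolding g_eq_\<phi> poly_prod_linear
    using prod.reindex[OF inj_\<phi>, of "\<lambda>x. \<alpha> - x"] prod.remove[OF finite_B[OF Suc_i] \<beta>_in_B, of "\<lambda>x. \<alpha> - \<phi> x"]
    by simp
  have "mdvd (H (Suc i) + ss (Suc i)) ((\<alpha> - \<gamma>) * (\<Prod>x\<in>?B - {?b}. \<alpha> - \<phi> x))"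
    using md unfolding ga bb_def by (simp only: add.commute)
  then have "mdvd (H (Suc i)) (\<alpha> - \<gamma>)" by (rule mdvd_cancel[OF lo])
  moreover have "cf (\<alpha> - \<gamma>) (H (Suc i)) \<noteq> 0" using cf_\<gamma>[OF H_notin[OF Si]] cf_H[OF Si] by simp
  ultimately have l: "lead (H (Suc i)) (\<alpha> - \<gamma>)" by (simp add: lead_def del: cf_diff)
  then show "lead (H (Suc i)) (\<gamma> - \<alpha>)" by (rule lead_minus_commute)
  show "lead (bb (Suc i)) (poly g \<alpha>)"
    unfolding ga bb_def using lead_mult[OF l lo] by (simp only: add.commute)
qed

end

section \<open>The irreducibility criterion\<close>

lemma lead_prod_factor:
  fixes f :: "'b \<Rightarrow> ('n::finite, 'a::idom) fser"
  assumes "finite A" "lead e (\<Prod>x\<in>A. f x)" "x \<in> A"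
  shows "\<exists>e. lead e (f x)"
proof -
  have "lead e (f x * (\<Prod>y\<in>A - {x}. f y))" using assms prod.remove[OF assms(1,3), of f] by simp
  then show ?thesis by (rule lead_factor)
qed

lemma lead_prod_ex:
  fixes f :: "'b \<Rightarrow> ('n::finite, 'a::idom) fser"
  assumes "\<And>x. x \<in> A \<Longrightarrow> \<exists>e. lead e (f x)"
  shows "\<exists>e. lead e (\<Prod>x\<in>A. f x)"
proof -
  have "\<forall>x\<in>A. \<exists>e. lead e (f x)" using assms by blast
  from bchoice[OF this] obtain e where "\<And>x. x \<in> A \<Longrightarrow> lead (e x) (f x)" by blast
  then show ?thesis using lead_prod by blast
qed

text \<open>The discriminant is the product of all differences of roots up to sign, and by
  \<open>lead_factor\<close> a product is a monomial times a unit exactly if all its factors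
  are.\<close>

lemma quasi_ordinary_iff_differences:
  fixes A :: "('n::finite, 'a::field) fser set"
  assumes A: "finite A" and i: "ipoly (\<Prod>x\<in>A. [:- x, 1:])"
  shows "quasi_ordinary (ypol_of (\<Prod>x\<in>A. [:- x, 1:])) \<longleftrightarrow>
    (\<forall>x\<in>A. \<forall>y\<in>A. x \<noteq> y \<longrightarrow> (\<exists>e. lead e (x - y)))"
proof -
  have eq: "(\<Prod>x\<in>A. poly (pderiv (\<Prod>x\<in>A. [:- x, 1:])) x) = (\<Prod>x\<in>A. \<Prod>y\<in>A - {x}. x - y)"
    by (rule prod.cong) (simp_all add: poly_pderiv_prod_linear[OF A])
  show ?thesis
    unfolding quasi_ordinary_ypol_of[OF A refl i] eq
  proof
    assume "\<exists>q. lead q (\<Prod>x\<in>A. \<Prod>y\<in>A - {x}. x - y)"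
    then obtain q where q: "lead q (\<Prod>x\<in>A. \<Prod>y\<in>A - {x}. x - y)" by blast
    show "\<forall>x\<in>A. \<forall>y\<in>A. x \<noteq> y \<longrightarrow> (\<exists>e. lead e (x - y))"
    proof (intro ballI impI)
      fix x y assume xy: "x \<in> A" "y \<in> A" "x \<noteq> y"
      obtain e where "lead e (\<Prod>y\<in>A - {x}. x - y)" using lead_prod_factor[OF A q xy(1)] by blast
      then show "\<exists>e. lead e (x - y)" using A xy by (intro lead_prod_factor[of "A - {x}" e]) auto
    qed
  next
    assume "\<forall>x\<in>A. \<forall>y\<in>A. x \<noteq> y \<longrightarrow> (\<exists>e. lead e (x - y))"
    then show "\<exists>q. lead q (\<Prod>x\<in>A. \<Prod>y\<in>A - {x}. x - y)"
      by (intro lead_prod_ex) auto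
  qed
qed

text \<open>A factor with integral exponents that vanishes at \<open>\<gamma>\<close> vanishes on
  the whole orbit and so has full degree. The cofactor is then a constant whose inverse is the
  leading coefficient of that factor.\<close>

lemma yirreducible_orbit:
  fixes \<gamma> :: "('n::finite, 'a::field) fser"
  defines "A \<equiv> {act \<chi> \<gamma> | \<chi>. \<chi> \<in> chars}"
  assumes A: "finite A" and i: "ipoly (\<Prod>x\<in>A. [:- x, 1:])"
  shows "yirreducible (ypol_of (\<Prod>x\<in>A. [:- x, 1:]))"
proof -
  define p where "p = (\<Prod>x\<in>A. [:- x, 1:])"
  have "\<gamma> \<in> A" unfolding A_def by (rule CollectI, rule exI[of _ "\<lambda>_. 1"]) simp
  then have card: "0 < card A" using A by (auto simp: card_gt_0_iff)
  have dp: "degree p = card A" "lead_coeff p = 1"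
    unfolding p_def by (rule degree_prod_linear lead_coeff_prod_linear)+
  have p0: "p \<noteq> 0" using dp(2) by auto
  have nounit: "p * q \<noteq> 1" for q
  proof
    assume pq: "p * q = 1"
    then have "q \<noteq> 0" by auto
    then have "degree (p * q) = card A + degree q" using p0 dp by (simp add: degree_mult_eq)
    then show False using pq card by simp
  qed
  have unit: "\<exists>u. ipoly u \<and> r * u = 1" if q: "ipoly q" "p = q * r" "poly q \<gamma> = 0" for q r
  proof -
    have "poly q x = 0" if "x \<in> A" for x using that poly_act[OF q(1)] q(3) by (auto simp: A_def)
    then have "p dvd q" unfolding p_def using A by (intro prod_linear_dvd)
    moreover have qr: "q \<noteq> 0" "r \<noteq> 0" using p0 q(2) by auto
    ultimately have "degree p \<le> degree q" by (intro dvd_imp_degree_le)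
    then have "degree r = 0" using q(2) qr by (simp add: degree_mult_eq)
    then obtain c where c: "r = [:c:]" by (auto elim: degree_eq_zeroE)
    have "lead_coeff q * lead_coeff r = 1" using dp(2) unfolding q(2) lead_coeff_mult .
    then have "lead_coeff q * c = 1" by (simp add: c)
    then have "r * [:lead_coeff q:] = 1" by (simp add: c one_pCons mult.commute)
    moreover have "ipoly [:lead_coeff q:]" using q(1) by (auto simp: ipoly_def coeff_pCons split: nat.splits)
    ultimately show ?thesis by blast
  qed
  have "(\<exists>u. ipoly u \<and> q * u = 1) \<or> (\<exists>u. ipoly u \<and> r * u = 1)" if "ipoly q" "ipoly r" "p = q * r" for q r
  proof -
    have "poly p \<gamma> = 0" using \<open>\<gamma> \<in> A\<close> A unfolding p_def poly_prod_linear by (auto simp: prod_zero_iff)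
    then have "poly q \<gamma> = 0 \<or> poly r \<gamma> = 0" by (simp add: that(3))
    then show ?thesis using unit[of q r] unit[of r q] that by (auto simp: mult.commute)
  qed
  then show ?thesis using i p0 nounit unfolding p_def[symmetric] yirreducible_ypol_of by blast
qed

lemma contact_set:
  fixes A :: "('n::finite, 'a::field) fser set"
  assumes A: "finite A"
  shows "{contact x y | x y. x \<in> Zer (ypol_of (\<Prod>x\<in>A. [:- x, 1:])) \<and> y \<in> Zer (ypol_of (\<Prod>x\<in>A. [:- x, 1:])) \<and> x \<noteq> y}
    = {contact (cf x) (cf y) | x y. x \<in> A \<and> y \<in> A \<and> x \<noteq> y}"
proof -
  have "Zer (ypol_of (\<Prod>x\<in>A. [:- x, 1:])) = cf ` A"
    unfolding Zer_ypol_of poly_prod_linear using A by (auto simp: prod_zero_iff)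
  then show ?thesis by (auto simp: cf_inject) (metis cf_inject imageI)
qed

text \<open>The orbit polynomial of a root has integral exponents and divides f, so irreducibility
  makes it equal to f. Quasi-ordinarity then gives every difference of conjugates a leading
  exponent, which is its contact.\<close>

lemma ex_branch:
  fixes f :: "('n::finite, 'a::field_char_0) ypol"
  assumes K: "alg_closed_field TYPE('a)" and qo: "quasi_ordinary f" and irr: "yirreducible f"
    and ch: "is_characteristic f hs" and ne: "hs \<noteq> []"
  shows "\<exists>\<alpha>. branch \<alpha> hs \<and> f = ypol_of (branch.P \<alpha> hs (length hs))"
proof -
  have "ymonic f" using qo by (simp add: quasi_ordinary_def)
  then obtain p where f: "f = ypol_of p" "ipoly p" using ypoly_imp_ypol_of unfolding ymonic_def by blast
  then have lp: "lead_coeff p = 1" using \<open>ymonic f\<close> ymonic_ypol_of by blast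
  have "hd hs \<in> set hs" using ne by simp
  also have "set hs = {contact x y | x y. x \<in> Zer f \<and> y \<in> Zer f \<and> x \<noteq> y}"
    using ch unfolding is_characteristic_def by (rule conjunct2)
  finally obtain x where "x \<in> Zer f" by auto
  then obtain \<alpha> where \<alpha>: "poly p \<alpha> = 0" unfolding f Zer_ypol_of by blast
  define A where "A = {act \<chi> \<alpha> | \<chi>. \<chi> \<in> chars}"
  have \<alpha>A: "\<alpha> \<in> A" unfolding A_def by (rule CollectI, rule exI[of _ "\<lambda>_. 1"]) simp
  have p0: "p \<noteq> 0" using lp by auto
  have roots: "poly p x = 0" if "x \<in> A" for x using that poly_act[OF f(2)] \<alpha> by (auto simp: A_def)
  then have "A \<subseteq> {x. poly p x = 0}" by blast
  then have A: "finite A" using poly_roots_finite[OF p0] by (rule finite_subset)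
  define P where "P = (\<Prod>x\<in>A. [:- x, 1:])"
  have "act \<chi> ` A \<subseteq> A" if "\<chi> \<in> chars" for \<chi>
    using that chars_mult by (fastforce simp: A_def act_act)
  then have iP: "ipoly P" unfolding P_def by (intro ipoly_prod_linear[OF K A])
  have dP: "degree P = card A" "lead_coeff P = 1"
    unfolding P_def by (rule degree_prod_linear lead_coeff_prod_linear)+
  have cA: "0 < card A" using A \<alpha>A by (auto simp: card_gt_0_iff)
  have "0 < degree P" using dP cA by simp
  \<comment> \<open>Division with remainder yields a cofactor with integral exponents, as
    irreducibility requires; divisibility by P is at first known only over all fractional
    series.\<close>
  then obtain q r where q: "ipoly q" "p = q * P + r" "degree r < degree P"
    using monic_division[OF iP dP(2) _ f(2)] by blast
  have "P dvd p" unfolding P_def using A roots by (intro prod_linear_dvd)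
  then have "P dvd r" using q(2) by (simp add: dvd_add_right_iff)
  then have "r = 0" using q(3) dvd_imp_degree_le[of P r] by force
  then have pq: "p = q * P" using q(2) by simp
  have "(\<exists>u. ipoly u \<and> q * u = 1) \<or> (\<exists>u. ipoly u \<and> P * u = 1)"
    using irr q(1) iP pq unfolding f yirreducible_ypol_of by blast
  moreover have "P * u \<noteq> 1" for u
  proof
    assume "P * u = 1"
    moreover from this have "P \<noteq> 0" "u \<noteq> 0" by auto
    ultimately have "degree P + degree u = 0" by (metis degree_1 degree_mult_eq)
    then show False using dP cA by simp
  qed
  ultimately obtain u where u: "q * u = 1" by blast
  then have "q \<noteq> 0" "u \<noteq> 0" by auto
  then have "degree q = 0" using u by (metis add_is_0 degree_1 degree_mult_eq)
  moreover have "lead_coeff q = 1" using lp dP(2) unfolding pq by (simp add: lead_coeff_mult)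
  ultimately have "q = 1" by (intro monic_degree_0)
  then have p: "p = P" using pq by simp
  have diff: "\<exists>e. lead e (x - y)" if "x \<in> A" "y \<in> A" "x \<noteq> y" for x y
    using qo quasi_ordinary_iff_differences[OF A iP[unfolded P_def]] that unfolding f(1) p P_def by blast
  have set: "set hs = {contact (cf x) (cf y) | x y. x \<in> A \<and> y \<in> A \<and> x \<noteq> y}"
    using ch unfolding is_characteristic_def f(1) p P_def contact_set[OF A] by (rule conjunct2)
  have br: "branch \<alpha> hs"
  proof
    show "alg_closed_field TYPE('a)" by (rule K)
    show "sorted_wrt (<) hs" using ch by (simp add: is_characteristic_def)
    show "\<exists>h\<in>set hs. lead h (\<alpha> - act \<chi> \<alpha>)" if \<chi>: "\<chi> \<in> chars" "act \<chi> \<alpha> \<noteq> \<alpha>" for \<chi>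
    proof -
      have "act \<chi> \<alpha> \<in> A" using \<chi> by (auto simp: A_def)
      then obtain e where e: "lead e (\<alpha> - act \<chi> \<alpha>)" using diff \<alpha>A \<chi>(2) by metis
      have "contact (cf \<alpha>) (cf (act \<chi> \<alpha>)) \<in> set hs"
        unfolding set using \<open>act \<chi> \<alpha> \<in> A\<close> \<alpha>A \<chi>(2)
        by (intro CollectI exI[of _ \<alpha>] exI[of _ "act \<chi> \<alpha>"]) auto
      then show ?thesis using e contact_cf[OF e] by auto
    qed
    show "\<exists>\<chi>\<in>chars. lead h (\<alpha> - act \<chi> \<alpha>)" if h: "h \<in> set hs" for h
    proof -
      obtain x y where xy: "h = contact (cf x) (cf y)" "x \<in> A" "y \<in> A" "x \<noteq> y" using h unfolding set by blast
      obtain \<chi> \<psi> where \<chi>: "\<chi> \<in> chars" "x = act \<chi> \<alpha>" and \<psi>: "\<psi> \<in> chars" "y = act \<psi> \<alpha>"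
        using xy by (auto simp: A_def)
      obtain e where e: "lead e (x - y)" using diff xy by blast
      then have "h = e" using contact_cf xy(1) by simp
      have "x - y = act \<chi> (\<alpha> - act (\<lambda>a. inverse (\<chi> a) * \<psi> a) \<alpha>)"
        unfolding \<chi>(2) \<psi>(2) by (rule act_quot[OF \<chi>(1) \<psi>(1)])
      then have "lead h (\<alpha> - act (\<lambda>a. inverse (\<chi> a) * \<psi> a) \<alpha>)"
        using e \<chi>(1) \<open>h = e\<close> by (simp only: lead_act)
      then show ?thesis using quot_chars[OF \<chi>(1) \<psi>(1)] by blast
    qed
  qed
  have "A = branch.B \<alpha> hs (length hs)"
    unfolding branch.B_def[OF br] branch.\<beta>_s[OF br] A_def ..
  then have "f = ypol_of (branch.P \<alpha> hs (length hs))"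
    unfolding branch.P_def[OF br] f(1) p P_def by simp
  then show ?thesis using br by blast
qed

context branch
begin

lemma char_n_eq: "char_n hs (Suc l) = n l"
  by (rule char_n_Suc)

lemma prod_char_n: "(\<Prod>j\<in>{1..k}. char_n hs j) = N k"
proof (induction k)
  case (Suc k)
  have "{1..Suc k} = insert (Suc k) {1..k}" by auto
  then show ?case using Suc by (simp add: N_Suc char_n_eq mult.commute)
qed simp

lemma char_e_eq: "i < s \<Longrightarrow> char_e hs i = n i * char_e hs (Suc i)"
  unfolding char_e_def using prod.atLeast_Suc_atMost[of "Suc i" s "char_n hs"] by (simp add: char_n_eq)

lemma N_char_e: "i \<le> s \<Longrightarrow> N i * char_e hs i = N s"
proof (induction rule: inc_induct)
  case base
  show ?case by (simp add: char_e_def)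
next
  case (step i)
  then show ?case using char_e_eq[of i] by (simp add: N_Suc mult_ac)
qed

text \<open>Both sides satisfy one recursion: \<open>char_q\<close> grows by
  \<open>char_e hs (Suc i)\<close> times the difference of consecutive exponents, and
  \<open>bb_Suc\<close> gives the same because e_i = n_(i+1) e_(i+1).\<close>

lemma char_q_eq: "i < s \<Longrightarrow> char_q hs (Suc i) t = of_nat (char_e hs i) * bb i t"
proof (induction i)
  case 0
  show ?case by (simp add: char_q_def bb_def algebra_simps)
next
  case (Suc i)
  let ?e = "char_e hs"
  have "char_q hs (Suc (Suc i)) t = char_q hs (Suc i) t + of_nat (?e (Suc i)) * (H (Suc i) t - H i t)"
    by (simp add: char_q_def algebra_simps)
  also have "\<dots> = of_nat (?e (Suc i)) * (of_nat (n i) * bb i t + (H (Suc i) t - H i t))"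
    using Suc char_e_eq[of i] by (simp add: algebra_simps)
  also have "of_nat (n i) * bb i t + (H (Suc i) t - H i t) = bb (Suc i) t"
    using fun_cong[OF bb_Suc[of i], of t] by simp
  finally show ?case .
qed

text \<open>Translates the exponent of the resultant, a product over \<open>N s\<close> conjugates,
  into the exponent for a single conjugate.\<close>

lemma scaled_char_q:
  assumes "i < s"
  shows "of_nat d * char_q hs (Suc i) t / of_nat (N s) = nsm d (QQ i) t"
proof -
  have N: "N s = N i * char_e hs i" using N_char_e[of i] assms by simp
  then have "char_e hs i \<noteq> 0" using N_pos[of s] by auto
  then show ?thesis using N_pos[of i] by (simp add: char_q_eq[OF assms] N QQ_def)
qed

lemma poly_conjugates:
  assumes "ipoly g" "x \<in> B s"
  shows "\<exists>\<chi>\<in>chars. poly g x = act \<chi> (poly g \<alpha>)"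
  using assms poly_act by (fastforce simp: B_def \<beta>_s)

lemma lead_norm:
  assumes g: "ipoly g" and l: "lead e (poly g \<alpha>)"
  shows "lead (nsm (N s) e) (\<Prod>x\<in>B s. poly g x)"
proof -
  have "lead (\<Sum>x\<in>B s. e) (\<Prod>x\<in>B s. poly g x)"
    using poly_conjugates[OF g] l by (intro lead_prod) fastforce
  then show ?thesis unfolding sum_const_nsm card_B[OF order_refl] .
qed

text \<open>Characters do not change supports, so all \<open>N s\<close> factors have the same least
  exponent for each enumeration, and that of the product is \<open>N s\<close> times it.\<close>

lemma mdvd_norm:
  assumes g: "ipoly g" and R: "mdvd v (\<Prod>x\<in>B s. poly g x)"
  shows "mdvd (\<lambda>j. v j / of_nat (N s)) (poly g \<alpha>)"
proof (rule mdvdI_lm)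
  fix j and xs :: "'n list" assume xs: "set (j # xs) = UNIV" and nz: "poly g \<alpha> \<noteq> 0"
  have c: "poly g x \<noteq> 0" "lm (j # xs) (poly g x) = lm (j # xs) (poly g \<alpha>)" if "x \<in> B s" for x
    using poly_conjugates[OF g that] nz by auto
  have fin: "finite (B s)" using finite_B by simp
  have "(\<Prod>x\<in>B s. poly g x) \<noteq> 0" using c fin by (simp add: prod_zero_iff)
  then have "v \<le> lm (j # xs) (\<Prod>x\<in>B s. poly g x)" using mdvd_lm[OF xs _ R] by blast
  also have "lm (j # xs) (\<Prod>x\<in>B s. poly g x) = (\<Sum>x\<in>B s. lm (j # xs) (poly g x))"
    using c by (intro lm_prod[OF xs fin])
  also have "\<dots> = (\<Sum>x\<in>B s. lm (j # xs) (poly g \<alpha>))" by (rule sum.cong) (use c in auto)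
  also have "\<dots> = nsm (N s) (lm (j # xs) (poly g \<alpha>))" unfolding sum_const_nsm card_B[OF order_refl] ..
  finally have "v j \<le> of_nat (N s) * lm (j # xs) (poly g \<alpha>) j" by (auto simp: le_fun_def)
  then show "v j / of_nat (N s) \<le> lm (j # xs) (poly g \<alpha>) j"
    using N_pos[of s] by (simp add: divide_le_eq mult.commute)
qed

text \<open>If the bound were attained, g(\<alpha>) would be a monomial times a unit, and the
  product of its conjugates would have the nonzero coefficient at v that is excluded.\<close>

lemma sdvd_norm:
  assumes g: "ipoly g" and R: "sdvd v (\<Prod>x\<in>B s. poly g x)"
  shows "sdvd (\<lambda>j. v j / of_nat (N s)) (poly g \<alpha>)"
proof (rule ccontr)
  define e where "e = (\<lambda>j. v j / of_nat (N s))"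
  have m: "mdvd e (poly g \<alpha>)" using mdvd_norm[OF g, of v] R by (simp only: sdvd_iff e_def)
  assume "\<not> sdvd (\<lambda>j. v j / of_nat (N s)) (poly g \<alpha>)"
  then have "lead e (poly g \<alpha>)" using m by (simp only: sdvd_iff lead_def e_def simp_thms)
  from lead_norm[OF g this] have "lead v (\<Prod>x\<in>B s. poly g x)"
    using N_pos[of s] by (simp add: e_def nsm_def)
  then show False using R by (simp add: lead_def sdvd_iff)
qed

end

theorem theorem1p1:
  fixes f g :: "('n::finite, 'a::field_char_0) ypol"
    and hs :: "('n \<Rightarrow> rat) list"
    and k :: nat
  assumes K: "alg_closed_field TYPE('a)"
    and f_qo: "quasi_ordinary f" and f_irr: "yirreducible f"
    and f_char: "is_characteristic f hs"
    and k: "1 \<le> k" "k \<le> length hs"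
    and g_w: "weierstrass g"
    and g_deg: "ydeg g \<le> (\<Prod>j\<in>{1..k}. char_n hs j)"
    and res: "\<forall>a. yres f g a \<noteq> 0 \<longrightarrow> (\<lambda>i. of_nat (ydeg g) * char_q hs k i) < a"
  shows "(yirreducible g \<and> quasi_ordinary g \<and> ydeg g = (\<Prod>j\<in>{1..k}. char_n hs j)
           \<and> is_characteristic g (take k hs))
         \<and> (\<forall>\<gamma>\<in>Zer g. \<exists>\<alpha>\<in>Zer f. \<forall>a. ser_diff \<gamma> \<alpha> a \<noteq> 0 \<longrightarrow> hs ! (k - 1) < a)
         \<and> (k \<le> length hs - 1 \<longrightarrow>
         (\<exists>c. is_pser c \<and> yres f g = ser_mul c (ser_monom (\<lambda>i. of_nat (ydeg g) * char_q hs (k + 1) i))) \<longrightarrow>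
         (\<exists>u. is_pser u \<and> u (\<lambda>i. 0) \<noteq> 0 \<and>
              yres f g = ser_mul u (ser_monom (\<lambda>i. of_nat (ydeg g) * char_q hs (k + 1) i)))
       \<and> (\<forall>\<gamma>\<in>Zer g. \<exists>\<alpha>\<in>Zer f. ser_diff \<gamma> \<alpha> (hs ! k) \<noteq> 0 \<and>
              (\<forall>a. ser_diff \<gamma> \<alpha> a \<noteq> 0 \<longrightarrow> hs ! k \<le> a)))"
proof -
  have "hs \<noteq> []" using k by auto
  then obtain \<alpha> where br: "branch \<alpha> hs" and f: "f = ypol_of (branch.P \<alpha> hs (length hs))"
    using ex_branch[OF K f_qo f_irr f_char] by blast
  interpret branch \<alpha> hs by (rule br)
  \<comment> \<open>The statement counts characteristic exponents from 1, the locale from 0.\<close>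
  obtain i where ki: "k = Suc i" using k by (cases k) auto
  then have il: "i < s" using k ki by simp
  obtain q where gq: "g = ypol_of q" "ipoly q" "lead_coeff q = 1"
    using g_w ypoly_imp_ypol_of ymonic_ypol_of unfolding weierstrass_def ymonic_def by metis
  have dq: "ydeg g = degree q" unfolding gq(1) by (rule ydeg_ypol_of)
  define R where "R = (\<Prod>x\<in>B s. poly q x)"
  have fin: "finite (B s)" using finite_B by simp
  have yR: "yres f g = cf R" unfolding f gq(1) R_def by (rule yres_split[OF fin P_def])
  have "sdvd (\<lambda>t. of_nat (degree q) * char_q hs (Suc i) t) R"
    using res unfolding yR dq ki sdvd_def by blast
  from sdvd_norm[OF gq(2) this[unfolded R_def]]
  have "sdvd (\<lambda>t. nsm (degree q) (QQ i) t) (poly q \<alpha>)" unfolding scaled_char_q[OF il] .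
  then have sd: "sdvd (nsm (degree q) (QQ i)) (poly q \<alpha>)" .
  have le: "degree q \<le> N (Suc i)" using g_deg unfolding prod_char_n dq ki .
  note D = degree_approx_root[OF il gq(2,3) le sd]
  obtain \<gamma> where \<gamma>: "poly q \<gamma> = 0" "sdvd (H i) (\<gamma> - \<alpha>)" using ex_approx_root[OF il gq(2,3) le sd] by blast
  interpret approx_root \<alpha> hs i q \<gamma>
    by unfold_locales (use il gq D \<gamma> in auto)
  have Zf: "Zer f = cf ` B s"
    unfolding f Zer_ypol_of poly_P using fin by (auto simp: prod_zero_iff)
  have Zg: "Zer g = cf ` \<Gamma>" unfolding gq(1) Zer_ypol_of by (auto simp: roots_g)
  \<comment> \<open>A root of g is a conjugate of \<open>\<gamma>\<close>; the same character
    applied to \<open>\<alpha>\<close> gives the matching root of f, and the difference has the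
    support of \<open>\<gamma> - \<alpha>\<close>.\<close>
  have pair: "\<exists>\<chi>\<in>chars. x = act \<chi> \<gamma> \<and> cf (act \<chi> \<alpha>) \<in> Zer f \<and>
      ser_diff (cf x) (cf (act \<chi> \<alpha>)) = cf (act \<chi> (\<gamma> - \<alpha>))" if "x \<in> \<Gamma>" for x
    using that by (fastforce simp: \<Gamma>_def Zf B_def \<beta>_s ser_diff_def act_diff)
  have irr: "yirreducible g"
    using yirreducible_orbit[of \<gamma>] finite_\<Gamma> gq(2) unfolding gq(1) \<Gamma>_def[symmetric] g_eq[symmetric] by blast
  have qo: "quasi_ordinary g"
    using quasi_ordinary_iff_differences[OF finite_\<Gamma>] gq(2) \<Gamma>_diff unfolding gq(1) g_eq[symmetric] by blast
  have deg: "ydeg g = (\<Prod>j\<in>{1..k}. char_n hs j)" unfolding prod_char_n dq ki by (rule D)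
  have "set (take k hs) = (!) hs ` {0..<Suc i}" using il by (simp add: nth_image ki)
  then have setk: "set (take k hs) = {H j | j. j \<le> i}" by (auto simp: less_Suc_eq_le)
  have "{contact x y | x y. x \<in> Zer g \<and> y \<in> Zer g \<and> x \<noteq> y}
      = {contact (cf x) (cf y) | x y. x \<in> \<Gamma> \<and> y \<in> \<Gamma> \<and> x \<noteq> y}"
    using contact_set[OF finite_\<Gamma>] unfolding gq(1) g_eq[symmetric] .
  also have "\<dots> = {H j | j. j \<le> i}"
  proof (intro equalityI subsetI)
    fix h assume "h \<in> {contact (cf x) (cf y) | x y. x \<in> \<Gamma> \<and> y \<in> \<Gamma> \<and> x \<noteq> y}"
    then obtain x y where xy: "h = contact (cf x) (cf y)" "x \<in> \<Gamma>" "y \<in> \<Gamma>" "x \<noteq> y" by blast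
    then obtain j where "j \<le> i" "lead (H j) (x - y)" using \<Gamma>_diff by blast
    then show "h \<in> {H j | j. j \<le> i}" using contact_cf xy(1) by blast
  next
    fix h assume "h \<in> {H j | j. j \<le> i}"
    then obtain j where j: "h = H j" "j \<le> i" by blast
    obtain x where x: "x \<in> \<Gamma>" "lead (H j) (\<gamma> - x)" using \<Gamma>_realized[OF j(2)] by blast
    then have "\<gamma> \<noteq> x" using lead_nz[OF x(2)] by auto
    moreover have "h = contact (cf \<gamma>) (cf x)" using contact_cf[OF x(2)] j(1) by simp
    ultimately show "h \<in> {contact (cf x) (cf y) | x y. x \<in> \<Gamma> \<and> y \<in> \<Gamma> \<and> x \<noteq> y}"
      using x(1) \<gamma>_in_\<Gamma> by blast
  qed
  finally have char: "is_characteristic g (take k hs)"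
    unfolding is_characteristic_def setk using sorted sorted_wrt_take by blast
  have ii: "\<forall>\<gamma>\<in>Zer g. \<exists>\<alpha>\<in>Zer f. \<forall>a. ser_diff \<gamma> \<alpha> a \<noteq> 0 \<longrightarrow> hs ! (k - 1) < a"
  proof
    fix z assume "z \<in> Zer g"
    then obtain x where "x \<in> \<Gamma>" "z = cf x" unfolding Zg by blast
    then obtain \<chi> where \<chi>: "\<chi> \<in> chars" "cf (act \<chi> \<alpha>) \<in> Zer f"
      "ser_diff z (cf (act \<chi> \<alpha>)) = cf (act \<chi> (\<gamma> - \<alpha>))" using pair by blast
    have "sdvd (H i) (act \<chi> (\<gamma> - \<alpha>))" using \<gamma>(2) \<chi>(1) by simp
    then have "\<forall>a. ser_diff z (cf (act \<chi> \<alpha>)) a \<noteq> 0 \<longrightarrow> hs ! (k - 1) < a"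
      unfolding \<chi>(3) sdvd_def ki by simp
    then show "\<exists>\<alpha>\<in>Zer f. \<forall>a. ser_diff z \<alpha> a \<noteq> 0 \<longrightarrow> hs ! (k - 1) < a" using \<chi>(2) by blast
  qed
  have iii: "(\<exists>u. is_pser u \<and> u (\<lambda>i. 0) \<noteq> 0 \<and>
              yres f g = ser_mul u (ser_monom (\<lambda>i. of_nat (ydeg g) * char_q hs (k + 1) i)))
       \<and> (\<forall>\<gamma>\<in>Zer g. \<exists>\<alpha>\<in>Zer f. ser_diff \<gamma> \<alpha> (hs ! k) \<noteq> 0 \<and>
              (\<forall>a. ser_diff \<gamma> \<alpha> a \<noteq> 0 \<longrightarrow> hs ! k \<le> a))"
    if ks: "k \<le> length hs - 1"
      and c: "\<exists>c. is_pser c \<and> yres f g = ser_mul c (ser_monom (\<lambda>i. of_nat (ydeg g) * char_q hs (k + 1) i))"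
  proof -
    have Si: "Suc i < s" using ks k ki by simp
    define v where "v = (\<lambda>t. of_nat (ydeg g) * char_q hs (k + 1) t)"
    obtain c where c: "is_pser c" "yres f g = ser_mul c (ser_monom v)" using c unfolding v_def by blast
    have cR: "cf R a = c (a - v)" for a using c(2) unfolding yR by (simp add: ser_mul_monom)
    have "v \<le> a" if "c (a - v) \<noteq> 0" for a
      using that c(1) by (auto simp: is_pser_def frac_supp_def le_fun_def)
    then have "mdvd v R" unfolding mdvd_def cR by blast
    from mdvd_norm[OF gq(2) this[unfolded R_def]] have "mdvd (\<lambda>t. v t / of_nat (N s)) (poly q \<alpha>)" .
    \<comment> \<open>As deg g = n_1 ... n_k is already known, deg g times q_(k+1) divided by deg f
      is exactly the exponent of \<open>P (Suc i)\<close> at \<open>\<alpha>\<close>.\<close>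
    moreover have "(\<lambda>t. v t / of_nat (N s)) = bb (Suc i)"
    proof
      fix t
      have "v t / of_nat (N s) = nsm (N (Suc i)) (QQ (Suc i)) t"
        using scaled_char_q[OF Si, of "N (Suc i)" t] by (simp add: v_def dq D ki)
      then show "v t / of_nat (N s) = bb (Suc i) t" unfolding nsm_N_QQ .
    qed
    ultimately have md: "mdvd (bb (Suc i)) (poly q \<alpha>)" by simp
    have "lead (nsm (N s) (bb (Suc i))) R"
      unfolding R_def by (rule lead_norm[OF gq(2) lead_g_next[OF Si md]])
    moreover have "nsm (N s) (bb (Suc i)) = v"
      using N_pos[of s] \<open>(\<lambda>t. v t / of_nat (N s)) = bb (Suc i)\<close>[symmetric] by (simp add: nsm_def)
    ultimately have "cf R v \<noteq> 0" by (simp add: lead_def)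
    \<comment> \<open>The cofactor supplied by the divisibility hypothesis is itself the required
      unit: its constant term is the coefficient of the resultant at v.\<close>
    then have "c (\<lambda>i. 0) \<noteq> 0" by (simp add: cR zero_fun_def)
    moreover have "\<exists>\<alpha>\<in>Zer f. ser_diff z \<alpha> (hs ! k) \<noteq> 0 \<and> (\<forall>a. ser_diff z \<alpha> a \<noteq> 0 \<longrightarrow> hs ! k \<le> a)"
      if z: "z \<in> Zer g" for z
    proof -
      obtain x where "x \<in> \<Gamma>" "z = cf x" using z unfolding Zg by blast
      then obtain \<chi> where \<chi>: "\<chi> \<in> chars" "cf (act \<chi> \<alpha>) \<in> Zer f"
        "ser_diff z (cf (act \<chi> \<alpha>)) = cf (act \<chi> (\<gamma> - \<alpha>))" using pair by blast
      have "lead (H (Suc i)) (act \<chi> (\<gamma> - \<alpha>))" using lead_\<gamma>_next[OF Si md] \<chi>(1) by simp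
      then have "ser_diff z (cf (act \<chi> \<alpha>)) (hs ! k) \<noteq> 0 \<and>
          (\<forall>a. ser_diff z (cf (act \<chi> \<alpha>)) a \<noteq> 0 \<longrightarrow> hs ! k \<le> a)"
        unfolding \<chi>(3) lead_def mdvd_def ki by blast
      then show ?thesis using \<chi>(2) by blast
    qed
    ultimately show ?thesis using c unfolding v_def by blast
  qed
  show ?thesis using irr qo deg char ii iii by blast
qed

end
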